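(* Consider the real planar polynomial differential system $$\dot x=\varphi(y)-F(x),\qquad \dot y=-g(x),$$ where $\varphi(y)=a_p y^p+\cdots+a_\ell y^\ell$, $F(x)=b_q x^q+\cdots+b_m x^m$, $g(x)=c_r x^r+\cdots+c_n x^n$ are real polynomials with $a_pb_qc_ra_\ell b_mc_n\neq 0$, $1\le p\le \ell$, $1\le q\le m$, $1\le r\le n$, and suppose $a_p=-1$. Put $\hat c:=q\left|\frac{b_q}{p+1}\right|^{\frac{p+1}{p}}$ and $G(x):=\int_0^x g(s)\,ds$. Then the system is monodromic at the origin $O$ if and only if either (M1) $p(r+1)<q(p+1)$, both $p$ and $r$ are odd, and $c_r<0$; or (M2) $p(r+1)=q(p+1)$, both $p$ and $r$ are odd, and $c_r<-\hat c$. Moreover, when $O$ is monodromic, it is a center if and only if the system of equations $F(x)=F(z)$, $G(x)=G(z)$ has a unique solution $z=z(x)$ (near $x=0$) satisfying $z(0)=0$ and $z'(0)<0$.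
   Context: The equilibrium $O$ is called monodromic if no orbit tends to $O$ in a definite direction (there are no characteristic orbits), so that orbits near $O$ turn around it; a monodromic $O$ of such a system is either a center or a focus. *)

theory Defs
  imports "HOL-Analysis.Analysis" "HOL-Computational_Algebra.Polynomial"
begin

definition integral_curve ::
  "(real \<times> real \<Rightarrow> real \<times> real) \<Rightarrow> real set \<Rightarrow> (real \<Rightarrow> real \<times> real) \<Rightarrow> bool" where
  "integral_curve X S \<gamma> \<longleftrightarrow> (\<forall>t\<in>S. (\<gamma> has_vector_derivative X (\<gamma> t)) (at t within S))"

text \<open>An orbit is represented by a half-line of its time parameter, forward or backward.
  Since \<open>sgn v\<close> is \<open>v\<close> divided by its norm, convergence of \<open>sgn (\<gamma> t - P)\<close>
  says that the orbit approaches \<open>P\<close> in a definite direction.\<close>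

definition characteristic_orbit ::
  "(real \<times> real \<Rightarrow> real \<times> real) \<Rightarrow> real \<times> real \<Rightarrow> (real \<Rightarrow> real \<times> real) \<Rightarrow> bool" where
  "characteristic_orbit X P \<gamma> \<longleftrightarrow>
     (integral_curve X {0..} \<gamma> \<and> (\<forall>t\<ge>0. \<gamma> t \<noteq> P) \<and> (\<gamma> \<longlongrightarrow> P) at_top \<and>
        (\<exists>u. ((\<lambda>t. sgn (\<gamma> t - P)) \<longlongrightarrow> u) at_top)) \<or>
     (integral_curve X {..0} \<gamma> \<and> (\<forall>t\<le>0. \<gamma> t \<noteq> P) \<and> (\<gamma> \<longlongrightarrow> P) at_bot \<and>
        (\<exists>u. ((\<lambda>t. sgn (\<gamma> t - P)) \<longlongrightarrow> u) at_bot))"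

definition monodromic :: "(real \<times> real \<Rightarrow> real \<times> real) \<Rightarrow> real \<times> real \<Rightarrow> bool" where
  "monodromic X P \<longleftrightarrow> X P = 0 \<and> (\<nexists>\<gamma>. characteristic_orbit X P \<gamma>)"

text \<open>A center has a punctured neighbourhood filled with periodic orbits; the last conjunct
  excludes other equilibria, which are trivially periodic.\<close>

definition center :: "(real \<times> real \<Rightarrow> real \<times> real) \<Rightarrow> real \<times> real \<Rightarrow> bool" where
  "center X P \<longleftrightarrow> X P = 0 \<and>
     (\<exists>\<epsilon>>0. \<forall>v\<in>ball P \<epsilon> - {P}. \<exists>\<gamma> T. integral_curve X UNIV \<gamma> \<and> \<gamma> 0 = v \<and>
        T > 0 \<and> (\<forall>t. \<gamma> (t + T) = \<gamma> t) \<and> (\<exists>t. \<gamma> t \<noteq> v))"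

definition lienard_field :: "real poly \<Rightarrow> real poly \<Rightarrow> real poly \<Rightarrow> real \<times> real \<Rightarrow> real \<times> real" where
  "lienard_field \<phi> F g = (\<lambda>(x, y). (poly \<phi> y - poly F x, - poly g x))"

definition decreasing_solution :: "(real \<Rightarrow> real) \<Rightarrow> (real \<Rightarrow> real) \<Rightarrow> (real \<Rightarrow> real) \<Rightarrow> bool" where
  "decreasing_solution F G z \<longleftrightarrow>
     (\<forall>\<^sub>F x in nhds 0. F x = F (z x) \<and> G x = G (z x)) \<and>
     z 0 = 0 \<and> (\<exists>d<0. (z has_real_derivative d) (at 0))"

text \<open>Functions are total, so a solution near \<open>0\<close> can only be unique as a germ at \<open>0\<close>.\<close>

definition unique_decreasing_solution :: "(real \<Rightarrow> real) \<Rightarrow> (real \<Rightarrow> real) \<Rightarrow> bool" where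
  "unique_decreasing_solution F G \<longleftrightarrow>
     (\<exists>z. decreasing_solution F G z \<and>
        (\<forall>w. decreasing_solution F G w \<longrightarrow> (\<forall>\<^sub>F x in nhds 0. w x = z x)))"

end

theory Submission
  imports Defs "HOL-Complex_Analysis.Complex_Analysis" "HOL-Real_Asymp.Real_Asymp"
begin

text \<open>
  In the half-plane \<open>x > 0\<close> the coordinate \<open>y\<close> is monotone along orbits. Hence an orbit that stays in a
  small half-disc tends to the origin, and it does so in a definite direction because it crosses almost
  every ray in one direction only. When neither (M1) nor (M2) holds, such an orbit is produced by a
  shooting argument in a region bounded by the \<open>y\<close>-axis or by a barrier \<open>y = B(x)\<close> along which the field
  points outwards. Under (M1) or (M2) the quasi-homogeneous angle turns at least as fast as the
  logarithm of the radius changes, so an orbit tending to the origin crosses the \<open>y\<close>-axis again and again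
  and has no limiting direction.

  For the center problem, write a half-turn as a graph over the \<open>y\<close>-axis and put \<open>\<xi> = - G(x)\<close>; then
  \<open>d\<xi>/dy = \<phi>(y) - F(x)\<close> on both sides of the axis. Comparing the two sides at equal levels of \<open>G\<close>, the
  orbit closes if \<open>F\<close> takes equal values there, and otherwise, by analyticity, the difference has a sign
  near the origin and the orbit spirals.
\<close>

section \<open>Ordinary differential equations\<close>

text \<open>The threshold \<open>c_hat\<close> is an extremal value. When
  \<open>p(r+1) = q(p+1)\<close> and \<open>b < 0\<close>, the curve \<open>y = k x^s\<close> with
  \<open>s = q / p\<close> satisfies the barrier inequality to leading order if
  \<open>c + s k (- k^p - b)\<close> is positive. The maximum over \<open>k > 0\<close> is
  \<open>c + c_hat\<close>, attained at \<open>k^p = - b / (p + 1)\<close>. So barriers exist down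
  to \<open>c = - c_hat\<close>, where the leading coefficient vanishes and a further term has to
  decide. Below this value Young's inequality, used at the same optimal point, yields a definite
  rotation.

  Remaining signs and parities are carried to the half-plane \<open>x > 0\<close> by reflections and
  time reversal; hence the data enter only through their lowest terms, in a locale that is
  interpreted anew for each symmetric field.

  The field is only locally Lipschitz, so solutions are built for a truncated field and shown to
  stay where the truncation is not felt. The origin may be degenerate, so no smooth return map is
  used: only the ends of half-turns are compared, and spiralling is refuted at the point of a
  periodic orbit on the negative \<open>y\<close>-axis nearest to the origin.\<close>

lemma integral_atLeast_has_vector_derivative:
  fixes g :: "real \<Rightarrow> 'a::banach"
  assumes g: "continuous_on {0..} g" and t: "t \<ge> 0"
  shows "((\<lambda>u. integral {0..u} g) has_vector_derivative g t) (at t within {0..})"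
proof -
  have "continuous_on {0..t+1} g" by (rule continuous_on_subset[OF g]) auto
  from integral_has_vector_derivative[OF this, of t] t
  have "((\<lambda>u. integral {0..u} g) has_vector_derivative g t) (at t within {0..t+1})" by simp
  moreover have "at t within {0..t+1} = at t within {0..}"
    by (rule at_within_nhd[of _ "{..<t+1}"]) auto
  ultimately show ?thesis by simp
qed

text \<open>Picard iteration in a norm weighted by \<open>exp (- K s)\<close>: the weight makes the
  integral operator a contraction on the whole half-line at once, so no local solutions have to be
  glued. The unknown \<open>\<eta>\<close> is \<open>exp (- K s)\<close> times the displacement from
  \<open>v\<close>; it is bounded because the bound on \<open>f\<close> lets the displacement grow
  at most linearly.\<close>

lemma ode_global_forward:
  fixes f :: "'a::banach \<Rightarrow> 'a"
  assumes lip: "\<And>x y. norm (f x - f y) \<le> L * norm (x - y)" and bd: "\<And>x. norm (f x) \<le> B"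
  shows "\<exists>\<gamma>. \<gamma> 0 = v \<and> (\<forall>t\<ge>0. (\<gamma> has_vector_derivative f (\<gamma> t)) (at t within {0..}))"
proof -
  \<comment> \<open>Twice the Lipschitz constant gives the contraction factor \<open>1/2\<close>;
    the added \<open>1\<close> covers \<open>L = 0\<close> and yields
    \<open>t \<le> exp (K * t)\<close>.\<close>
  define K where "K = 2 * \<bar>L\<bar> + 1"
  have K: "K > 0" "K \<ge> 1" "\<bar>L\<bar> / K \<le> 1/2" by (auto simp: K_def field_simps)
  have lip': "norm (f x - f y) \<le> \<bar>L\<bar> * norm (x - y)" for x y
    by (rule order_trans[OF lip]) (intro mult_right_mono, auto)
  have B: "B \<ge> 0" using bd[of 0] norm_ge_zero order_trans by blast
  have "\<bar>L\<bar>-lipschitz_on UNIV f" by (rule lipschitz_onI) (auto simp: dist_norm lip')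
  then have contf: "continuous_on S f" for S
    using lipschitz_on_continuous_on continuous_on_subset by blast
  define h where "h = (\<lambda>(\<eta>::real \<Rightarrow>\<^sub>C 'a) s. f (v + exp (K * s) *\<^sub>R apply_bcontfun \<eta> s))"
  have conth: "continuous_on S (h \<eta>)" for \<eta> S
    unfolding h_def by (rule continuous_on_compose2[OF contf[of UNIV]]) (auto intro!: continuous_intros)
  define I where "I = (\<lambda>\<eta> u. integral {0..u} (h \<eta>))"
  have hI: "((I \<eta>) has_vector_derivative h \<eta> t) (at t within {0..})" if "t \<ge> 0" for \<eta> t
    unfolding I_def by (rule integral_atLeast_has_vector_derivative[OF conth that])
  have contI: "continuous_on {0..} (I \<eta>)" for \<eta>
    unfolding continuous_on_eq_continuous_within
    using hI has_vector_derivative_continuous by fastforce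
  have hint: "h \<eta> integrable_on {0..u}" for \<eta> u
    by (rule integrable_continuous_real[OF conth])
  \<comment> \<open>Bounded continuous functions are defined for all real times;
    \<open>max 0 t\<close> continues the weighted integral to negative times by its value
    \<open>0\<close> at time \<open>0\<close>.\<close>
  define W where "W = (\<lambda>\<eta> t. exp (- K * max 0 t) *\<^sub>R I \<eta> (max 0 t))"
  have te: "t * exp (- K * t) \<le> 1" if "t \<ge> 0" for t
  proof -
    have "t \<le> K * t" using K that by (simp add: mult_le_cancel_right1)
    also have "\<dots> \<le> exp (K * t)" using exp_ge_add_one_self[of "K*t"] by linarith
    finally show ?thesis by (simp add: exp_minus field_simps)
  qed
  have normI: "norm (I \<eta> t) \<le> B * t" if "t \<ge> 0" for \<eta> t
  proof -
    have "norm (I \<eta> t) \<le> integral {0..t} (\<lambda>_. B)"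
      unfolding I_def by (rule integral_norm_bound_integral) (use hint in \<open>auto simp: h_def bd\<close>)
    then show ?thesis using that by (simp add: mult.commute)
  qed
  have Wb: "W \<eta> \<in> bcontfun" for \<eta>
  proof (rule bcontfun_normI)
    show "continuous_on UNIV (W \<eta>)" unfolding W_def
      by (intro continuous_intros continuous_on_compose2[OF contI]) (auto simp: le_max_iff_disj)
    show "norm (W \<eta> t) \<le> B" for t
    proof -
      define m where "m = max 0 t"
      have m: "m \<ge> 0" by (simp add: m_def le_max_iff_disj)
      have "norm (W \<eta> t) = exp (- K * m) * norm (I \<eta> m)" by (simp add: W_def m_def)
      also have "\<dots> \<le> exp (- K * m) * (B * m)" using normI[OF m] by (intro mult_left_mono) auto
      also have "\<dots> = B * (m * exp (- K * m))" by simp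
      also have "\<dots> \<le> B * 1" using te[OF m] B by (intro mult_left_mono) auto
      finally show ?thesis by simp
    qed
  qed
  have ex_int: "integral {0..m} (\<lambda>s. exp (K * s)) = (exp (K * m) - 1) / K" if "m \<ge> 0" for m
  proof -
    have "((\<lambda>s. exp (K * s)) has_integral (exp (K * m) / K - exp (K * 0) / K)) {0..m}"
      using that K(1) by (intro fundamental_theorem_of_calculus)
        (auto intro!: derivative_eq_intros simp: has_real_derivative_iff_has_vector_derivative[symmetric])
    then show ?thesis by (auto dest!: integral_unique simp: diff_divide_distrib)
  qed
  have contr: "dist (Bcontfun (W \<eta>)) (Bcontfun (W \<theta>)) \<le> 1/2 * dist \<eta> \<theta>" for \<eta> \<theta>
  proof (rule dist_bound)
    fix t :: real
    define m where "m = max 0 t"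
    have m: "m \<ge> 0" by (simp add: m_def le_max_iff_disj)
    have "dist (W \<eta> t) (W \<theta> t) = exp (- K * m) * norm (I \<eta> m - I \<theta> m)"
      by (simp add: W_def m_def dist_norm flip: scaleR_diff_right)
    also have "I \<eta> m - I \<theta> m = integral {0..m} (\<lambda>s. h \<eta> s - h \<theta> s)"
      unfolding I_def by (rule Henstock_Kurzweil_Integration.integral_diff[OF hint hint, symmetric])
    also have "norm \<dots> \<le> integral {0..m} (\<lambda>s. (\<bar>L\<bar> * dist \<eta> \<theta>) * exp (K * s))"
    proof (rule integral_norm_bound_integral)
      show "(\<lambda>s. h \<eta> s - h \<theta> s) integrable_on {0..m}" by (intro integrable_diff hint)
      show "(\<lambda>s. (\<bar>L\<bar> * dist \<eta> \<theta>) * exp (K * s)) integrable_on {0..m}"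
        by (intro integrable_continuous_real continuous_intros)
      show "norm (h \<eta> s - h \<theta> s) \<le> (\<bar>L\<bar> * dist \<eta> \<theta>) * exp (K * s)" for s
      proof -
        have "norm (h \<eta> s - h \<theta> s) \<le> \<bar>L\<bar> * norm (exp (K * s) *\<^sub>R (\<eta> s - \<theta> s))"
          unfolding h_def by (rule order_trans[OF lip']) (simp add: scaleR_diff_right)
        also have "\<dots> \<le> \<bar>L\<bar> * (exp (K * s) * dist \<eta> \<theta>)"
          using dist_bounded[of \<eta> s \<theta>] by (intro mult_left_mono) (auto simp: dist_norm)
        finally show ?thesis by (simp add: mult_ac)
      qed
    qed
    also have "integral {0..m} (\<lambda>s. (\<bar>L\<bar> * dist \<eta> \<theta>) * exp (K * s)) = (\<bar>L\<bar> * dist \<eta> \<theta>) * ((exp (K * m) - 1) / K)"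
      using ex_int[OF m] by simp
    also have "exp (- K * m) * ((\<bar>L\<bar> * dist \<eta> \<theta>) * ((exp (K * m) - 1) / K))
      = (\<bar>L\<bar> / K) * dist \<eta> \<theta> * (1 - exp (- K * m))"
      by (simp add: field_simps flip: exp_add)
    also have "\<dots> \<le> 1/2 * dist \<eta> \<theta> * 1"
      using K m by (intro mult_mono) auto
    finally show "dist (apply_bcontfun (Bcontfun (W \<eta>)) t) (apply_bcontfun (Bcontfun (W \<theta>)) t) \<le> 1/2 * dist \<eta> \<theta>"
      by (simp add: Bcontfun_inverse[OF Wb])
  qed
  obtain \<eta> where \<eta>: "Bcontfun (W \<eta>) = \<eta>"
    using banach_fix_type[of "1/2" "\<lambda>\<eta>. Bcontfun (W \<eta>)"] contr by auto
  have \<eta>': "apply_bcontfun \<eta> t = W \<eta> t" for t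
    using arg_cong[OF \<eta>, of apply_bcontfun] by (simp add: Bcontfun_inverse[OF Wb])
  define \<gamma> where "\<gamma> = (\<lambda>t. v + I \<eta> t)"
  \<comment> \<open>Removing the weight turns the fixed-point equation into the integral equation
    for \<open>\<gamma>\<close>.\<close>
  have e: "exp (K * t) *\<^sub>R apply_bcontfun \<eta> t = I \<eta> t" if "t \<ge> 0" for t
    using that by (simp add: \<eta>' W_def flip: exp_add)
  have "(\<gamma> has_vector_derivative f (\<gamma> t)) (at t within {0..})" if "t \<ge> 0" for t
    unfolding \<gamma>_def using hI[OF that, of \<eta>] e[OF that]
    by (auto intro!: derivative_eq_intros simp: h_def)
  moreover have "\<gamma> 0 = v" by (simp add: \<gamma>_def I_def)
  ultimately show ?thesis by blast
qed

section \<open>Elementary operations on integral curves\<close>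

lemma integral_curve_reflect:
  assumes "integral_curve X S \<gamma>"
  shows "integral_curve (\<lambda>v. - X v) (uminus ` S) (\<lambda>t. \<gamma> (- t))"
  unfolding integral_curve_def
proof (intro ballI)
  fix t assume "t \<in> uminus ` S"
  then have t: "- t \<in> S" by auto
  have "((\<gamma> \<circ> uminus) has_vector_derivative (-1) *\<^sub>R X (\<gamma> (- t))) (at t within uminus ` S)"
    using assms t
    by (intro vector_diff_chain_within)
      (auto simp: integral_curve_def image_image intro!: derivative_eq_intros)
  then show "((\<lambda>t. \<gamma> (- t)) has_vector_derivative - X (\<gamma> (- t))) (at t within uminus ` S)"
    by (simp add: o_def)
qed

lemma integral_curve_shift:
  assumes "integral_curve X S \<gamma>" "\<And>t. t \<in> T \<Longrightarrow> t + s \<in> S"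
  shows "integral_curve X T (\<lambda>t. \<gamma> (t + s))"
  unfolding integral_curve_def
proof (intro ballI)
  fix t assume t: "t \<in> T"
  have "((\<gamma> \<circ> (\<lambda>t. t + s)) has_vector_derivative 1 *\<^sub>R X (\<gamma> (t + s))) (at t within T)"
    using assms t
    by (intro vector_diff_chain_within)
      (auto simp: integral_curve_def intro!: derivative_eq_intros intro: has_vector_derivative_within_subset)
  then show "((\<lambda>t. \<gamma> (t + s)) has_vector_derivative X (\<gamma> (t + s))) (at t within T)"
    by (simp add: o_def)
qed

lemma integral_curve_subset:
  "integral_curve X S \<gamma> \<Longrightarrow> T \<subseteq> S \<Longrightarrow> integral_curve X T \<gamma>"
  unfolding integral_curve_def by (meson has_vector_derivative_within_subset subsetD)

lemma integral_curve_continuous: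
  "integral_curve X S \<gamma> \<Longrightarrow> continuous_on S \<gamma>"
  unfolding integral_curve_def continuous_on_eq_continuous_within
  using has_vector_derivative_continuous by blast

lemma integral_curve_cong_field:
  "integral_curve X S \<gamma> \<Longrightarrow> (\<And>t. t \<in> S \<Longrightarrow> X (\<gamma> t) = Y (\<gamma> t)) \<Longrightarrow> integral_curve Y S \<gamma>"
  unfolding integral_curve_def by simp

text \<open>For negative times, \<open>- f\<close> is solved forward and time is reversed. At the
  junction both one-sided derivatives equal \<open>f v\<close>, so the two-sided derivative
  exists.\<close>

lemma integral_curve_global:
  fixes f :: "real \<times> real \<Rightarrow> real \<times> real"
  assumes lip: "\<And>x y. norm (f x - f y) \<le> L * norm (x - y)" and bd: "\<And>x. norm (f x) \<le> B"
  shows "\<exists>\<gamma>. \<gamma> 0 = v \<and> integral_curve f UNIV \<gamma>"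
proof -
  obtain \<alpha> where \<alpha>: "\<alpha> 0 = v" "integral_curve f {0..} \<alpha>"
    using ode_global_forward[OF lip bd, of v] by (auto simp: integral_curve_def)
  have "norm (- f x - - f y) \<le> L * norm (x - y)" for x y
    using lip[of x y] by (simp add: norm_minus_commute)
  then obtain \<beta> where \<beta>: "\<beta> 0 = v" "integral_curve (\<lambda>v. - f v) {0..} \<beta>"
    using ode_global_forward[of "\<lambda>v. - f v" L B v] bd by (auto simp: integral_curve_def)
  from integral_curve_reflect[OF \<beta>(2)] have \<beta>': "integral_curve f {..0} (\<lambda>t. \<beta> (- t))" by simp
  define \<gamma> where "\<gamma> t = (if t \<ge> 0 then \<alpha> t else \<beta> (- t))" for t
  have 1: "integral_curve f {0..} \<gamma>"
    using \<alpha>(2) unfolding integral_curve_def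
    by (auto simp: \<gamma>_def intro: has_vector_derivative_transform)
  have 2: "integral_curve f {..0} \<gamma>"
    unfolding integral_curve_def
  proof
    fix t :: real assume t: "t \<in> {..0}"
    have eq: "\<gamma> s = \<beta> (- s)" if "s \<in> {..0}" for s
      using that \<alpha>(1) \<beta>(1) by (cases "s = 0") (auto simp: \<gamma>_def)
    have "((\<lambda>t. \<beta> (- t)) has_vector_derivative f (\<gamma> t)) (at t within {..0})"
      using \<beta>' t eq[OF t] by (simp add: integral_curve_def)
    with t show "(\<gamma> has_vector_derivative f (\<gamma> t)) (at t within {..0})"
      using has_vector_derivative_transform[of t "{..0}" \<gamma> "\<lambda>t. \<beta> (- t)"] eq by blast
  qed
  have "(\<gamma> has_vector_derivative f (\<gamma> t)) (at t)" for t
  proof (cases "t = 0")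
    case True
    have "(\<gamma> has_vector_derivative f (\<gamma> t)) (at t within ({0..} \<union> {..0}))"
      using 1[unfolded integral_curve_def has_vector_derivative_def has_derivative_within, rule_format, of t]
        2[unfolded integral_curve_def has_vector_derivative_def has_derivative_within, rule_format, of t] True
      unfolding has_vector_derivative_def has_derivative_within by (intro conjI Lim_Un) auto
    moreover have "{0::real..} \<union> {..0} = UNIV" by auto
    ultimately show ?thesis by simp
  next
    case False
    then consider "t > 0" | "t < 0" by linarith
    then show ?thesis
    proof cases
      case 1
      then have "at t within {0..} = at t" by (intro at_within_interior) (auto simp: interior_Ici)
      with \<open>integral_curve f {0..} \<gamma>\<close>[unfolded integral_curve_def, rule_format, of t] \<open>t > 0\<close>
      show ?thesis by simp
    next
      case 2
      then have "at t within {..0} = at t" by (intro at_within_interior) (auto simp: interior_Iic)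
      with \<open>integral_curve f {..0} \<gamma>\<close>[unfolded integral_curve_def, rule_format, of t] \<open>t < 0\<close>
      show ?thesis by simp
    qed
  qed
  then have "integral_curve f UNIV \<gamma>" by (simp add: integral_curve_def)
  then show ?thesis by (intro exI[of _ \<gamma>]) (simp add: \<gamma>_def \<alpha>)
qed

lemma deriv_nonneg_imp_mono_open:
  fixes f :: "real \<Rightarrow> real"
  assumes "a \<le> b" "continuous_on {a..b} f"
    and "\<And>x. a < x \<Longrightarrow> x < b \<Longrightarrow> \<exists>y. DERIV f x :> y \<and> y \<ge> 0"
  shows "f a \<le> f b"
proof (cases "a = b")
  case False
  then have "a < b" using assms by simp
  then obtain l z where z: "a < z" "z < b" "DERIV f z :> l" "f b - f a = (b - a) * l"
    using MVT[of a b f] assms(2,3) by (meson real_differentiable_def)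
  then obtain y where "DERIV f z :> y" "y \<ge> 0" using assms(3) by blast
  with z have "l \<ge> 0" using DERIV_unique by blast
  with z \<open>a < b\<close> show ?thesis by (metis diff_ge_0_iff_ge less_eq_real_def mult_nonneg_nonneg)
qed simp

lemma integral_curve_components:
  fixes \<gamma> :: "real \<Rightarrow> real \<times> real"
  assumes "integral_curve X S \<gamma>" "t \<in> S"
  shows "((\<lambda>t. fst (\<gamma> t)) has_real_derivative fst (X (\<gamma> t))) (at t within S)"
    and "((\<lambda>t. snd (\<gamma> t)) has_real_derivative snd (X (\<gamma> t))) (at t within S)"
  using assms bounded_linear.has_vector_derivative[OF bounded_linear_fst, of \<gamma> "X (\<gamma> t)"]
    bounded_linear.has_vector_derivative[OF bounded_linear_snd, of \<gamma> "X (\<gamma> t)"]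
  by (simp_all add: integral_curve_def has_real_derivative_iff_has_vector_derivative)

lemma integral_curve_components_at:
  fixes \<gamma> :: "real \<Rightarrow> real \<times> real"
  assumes "integral_curve X S \<gamma>" "t \<in> interior S"
  shows "DERIV (\<lambda>t. fst (\<gamma> t)) t :> fst (X (\<gamma> t))"
    and "DERIV (\<lambda>t. snd (\<gamma> t)) t :> snd (X (\<gamma> t))"
proof -
  have "t \<in> S" using assms(2) interior_subset by blast
  note * = integral_curve_components[OF assms(1) this, unfolded at_within_interior[OF assms(2)]]
  show "DERIV (\<lambda>t. fst (\<gamma> t)) t :> fst (X (\<gamma> t))" "DERIV (\<lambda>t. snd (\<gamma> t)) t :> snd (X (\<gamma> t))"
    by (fact *)+
qed

text \<open>By Cauchy-Schwarz the squared distance has derivative at most \<open>2 L\<close> times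
  itself, so its product with \<open>exp (- 2 L t)\<close> does not increase. The square is used
  because the norm is not differentiable where the curves meet; the minus sign in \<open>w\<close>
  adapts it to the monotonicity lemma for nonnegative derivatives.\<close>

lemma integral_curve_gronwall:
  fixes f :: "real \<times> real \<Rightarrow> real \<times> real"
  assumes lip: "\<And>x y. norm (f x - f y) \<le> L * norm (x - y)"
    and \<alpha>: "integral_curve f {0..T} \<alpha>" and \<beta>: "integral_curve f {0..T} \<beta>" and T: "T \<ge> 0"
  shows "norm (\<alpha> T - \<beta> T) \<le> exp (L * T) * norm (\<alpha> 0 - \<beta> 0)"
proof -
  define w where "w t = - (exp (- 2 * L * t) * ((\<alpha> t - \<beta> t) \<bullet> (\<alpha> t - \<beta> t)))" for t
  have ineq: "(\<alpha> t - \<beta> t) \<bullet> (f (\<alpha> t) - f (\<beta> t)) \<le> L * ((\<alpha> t - \<beta> t) \<bullet> (\<alpha> t - \<beta> t))" for t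
  proof -
    have "(\<alpha> t - \<beta> t) \<bullet> (f (\<alpha> t) - f (\<beta> t)) \<le> norm (\<alpha> t - \<beta> t) * norm (f (\<alpha> t) - f (\<beta> t))"
      by (rule norm_cauchy_schwarz)
    also have "\<dots> \<le> norm (\<alpha> t - \<beta> t) * (L * norm (\<alpha> t - \<beta> t))"
      by (intro mult_left_mono lip) auto
    finally show ?thesis by (simp add: dot_square_norm power2_eq_square mult_ac)
  qed
  have "w 0 \<le> w T"
  proof (rule deriv_nonneg_imp_mono_open[OF T])
    show "continuous_on {0..T} w" unfolding w_def
      using integral_curve_continuous[OF \<alpha>] integral_curve_continuous[OF \<beta>]
      by (intro continuous_intros)
    fix t assume t: "0 < t" "t < T"
    then have ti: "t \<in> interior {0..T}" "t \<in> {0..T}" by auto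
    have d: "(\<alpha> has_vector_derivative f (\<alpha> t)) (at t)" "(\<beta> has_vector_derivative f (\<beta> t)) (at t)"
      using \<alpha> \<beta> ti(2) unfolding at_within_interior[OF ti(1), symmetric] integral_curve_def by blast+
    have "((\<lambda>t. \<alpha> t - \<beta> t) has_vector_derivative (f (\<alpha> t) - f (\<beta> t))) (at t)"
      by (intro derivative_intros d)
    then have d1: "((\<lambda>t. \<alpha> t - \<beta> t) has_derivative (\<lambda>x. x *\<^sub>R (f (\<alpha> t) - f (\<beta> t)))) (at t)"
      by (simp add: has_vector_derivative_def)
    have d2: "((\<lambda>t. (\<alpha> t - \<beta> t) \<bullet> (\<alpha> t - \<beta> t)) has_real_derivative 2 * ((\<alpha> t - \<beta> t) \<bullet> (f (\<alpha> t) - f (\<beta> t)))) (at t)"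
      unfolding has_field_derivative_def
      by (rule has_derivative_eq_rhs[OF has_derivative_inner[OF d1 d1]]) (auto simp: fun_eq_iff inner_commute)
    have e: "DERIV (\<lambda>t. exp (- 2 * L * t)) t :> - 2 * L * exp (- 2 * L * t)"
      by (auto intro!: derivative_eq_intros)
    have "DERIV w t :> - (exp (- 2 * L * t) * (2 * ((\<alpha> t - \<beta> t) \<bullet> (f (\<alpha> t) - f (\<beta> t)))
        - 2 * L * ((\<alpha> t - \<beta> t) \<bullet> (\<alpha> t - \<beta> t))))"
      unfolding w_def by (rule DERIV_cong[OF DERIV_minus[OF DERIV_mult[OF e d2]]]) (simp add: right_diff_distrib)
    then show "\<exists>y. DERIV w t :> y \<and> y \<ge> 0"
      using ineq[of t] by (intro exI conjI) (auto simp: mult_le_0_iff)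
  qed
  then have "exp (- 2 * L * T) * (norm (\<alpha> T - \<beta> T))\<^sup>2 \<le> (norm (\<alpha> 0 - \<beta> 0))\<^sup>2"
    by (simp add: w_def power2_norm_eq_inner)
  then have "(norm (\<alpha> T - \<beta> T))\<^sup>2 \<le> exp (2 * L * T) * (norm (\<alpha> 0 - \<beta> 0))\<^sup>2"
    by (simp add: exp_minus field_simps)
  also have "\<dots> = (exp (L * T) * norm (\<alpha> 0 - \<beta> 0))\<^sup>2"
    by (simp add: power_mult_distrib flip: exp_double)
  finally show ?thesis by (rule power2_le_imp_le) auto
qed

lemma integral_curve_flip:
  assumes "integral_curve f {a..b} \<theta>"
  shows "integral_curve (\<lambda>v. - f v) {0..b-a} (\<lambda>t. \<theta> (b - t))"
  using integral_curve_shift[OF integral_curve_reflect[OF assms], of "{0..b-a}" "-b"] by auto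

text \<open>Backward control is what lets a limit of exit points carry whole backward orbits with
  it.\<close>

lemma integral_curve_gronwall_back:
  fixes f :: "real \<times> real \<Rightarrow> real \<times> real"
  assumes lip: "\<And>x y. norm (f x - f y) \<le> L * norm (x - y)"
    and \<alpha>: "integral_curve f {a..b} \<alpha>" and \<beta>: "integral_curve f {a..b} \<beta>" and T: "a \<le> b"
  shows "norm (\<alpha> a - \<beta> a) \<le> exp (L * (b - a)) * norm (\<alpha> b - \<beta> b)"
proof -
  have "norm (- f x - - f y) \<le> L * norm (x - y)" for x y
    using lip[of x y] by (simp add: norm_minus_commute)
  from integral_curve_gronwall[OF this integral_curve_flip[OF \<alpha>] integral_curve_flip[OF \<beta>]] T show ?thesis by simp
qed

text \<open>At the last instant where \<open>w \<ge> 0\<close> the derivative would have the wrong sign.\<close>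

lemma cross_pos:
  fixes w :: "real \<Rightarrow> real"
  assumes ab: "a < b" and cont: "continuous_on {a..b} w" and wa: "w a \<ge> 0"
    and der: "\<And>t. t \<in> {a..b} \<Longrightarrow> w t = 0 \<Longrightarrow> \<exists>d>0. (w has_real_derivative d) (at t within {a..b})"
  shows "w b > 0"
proof -
  have neg: False if c: "a < c" "c \<le> b" "w c < 0" for c
  proof -
    have contc: "continuous_on {a..c} w" by (rule continuous_on_subset[OF cont]) (use c in auto)
    define Z where "Z = {t\<in>{a..c}. w t \<ge> 0}"
    have "closed Z" unfolding Z_def
      using continuous_on_closed_Collect_le[of "{a..c}" "\<lambda>_. 0" w] contc by simp
    moreover have "bounded Z" by (rule bounded_subset[of "{a..c}"]) (auto simp: Z_def)
    ultimately have "compact Z" by (simp add: compact_eq_bounded_closed)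
    moreover have "a \<in> Z" using wa c by (simp add: Z_def)
    ultimately obtain s where s: "s \<in> Z" "\<And>t. t \<in> Z \<Longrightarrow> t \<le> s"
      using compact_attains_sup[of Z] by (metis empty_iff)
    have "s \<noteq> c" using s(1) c by (auto simp: Z_def)
    then have sc: "a \<le> s" "s < c" using s(1) by (auto simp: Z_def)
    have after: "w t < 0" if "s < t" "t \<le> c" for t
    proof (rule ccontr)
      assume "\<not> w t < 0"
      then have "t \<in> Z" using that sc by (simp add: Z_def)
      with s(2)[of t] that show False by simp
    qed
    have "w s = 0"
    proof (rule ccontr)
      assume "w s \<noteq> 0"
      then have "w s > 0" using s(1) by (auto simp: Z_def)
      moreover have "continuous_on {s..c} w" by (rule continuous_on_subset[OF contc]) (use sc in auto)
      ultimately obtain t where t: "s \<le> t" "t \<le> c" "w t = 0"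
        using IVT2'[of w c 0 s] c sc by auto
      then have "t \<in> Z" using sc by (auto simp: Z_def)
      then have "t = s" using s(2)[of t] t by simp
      with t \<open>w s > 0\<close> show False by simp
    qed
    then obtain d where d: "d > 0" "(w has_real_derivative d) (at s within {a..b})"
      using der[of s] sc c by auto
    from has_real_derivative_pos_inc_right[OF d(2,1)] obtain e where
      e: "e > 0" "\<And>h. h > 0 \<Longrightarrow> s + h \<in> {a..b} \<Longrightarrow> h < e \<Longrightarrow> w s < w (s + h)" by blast
    define h where "h = min (e/2) (c - s)"
    have "h > 0" "h < e" "s + h \<le> c" using e(1) sc by (auto simp: h_def)
    with e(2)[of h] after[of "s + h"] \<open>w s = 0\<close> sc c show False by auto
  qed
  \<comment> \<open>What precedes excludes only \<open>w b < 0\<close>. If \<open>w b = 0\<close>,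
    the positive derivative makes \<open>w\<close> negative just before \<open>b\<close>, which is
    excluded as well.\<close>
  show ?thesis
  proof (rule ccontr)
    assume "\<not> w b > 0"
    with neg[of b] ab have "w b = 0" by (metis linorder_cases order_refl)
    then obtain d where d: "d > 0" "(w has_real_derivative d) (at b within {a..b})"
      using der[of b] ab by auto
    from has_real_derivative_pos_inc_left[OF d(2,1)] obtain e where
      e: "e > 0" "\<And>h. h > 0 \<Longrightarrow> b - h \<in> {a..b} \<Longrightarrow> h < e \<Longrightarrow> w (b - h) < w b" by blast
    define h where "h = min (e/2) ((b - a)/2)"
    have "h > 0" "h < e" "b - h > a" using e(1) ab by (auto simp: h_def min_def field_simps)
    with e(2)[of h] neg[of "b - h"] \<open>w b = 0\<close> ab show False by auto
  qed
qed

text \<open>If all but finitely many levels are eventually on one side of \<open>f\<close>, its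
  lower and upper limits cannot differ.\<close>

lemma converges_if_levels_decided:
  fixes f :: "'a \<Rightarrow> real"
  assumes F: "F \<noteq> bot" and bd: "\<And>x. \<bar>f x\<bar> \<le> B"
    and fin: "finite E" and dec: "\<And>k. k \<notin> E \<Longrightarrow> (\<forall>\<^sub>F x in F. f x > k) \<or> (\<forall>\<^sub>F x in F. f x < k)"
  shows "\<exists>l. (f \<longlongrightarrow> l) F"
proof -
  define A where "A = {k. \<forall>\<^sub>F x in F. f x > k}"
  define l where "l = Sup A"
  have "f x > - B - 1" for x using bd[of x] by linarith
  then have ne: "- B - 1 \<in> A" by (simp add: A_def)
  have ub: "k \<le> B" if "k \<in> A" for k
  proof (rule ccontr)
    assume "\<not> k \<le> B"
    have "\<forall>\<^sub>F x in F. False" using that unfolding A_def mem_Collect_eq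
    proof (rule eventually_mono)
      fix x assume "k < f x" then show False using bd[of x] \<open>\<not> k \<le> B\<close> by simp
    qed
    then show False using F by (simp add: eventually_False)
  qed
  have bdd: "bdd_above A" using ub by (auto simp: bdd_above_def)
  have inf: "\<exists>k. k \<notin> E \<and> a < k \<and> k < b" if "a < b" for a b
  proof -
    have "infinite ({a<..<b} - E)" using that fin by (simp add: infinite_Ioo)
    then have "{a<..<b} - E \<noteq> {}" by (metis finite.emptyI)
    then show ?thesis by auto
  qed
  have "(f \<longlongrightarrow> l) F"
  proof (rule order_tendstoI)
    fix a assume "a < l"
    then obtain k where "k \<in> A" "a < k" using less_cSup_iff[OF _ bdd] ne by (auto simp: l_def)
    then show "\<forall>\<^sub>F x in F. a < f x" by (auto simp: A_def elim: eventually_mono)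
  next
    fix a assume "l < a"
    then obtain k where k: "k \<notin> E" "l < k" "k < a" using inf by blast
    then have "k \<notin> A" using cSup_upper[OF _ bdd] by (fastforce simp: l_def)
    with dec[OF k(1)] have "\<forall>\<^sub>F x in F. f x < k" by (simp add: A_def)
    then show "\<forall>\<^sub>F x in F. f x < a" by (rule eventually_mono) (use k in auto)
  qed
  then show ?thesis by blast
qed

section \<open>Orbits in a half-plane\<close>

text \<open>The cofactor \<open>Q\<close> is what later computations factor out; exposing it avoids
  coefficient sums and makes the notion stable under negation and under
  \<open>x -> - x\<close>.\<close>

definition lowest_term :: "real poly \<Rightarrow> nat \<Rightarrow> real \<Rightarrow> bool" where
  "lowest_term P k a \<longleftrightarrow> 1 \<le> k \<and> a \<noteq> 0 \<and> (\<exists>Q. (\<forall>x. poly P x = x ^ k * poly Q x) \<and> poly Q 0 = a)"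

lemma lowest_term_zero: "lowest_term P k a \<Longrightarrow> poly P 0 = 0"
  by (auto simp: lowest_term_def)

lemma lowest_term_minus: "lowest_term P k a \<Longrightarrow> lowest_term (- P) k (- a)"
  unfolding lowest_term_def by (metis minus_mult_right neg_equal_0_iff_equal poly_minus)

abbreviation reflect_poly_arg :: "real poly \<Rightarrow> real poly" where
  "reflect_poly_arg P \<equiv> pcompose P [:0, -1:]"

lemma lowest_term_reflect:
  assumes "lowest_term P k a"
  shows "lowest_term (reflect_poly_arg P) k ((-1) ^ k * a)"
proof -
  obtain Q where Q: "\<And>x. poly P x = x ^ k * poly Q x" "poly Q 0 = a" "1 \<le> k" "a \<noteq> 0"
    using assms by (auto simp: lowest_term_def)
  have "poly (reflect_poly_arg P) x = x ^ k * poly (smult ((-1) ^ k) (reflect_poly_arg Q)) x" for x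
    using power_minus[of x k] by (simp add: poly_pcompose Q(1))
  then show ?thesis unfolding lowest_term_def using Q
    by (intro conjI exI[of _ "smult ((-1) ^ k) (reflect_poly_arg Q)"]) (auto simp: poly_pcompose)
qed

lemma lowest_term_approx:
  assumes "lowest_term P k a" "\<eta> > 0"
  shows "\<exists>\<rho>>0. \<forall>x. \<bar>x\<bar> \<le> \<rho> \<longrightarrow> \<bar>poly P x - a * x ^ k\<bar> \<le> \<eta> * \<bar>x\<bar> ^ k"
proof -
  obtain Q where Q: "\<And>x. poly P x = x ^ k * poly Q x" "poly Q 0 = a"
    using assms by (auto simp: lowest_term_def)
  have "isCont (poly Q) 0" by simp
  then obtain d where d: "d > 0" "\<And>x. \<bar>x\<bar> < d \<Longrightarrow> \<bar>poly Q x - a\<bar> < \<eta>"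
    using assms(2) Q(2) unfolding continuous_at_eps_delta by (force simp: dist_real_def)
  have "\<bar>poly P x - a * x ^ k\<bar> \<le> \<eta> * \<bar>x\<bar> ^ k" if "\<bar>x\<bar> \<le> d/2" for x
  proof -
    have "poly P x - a * x ^ k = x ^ k * (poly Q x - a)" by (simp add: Q(1) algebra_simps)
    then have "\<bar>poly P x - a * x ^ k\<bar> = \<bar>x\<bar> ^ k * \<bar>poly Q x - a\<bar>" by (simp add: abs_mult power_abs)
    also have "\<dots> \<le> \<bar>x\<bar> ^ k * \<eta>" using d(2)[of x] d(1) that by (intro mult_left_mono) auto
    finally show ?thesis by (simp add: mult.commute)
  qed
  then show ?thesis using d(1) by (intro exI[of _ "d/2"]) auto
qed

lemma lowest_term_sign:
  assumes "lowest_term P k a"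
  shows "\<exists>\<rho>>0. \<forall>x. \<bar>x\<bar> \<le> \<rho> \<longrightarrow> x \<noteq> 0 \<longrightarrow> poly P x * (a * x ^ k) > 0"
proof -
  have a: "\<bar>a\<bar> / 2 > 0" using assms by (auto simp: lowest_term_def)
  obtain \<rho> where \<rho>: "\<rho> > 0" "\<And>x. \<bar>x\<bar> \<le> \<rho> \<Longrightarrow> \<bar>poly P x - a * x ^ k\<bar> \<le> \<bar>a\<bar> / 2 * \<bar>x\<bar> ^ k"
    using lowest_term_approx[OF assms a] by blast
  have "poly P x * (a * x ^ k) > 0" if "\<bar>x\<bar> \<le> \<rho>" "x \<noteq> 0" for x
  proof -
    have "\<bar>poly P x - a * x ^ k\<bar> < \<bar>a * x ^ k\<bar>"
    proof (rule le_less_trans[OF \<rho>(2)[OF that(1)]])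
      have "\<bar>a\<bar> * \<bar>x\<bar> ^ k > 0" using a that by simp
      then show "\<bar>a\<bar> / 2 * \<bar>x\<bar> ^ k < \<bar>a * x ^ k\<bar>" by (simp add: abs_mult power_abs)
    qed
    then have "(a * x ^ k > 0 \<and> poly P x > 0) \<or> (a * x ^ k < 0 \<and> poly P x < 0)" by linarith
    then show ?thesis by (auto intro: mult_pos_pos mult_neg_neg)
  qed
  then show ?thesis using \<rho>(1) by blast
qed

text \<open>Splitting off the exact power of \<open>x\<close> leaves a cofactor that is nonzero at
  \<open>0\<close> and keeps its sign nearby, while the power is positive for \<open>x > 0\<close>.
  Carrying the sign as a factor \<open>s\<close> handles both signs together.\<close>

lemma poly_nonzero_sign_right:
  fixes P :: "real poly"
  assumes "P \<noteq> 0"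
  shows "\<exists>s \<delta>. s \<noteq> 0 \<and> \<delta> > 0 \<and> (\<forall>x. 0 < x \<longrightarrow> x < \<delta> \<longrightarrow> s * poly P x > 0)"
proof -
  obtain Q where Q: "P = [:-0, 1:] ^ order 0 P * Q" "\<not> [:-0, 1:] dvd Q"
    using order_decomp[OF assms, of 0] by blast
  define s where "s = poly Q 0"
  have s: "s \<noteq> 0" using Q(2) poly_eq_0_iff_dvd[of Q 0] by (simp add: s_def)
  have "isCont (\<lambda>x. s * poly Q x) 0" by simp
  moreover have "s * poly Q 0 > 0" using s by (metis s_def not_real_square_gt_zero)
  ultimately have "\<forall>\<^sub>F x in at 0. s * poly Q x > 0"
    by (intro order_tendstoD(1)) (auto simp: isCont_def)
  then obtain d where d: "d > 0" "\<And>x. x \<noteq> 0 \<Longrightarrow> dist x 0 < d \<Longrightarrow> s * poly Q x > 0"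
    by (auto simp: eventually_at)
  have "s * poly P x > 0" if "0 < x" "x < d" for x
  proof -
    have "poly P x = x ^ order 0 P * poly Q x" by (subst Q(1)) simp
    then have "s * poly P x = x ^ order 0 P * (s * poly Q x)" by simp
    moreover have "x ^ order 0 P * (s * poly Q x) > 0"
      using d(2)[of x] that by (intro mult_pos_pos[of "x ^ order 0 P"]) auto
    ultimately show ?thesis by metis
  qed
  with s d(1) show ?thesis by blast
qed

section \<open>Boxes and the truncated field\<close>

lemma poly_lipschitz_interval:
  fixes P :: "real poly"
  shows "\<exists>L\<ge>0. \<forall>x\<in>{-R..R}. \<forall>y\<in>{-R..R}. \<bar>poly P x - poly P y\<bar> \<le> L * \<bar>x - y\<bar>"
proof -
  have "compact (poly (pderiv P) ` {-R..R})"
    by (intro compact_continuous_image continuous_intros) auto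
  then obtain L where L: "L > 0" "\<And>x. x \<in> {-R..R} \<Longrightarrow> \<bar>poly (pderiv P) x\<bar> \<le> L"
    using compact_imp_bounded bounded_pos by (metis (no_types, lifting) image_eqI real_norm_def)
  have "\<bar>poly P x - poly P y\<bar> \<le> L * \<bar>x - y\<bar>" if "x \<in> {-R..R}" "y \<in> {-R..R}" for x y
    using field_differentiable_bound[of "{-R..R}" "poly P" "poly (pderiv P)" L y x] that L
    by (auto intro: has_field_derivative_at_within poly_DERIV simp: abs_minus_commute)
  then show ?thesis using L(1) by (intro exI[of _ L]) auto
qed

text \<open>This is the closed ball of the maximum norm: clamping each coordinate retracts the plane
  onto it, and leaving it is a condition on the larger coordinate.\<close>

definition square_box :: "real \<Rightarrow> (real \<times> real) set" where
  "square_box R = {v. \<bar>fst v\<bar> \<le> R \<and> \<bar>snd v\<bar> \<le> R}"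

lemma square_box_mono: "R \<le> S \<Longrightarrow> square_box R \<subseteq> square_box S"
  by (auto simp: square_box_def)

lemma square_box_norm: "norm v \<le> R \<Longrightarrow> v \<in> square_box R"
  using norm_fst_le[of "fst v" "snd v"] norm_snd_le[of "snd v" "fst v"] by (simp add: square_box_def)

lemma norm_square_box: "v \<in> square_box R \<Longrightarrow> norm v \<le> 2 * R"
  using norm_Pair_le[of "fst v" "snd v"] by (simp add: square_box_def)

lemma closed_square_box: "closed (square_box R)"
  unfolding square_box_def by (intro closed_Collect_conj closed_Collect_le continuous_intros)

lemma compact_square_box: "compact (square_box R)"
  unfolding compact_eq_bounded_closed using closed_square_box norm_square_box
  by (metis boundedI)

lemma lienard_field_apply [simp]:
  "fst (lienard_field \<phi> F g v) = poly \<phi> (snd v) - poly F (fst v)"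
  "snd (lienard_field \<phi> F g v) = - poly g (fst v)"
  by (simp_all add: lienard_field_def case_prod_unfold)

text \<open>Global solutions are at hand for bounded Lipschitz fields, and a polynomial field is
  neither in general. Clamping both coordinates before evaluation does not increase distances and
  has values in the compact box, which yields both properties without changing the field
  inside.\<close>

lemma lienard_field_extension:
  obtains f L B where "L \<ge> 0" "\<And>u v. norm (f u - f v) \<le> L * norm (u - v)" "\<And>v. norm (f v) \<le> B"
    "\<And>v. v \<in> square_box R \<Longrightarrow> f v = lienard_field \<phi> F g v"
proof (cases "R \<ge> 0")
  case False
  then have "square_box R = {}" by (auto simp: square_box_def)
  then show thesis by (intro that[of 0 "\<lambda>_. 0" 0]) auto
next
  case True
  define k where "k x = max (-R) (min R x)" for x :: real
  have k: "k x \<in> {-R..R}" "\<bar>k x - k y\<bar> \<le> \<bar>x - y\<bar>" for x y using True by (auto simp: k_def)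
  have k_id: "k x = x" if "\<bar>x\<bar> \<le> R" for x using that by (auto simp: k_def)
  define f where "f v = lienard_field \<phi> F g (k (fst v), k (snd v))" for v
  have pl: "\<exists>L\<ge>0. \<forall>x y. \<bar>poly P (k x) - poly P (k y)\<bar> \<le> L * \<bar>x - y\<bar>" for P
  proof -
    obtain L where L: "L \<ge> 0" "\<forall>x\<in>{-R..R}. \<forall>y\<in>{-R..R}. \<bar>poly P x - poly P y\<bar> \<le> L * \<bar>x - y\<bar>"
      using poly_lipschitz_interval by blast
    have "\<bar>poly P (k x) - poly P (k y)\<bar> \<le> L * \<bar>x - y\<bar>" for x y
    proof -
      have "\<bar>poly P (k x) - poly P (k y)\<bar> \<le> L * \<bar>k x - k y\<bar>" using L(2) k(1) by blast
      also have "\<dots> \<le> L * \<bar>x - y\<bar>" using L(1) k(2) by (intro mult_left_mono)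
      finally show ?thesis .
    qed
    then show ?thesis using L(1) by blast
  qed
  obtain L1 where L1: "L1 \<ge> 0" "\<And>x y. \<bar>poly \<phi> (k x) - poly \<phi> (k y)\<bar> \<le> L1 * \<bar>x - y\<bar>" using pl by blast
  obtain L2 where L2: "L2 \<ge> 0" "\<And>x y. \<bar>poly F (k x) - poly F (k y)\<bar> \<le> L2 * \<bar>x - y\<bar>" using pl by blast
  obtain L3 where L3: "L3 \<ge> 0" "\<And>x y. \<bar>poly g (k x) - poly g (k y)\<bar> \<le> L3 * \<bar>x - y\<bar>" using pl by blast
  define L where "L = L1 + L2 + L3"
  have "norm (f u - f v) \<le> L * norm (u - v)" for u v
  proof -
    have c: "\<bar>fst u - fst v\<bar> \<le> norm (u - v)" "\<bar>snd u - snd v\<bar> \<le> norm (u - v)"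
      using norm_fst_le[of "fst (u - v)" "snd (u - v)"] norm_snd_le[of "snd (u - v)" "fst (u - v)"]
      unfolding prod.collapse by auto
    have "norm (f u - f v) \<le> \<bar>fst (f u - f v)\<bar> + \<bar>snd (f u - f v)\<bar>"
      using norm_Pair_le[of "fst (f u - f v)" "snd (f u - f v)"] unfolding prod.collapse by simp
    also have "\<dots> \<le> \<bar>poly \<phi> (k (snd u)) - poly \<phi> (k (snd v))\<bar> + \<bar>poly F (k (fst u)) - poly F (k (fst v))\<bar>
        + \<bar>poly g (k (fst u)) - poly g (k (fst v))\<bar>"
      by (simp add: f_def)
    also have "\<dots> \<le> L1 * \<bar>snd u - snd v\<bar> + L2 * \<bar>fst u - fst v\<bar> + L3 * \<bar>fst u - fst v\<bar>"
      by (intro add_mono L1 L2 L3)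
    also have "\<dots> \<le> L1 * norm (u - v) + L2 * norm (u - v) + L3 * norm (u - v)"
      by (intro add_mono mult_left_mono c L1 L2 L3)
    finally show ?thesis by (simp add: L_def algebra_simps)
  qed
  moreover have "L \<ge> 0" using L1 L2 L3 by (simp add: L_def)
  moreover have "f v = lienard_field \<phi> F g v" if "v \<in> square_box R" for v
    using that by (auto simp: f_def k_id square_box_def)
  moreover have "\<exists>B. \<forall>v. norm (f v) \<le> B"
  proof -
    have "compact (lienard_field \<phi> F g ` square_box R)"
      unfolding lienard_field_def case_prod_unfold
      by (intro compact_continuous_image compact_square_box continuous_intros)
    then obtain B where B: "\<And>v. v \<in> square_box R \<Longrightarrow> norm (lienard_field \<phi> F g v) \<le> B"
      using compact_imp_bounded bounded_iff by (metis (no_types, lifting) image_eqI)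
    have "(k (fst v), k (snd v)) \<in> square_box R" for v
      using k(1)[of "fst v"] k(1)[of "snd v"] by (auto simp: square_box_def)
    then have "norm (f v) \<le> B" for v unfolding f_def by (intro B)
    then show ?thesis by blast
  qed
  ultimately show thesis using that[of L f] by blast
qed

lemma lipschitz_curve_unique:
  fixes f :: "real \<times> real \<Rightarrow> real \<times> real"
  assumes lip: "\<And>x y. norm (f x - f y) \<le> L * norm (x - y)"
    and \<alpha>: "integral_curve f {a..b} \<alpha>" and \<beta>: "integral_curve f {a..b} \<beta>"
    and eq: "s \<in> {a..b}" "\<alpha> s = \<beta> s" and t: "t \<in> {a..b}"
  shows "\<alpha> t = \<beta> t"
proof (cases "s \<le> t")
  case True
  have "norm (\<alpha> (t - s + s) - \<beta> (t - s + s)) \<le> exp (L * (t - s)) * norm (\<alpha> (0 + s) - \<beta> (0 + s))"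
    using True t eq
    by (intro integral_curve_gronwall[OF lip] integral_curve_shift[OF \<alpha>] integral_curve_shift[OF \<beta>]) auto
  then show ?thesis using eq by simp
next
  case False
  have "norm (\<alpha> t - \<beta> t) \<le> exp (L * (s - t)) * norm (\<alpha> s - \<beta> s)"
    using False t eq
    by (intro integral_curve_gronwall_back[OF lip] integral_curve_subset[OF \<alpha>] integral_curve_subset[OF \<beta>]) auto
  then show ?thesis using eq by simp
qed

text \<open>On a compact time interval both curves lie in one box, where they solve the same
  truncated, globally Lipschitz equation.\<close>

lemma lienard_unique:
  assumes \<alpha>: "integral_curve (lienard_field \<phi> F g) {a..b} \<alpha>"
    and \<beta>: "integral_curve (lienard_field \<phi> F g) {a..b} \<beta>"
    and eq: "s \<in> {a..b}" "\<alpha> s = \<beta> s" and t: "t \<in> {a..b}"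
  shows "\<alpha> t = \<beta> t"
proof -
  have "compact (\<alpha> ` {a..b})" "compact (\<beta> ` {a..b})"
    using integral_curve_continuous[OF \<alpha>] integral_curve_continuous[OF \<beta>]
    by (auto intro: compact_continuous_image)
  then have "bounded (\<alpha> ` {a..b} \<union> \<beta> ` {a..b})" by (simp add: compact_imp_bounded)
  then obtain R where R: "\<And>v. v \<in> \<alpha> ` {a..b} \<union> \<beta> ` {a..b} \<Longrightarrow> norm v \<le> R"
    by (auto simp: bounded_iff)
  obtain f L B where f: "\<And>u v. norm (f u - f v) \<le> L * norm (u - v)"
    "\<And>v. v \<in> square_box R \<Longrightarrow> f v = lienard_field \<phi> F g v"
    by (rule lienard_field_extension[of R \<phi> F g]) blast
  have \<alpha>': "integral_curve f {a..b} \<alpha>"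
    by (rule integral_curve_cong_field[OF \<alpha>], rule f(2)[symmetric], rule square_box_norm) (auto intro: R)
  have \<beta>': "integral_curve f {a..b} \<beta>"
    by (rule integral_curve_cong_field[OF \<beta>], rule f(2)[symmetric], rule square_box_norm) (auto intro: R)
  show ?thesis by (rule lipschitz_curve_unique[OF f(1) \<alpha>' \<beta>' eq t])
qed

lemma mono_bounded_tendsto_at_top:
  fixes f :: "real \<Rightarrow> real"
  assumes mono: "\<And>s t. a \<le> s \<Longrightarrow> s \<le> t \<Longrightarrow> f s \<le> f t" and bd: "\<And>t. t \<ge> a \<Longrightarrow> f t \<le> B"
  obtains l where "(f \<longlongrightarrow> l) at_top" "\<And>t. t \<ge> a \<Longrightarrow> f t \<le> l"
proof -
  define l where "l = Sup (f ` {a..})"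
  have bdd: "bdd_above (f ` {a..})" using bd by (auto simp: bdd_above_def)
  have ub: "f t \<le> l" if "t \<ge> a" for t unfolding l_def using that bdd by (intro cSup_upper) auto
  have "(f \<longlongrightarrow> l) at_top"
  proof (rule order_tendstoI)
    fix k assume "k < l"
    then obtain s where s: "s \<ge> a" "k < f s"
      using less_cSup_iff[OF _ bdd, of k] by (auto simp: l_def)
    then show "\<forall>\<^sub>F t in at_top. k < f t"
      using mono unfolding eventually_at_top_linorder by (intro exI[of _ s]) (metis less_le_trans)
  next
    fix k assume "l < k"
    then show "\<forall>\<^sub>F t in at_top. f t < k"
      using ub unfolding eventually_at_top_linorder by (intro exI[of _ a]) (metis le_less_trans)
  qed
  with ub that show thesis by blast
qed

text \<open>The mean value theorem on \<open>{t..t + 1}\<close> supplies times \<open>z t\<close>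
  tending to infinity at which \<open>f'\<close> equals an increment of \<open>f\<close>, and these
  increments tend to \<open>0\<close>.\<close>

lemma tendsto_derivative_zero:
  fixes f :: "real \<Rightarrow> real"
  assumes f: "(f \<longlongrightarrow> l) at_top" and f': "(f' \<longlongrightarrow> m) at_top"
    and d: "\<And>t. t > a \<Longrightarrow> DERIV f t :> f' t"
  shows "m = 0"
proof -
  have "\<exists>z. t < z \<and> z < t + 1 \<and> f (t + 1) - f t = f' z" if "t > a" for t
    using MVT2[of t "t+1" f f'] d that by force
  then obtain z where z: "\<And>t. t > a \<Longrightarrow> t < z t \<and> f (t + 1) - f t = f' (z t)" by metis
  have "filterlim z at_top at_top"
    by (rule filterlim_at_top_mono[OF filterlim_ident])
      (use z in \<open>auto intro!: eventually_mono[OF eventually_gt_at_top[of a]] less_imp_le\<close>)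
  from filterlim_compose[OF f' this] have "((\<lambda>t. f' (z t)) \<longlongrightarrow> m) at_top" .
  moreover have "((\<lambda>t. f (t + 1) - f t) \<longlongrightarrow> l - l) at_top"
    by (intro tendsto_diff f filterlim_compose[OF f] filterlim_tendsto_add_at_top[OF tendsto_const filterlim_ident, THEN filterlim_cong[OF refl refl, THEN iffD1, rotated]])
      (auto simp: add.commute)
  then have "((\<lambda>t. f' (z t)) \<longlongrightarrow> l - l) at_top"
    by (rule Lim_transform_eventually) (use z in \<open>auto intro!: eventually_mono[OF eventually_gt_at_top[of a]]\<close>)
  ultimately have "m = l - l" using tendsto_unique trivial_limit_at_top_linorder by blast
  then show ?thesis by simp
qed

text \<open>Only lowest terms are fixed, with no signs or parities, so that every result can be
  reinterpreted for the reflected and time-reversed fields.\<close>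

locale lienard =
  fixes \<phi> F g :: "real poly" and p q r :: nat and a b c :: real
  assumes \<phi>: "lowest_term \<phi> p a" and F: "lowest_term F q b" and g: "lowest_term g r c"
begin

abbreviation X where "X \<equiv> lienard_field \<phi> F g"

lemma X_zero: "X (0, 0) = (0, 0)"
  using lowest_term_zero[OF \<phi>] lowest_term_zero[OF F] lowest_term_zero[OF g] by (simp add: lienard_field_def)

lemma curve_components:
  assumes "integral_curve X {0..} \<gamma>" "t > 0"
  shows "DERIV (\<lambda>t. fst (\<gamma> t)) t :> poly \<phi> (snd (\<gamma> t)) - poly F (fst (\<gamma> t))"
    and "DERIV (\<lambda>t. snd (\<gamma> t)) t :> - poly g (fst (\<gamma> t))"
  using integral_curve_components_at[OF assms(1), of t] assms(2) by auto

lemma curve_nonzero: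
  assumes \<gamma>: "integral_curve X S \<gamma>" and S: "\<And>s t. s \<in> S \<Longrightarrow> t \<in> S \<Longrightarrow> {s..t} \<subseteq> S"
    and s: "s \<in> S" "\<gamma> s \<noteq> (0, 0)" and t: "t \<in> S"
  shows "\<gamma> t \<noteq> (0, 0)"
proof
  assume eq: "\<gamma> t = (0, 0)"
  define lo hi where "lo = min s t" and "hi = max s t"
  have "lo \<in> S" "hi \<in> S" using s t by (auto simp: lo_def hi_def min_def max_def)
  then have 1: "integral_curve X {lo..hi} \<gamma>" using integral_curve_subset[OF \<gamma>] S by blast
  have 2: "integral_curve X {lo..hi} (\<lambda>_. (0, 0))"
    unfolding integral_curve_def X_zero by (auto simp: zero_prod_def intro!: derivative_eq_intros)
  have "\<gamma> s = (0, 0)"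
    by (rule lienard_unique[OF 1 2, of t]) (use eq in \<open>auto simp: lo_def hi_def\<close>)
  with s show False by simp
qed

text \<open>Since \<open>y\<close> is monotone in the half-plane, it converges; then \<open>g (x)\<close> has to vanish in the
  limit, and finally also \<open>\<phi> (y)\<close>.\<close>

lemma half_plane_converges:
  assumes \<gamma>: "integral_curve X {0..} \<gamma>" and box: "\<And>t. t \<ge> 0 \<Longrightarrow> \<gamma> t \<in> square_box \<rho>"
    and pos: "\<And>t. t \<ge> 0 \<Longrightarrow> fst (\<gamma> t) \<ge> 0"
    and \<rho>\<phi>: "\<And>y. \<bar>y\<bar> \<le> \<rho> \<Longrightarrow> poly \<phi> y = 0 \<Longrightarrow> y = 0"
    and \<rho>g: "\<And>x. 0 < x \<Longrightarrow> x \<le> \<rho> \<Longrightarrow> poly g x * c > 0"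
  shows "(\<gamma> \<longlongrightarrow> (0, 0)) at_top"
proof -
  define x y where "x t = fst (\<gamma> t)" and "y t = snd (\<gamma> t)" for t
  have c: "c \<noteq> 0" using g by (auto simp: lowest_term_def)
  have dx: "DERIV x t :> poly \<phi> (y t) - poly F (x t)" and dy: "DERIV y t :> - poly g (x t)" if "t > 0" for t
    using curve_components[OF \<gamma> that] by (auto simp: x_def[abs_def] y_def[abs_def])
  have cont: "continuous_on {0..} \<gamma>" by (rule integral_curve_continuous[OF \<gamma>])
  have contx: "continuous_on {s..t} x" and conty: "continuous_on {s..t} y" if "s \<ge> 0" for s t
    unfolding x_def[abs_def] y_def[abs_def]
    using that by (auto intro!: continuous_intros continuous_on_subset[OF cont])
  have bx: "0 \<le> x t" "x t \<le> \<rho>" and b_y: "\<bar>y t\<bar> \<le> \<rho>" if "t \<ge> 0" for t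
    using box[OF that] pos[OF that] by (auto simp: square_box_def x_def y_def)
  have \<rho>0: "\<rho> \<ge> 0" using bx[of 0] by linarith
  \<comment> \<open>Multiplication by \<open>- c\<close> makes the ordinate nondecreasing whatever
    the sign of \<open>c\<close>, since \<open>c * poly g x\<close> is nonnegative for
    \<open>x \<ge> 0\<close> in the box.\<close>
  define Y where "Y t = - c * y t" for t
  have dY: "DERIV Y t :> c * poly g (x t)" if "t > 0" for t
    unfolding Y_def by (rule DERIV_cong, rule DERIV_cmult, rule dy[OF that]) simp
  have contY: "continuous_on {s..t} Y" if "s \<ge> 0" for s t
    unfolding Y_def[abs_def] by (intro continuous_intros conty that)
  have cg: "c * poly g (x t) \<ge> 0" if "t \<ge> 0" for t
    using \<rho>g[of "x t"] bx[OF that] lowest_term_zero[OF g] by (cases "x t = 0") (auto simp: mult.commute)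
  have Ymono: "Y s \<le> Y t" if "0 \<le> s" "s \<le> t" for s t
    by (rule deriv_nonneg_imp_mono_open[OF that(2) contY[OF that(1)]])
      (use dY cg that in \<open>meson le_less_trans less_imp_le\<close>)
  have "Y t \<le> \<bar>c\<bar> * \<rho>" if "t \<ge> 0" for t
  proof -
    have "Y t \<le> \<bar>c\<bar> * \<bar>y t\<bar>" unfolding Y_def by (metis abs_ge_self abs_minus_cancel abs_mult)
    also have "\<dots> \<le> \<bar>c\<bar> * \<rho>" using b_y[OF that] by (intro mult_left_mono) auto
    finally show ?thesis .
  qed
  then obtain l where l: "(Y \<longlongrightarrow> l) at_top" "\<And>t. t \<ge> 0 \<Longrightarrow> Y t \<le> l"
    using mono_bounded_tendsto_at_top[of 0 Y, OF Ymono] by metis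
  have "compact (lienard_field \<phi> F g ` square_box \<rho>)"
    unfolding lienard_field_def case_prod_unfold
    by (intro compact_continuous_image compact_square_box continuous_intros)
  then obtain B where B: "B > 0" "\<And>v. v \<in> square_box \<rho> \<Longrightarrow> norm (X v) \<le> B"
    using compact_imp_bounded bounded_pos by (metis (no_types, lifting) image_eqI)
  have dxB: "\<bar>poly \<phi> (y t) - poly F (x t)\<bar> \<le> B" if "t \<ge> 0" for t
    using B(2)[OF box[OF that]] norm_fst_le[of "fst (X (\<gamma> t))" "snd (X (\<gamma> t))"]
    unfolding prod.collapse by (simp add: x_def y_def)
  have x0: "(x \<longlongrightarrow> 0) at_top"
  proof (rule order_tendstoI)
    fix k :: real assume "k < 0"
    then show "\<forall>\<^sub>F t in at_top. k < x t"
      using bx(1) by (intro eventually_mono[OF eventually_ge_at_top[of 0]]) (metis less_le_trans)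
  next
    fix k :: real assume k: "0 < k"
    show "\<forall>\<^sub>F t in at_top. x t < k"
    proof (cases "k \<le> \<rho>")
      case False
      then show ?thesis using bx(2)
        by (intro eventually_mono[OF eventually_ge_at_top[of 0]]) (metis le_less_trans not_le)
    next
      case True
      have "\<exists>z\<in>{k/2..\<rho>}. \<forall>w\<in>{k/2..\<rho>}. c * poly g z \<le> c * poly g w"
        using k True by (intro continuous_attains_inf) (auto intro!: continuous_intros)
      then obtain z where z: "z \<in> {k/2..\<rho>}" "\<And>w. w \<in> {k/2..\<rho>} \<Longrightarrow> c * poly g z \<le> c * poly g w" by blast
      define \<kappa> where "\<kappa> = c * poly g z"
      have \<kappa>: "\<kappa> > 0" using \<rho>g[of z] z(1) k by (auto simp: \<kappa>_def mult.commute)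
      \<comment> \<open>In time \<open>h\<close> the coordinate \<open>x\<close>, whose speed is at
        most \<open>B\<close>, cannot fall from \<open>k\<close> to below \<open>k / 2\<close>.
        Meanwhile \<open>Y\<close> gains at least \<open>\<kappa> * h\<close>, too much once it is
        within \<open>\<kappa> * h\<close> of its limit.\<close>
      define h where "h = k / (2 * B)"
      have h: "h > 0" using k B by (simp add: h_def)
      have "l - \<kappa> * h < l" using \<kappa> h by simp
      then have "\<forall>\<^sub>F t in at_top. l - \<kappa> * h < Y t" using order_tendstoD(1)[OF l(1)] by blast
      then show ?thesis using eventually_gt_at_top[of 0]
      proof eventually_elim
        case (elim t)
        show ?case
        proof (rule ccontr)
          assume "\<not> x t < k"
          then have xt: "x t \<ge> k" by simp
          have xs: "x s \<ge> k / 2" if s: "t \<le> s" "s \<le> t + h" for s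
          proof -
            have "\<bar>x s - x t\<bar> \<le> B * \<bar>s - t\<bar>"
            proof (rule field_differentiable_bound[of "{t..s}" x "\<lambda>u. poly \<phi> (y u) - poly F (x u)", simplified real_norm_def])
              fix u assume "u \<in> {t..s}"
              then have u: "u > 0" using elim(2) by auto
              show "(x has_real_derivative poly \<phi> (y u) - poly F (x u)) (at u within {t..s})"
                by (rule has_field_derivative_at_within[OF dx[OF u]])
              show "\<bar>poly \<phi> (y u) - poly F (x u)\<bar> \<le> B" using dxB u by simp
            qed (use s in auto)
            also have "\<dots> \<le> B * h" using s B by (intro mult_left_mono) auto
            also have "\<dots> = k / 2" using B by (simp add: h_def)
            finally show ?thesis using xt by linarith
          qed
          obtain u where u: "t < u" "u < t + h" "Y (t + h) - Y t = (t + h - t) * (c * poly g (x u))"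
            using MVT2[of t "t+h" Y "\<lambda>u. c * poly g (x u)"] dY elim(2) h by force
          have "\<kappa> \<le> c * poly g (x u)"
            unfolding \<kappa>_def using z(2)[of "x u"] xs[of u] u bx(2)[of u] elim(2) by auto
          then have "\<kappa> * h \<le> Y (t + h) - Y t" using u(3) h by (simp add: mult.commute)
          with l(2)[of "t + h"] elim h show False by simp
        qed
      qed
    qed
  qed
  have y: "(y \<longlongrightarrow> - l / c) at_top"
    using tendsto_divide[OF tendsto_minus[OF l(1)] tendsto_const[of c]] c by (simp add: Y_def[abs_def])
  have "((\<lambda>t. poly \<phi> (y t) - poly F (x t)) \<longlongrightarrow> poly \<phi> (- l / c) - poly F 0) at_top"
    by (intro tendsto_intros x0 y)
  then have "poly \<phi> (- l / c) - poly F 0 = 0"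
    using tendsto_derivative_zero[OF x0 _ dx] by blast
  moreover have "\<bar>- l / c\<bar> \<le> \<rho>"
    by (rule tendsto_upperbound[OF tendsto_rabs[OF y]])
      (auto intro!: eventually_mono[OF eventually_ge_at_top[of 0]] b_y)
  ultimately have "- l / c = 0" using \<rho>\<phi>[of "- l / c"] lowest_term_zero[OF F] by simp
  with y have "(y \<longlongrightarrow> 0) at_top" by metis
  from tendsto_Pair[OF x0 this] show ?thesis by (simp add: x_def y_def)
qed

text \<open>A later contact with the axis would be a local minimum of \<open>x\<close>, so
  \<open>\<phi>\<close> vanishes at the ordinate, the ordinate is \<open>0\<close>, and the orbit
  sits at the origin. Time \<open>0\<close> is left out because an orbit may start on the
  axis.\<close>

lemma half_plane_interior:
  assumes \<gamma>: "integral_curve X {0..} \<gamma>" and nz: "\<And>t. t \<ge> 0 \<Longrightarrow> \<gamma> t \<noteq> (0, 0)"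
    and box: "\<And>t. t \<ge> 0 \<Longrightarrow> \<gamma> t \<in> square_box \<rho>"
    and pos: "\<And>t. t \<ge> 0 \<Longrightarrow> fst (\<gamma> t) \<ge> 0"
    and \<rho>\<phi>: "\<And>y. \<bar>y\<bar> \<le> \<rho> \<Longrightarrow> poly \<phi> y = 0 \<Longrightarrow> y = 0"
    and t: "t > 0"
  shows "fst (\<gamma> t) > 0"
proof (rule ccontr)
  assume "\<not> fst (\<gamma> t) > 0"
  then have 0: "fst (\<gamma> t) = 0" using pos[of t] t by simp
  have "poly \<phi> (snd (\<gamma> t)) - poly F (fst (\<gamma> t)) = 0"
    by (rule DERIV_local_min[OF curve_components(1)[OF \<gamma> t] t]) (use pos 0 in auto)
  then have "snd (\<gamma> t) = 0" using \<rho>\<phi>[of "snd (\<gamma> t)"] box[of t] t 0 lowest_term_zero[OF F]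
    by (auto simp: square_box_def)
  with 0 nz[of t] t show False by (metis less_imp_le prod.collapse)
qed

text \<open>An orbit near the origin crosses each ray \<open>y = k x\<close>, with finitely many exceptions, in one direction only.\<close>

lemma half_plane_direction:
  assumes \<gamma>: "integral_curve X {0..} \<gamma>" and pos: "\<And>t. t > 0 \<Longrightarrow> fst (\<gamma> t) > 0"
    and lim: "(\<gamma> \<longlongrightarrow> (0, 0)) at_top"
  shows "\<exists>u. ((\<lambda>t. sgn (\<gamma> t)) \<longlongrightarrow> u) at_top"
proof -
  define x y where "x t = fst (\<gamma> t)" and "y t = snd (\<gamma> t)" for t
  have dx: "DERIV x t :> poly \<phi> (y t) - poly F (x t)" and dy: "DERIV y t :> - poly g (x t)" if "t > 0" for t
    using curve_components[OF \<gamma> that] by (auto simp: x_def[abs_def] y_def[abs_def])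
  have xpos: "x t > 0" if "t > 0" for t using pos that by (simp add: x_def)
  have x0: "(x \<longlongrightarrow> 0) at_top" using tendsto_fst[OF lim] by (simp add: x_def[abs_def])
  \<comment> \<open>On the ray \<open>y = k x\<close> the derivative of \<open>y - k x\<close> along
    the orbit is \<open>poly (N k) x\<close>; unless \<open>N k\<close> is the zero polynomial, this
    has a fixed sign for small positive \<open>x\<close>.\<close>
  define N where "N k = - g - smult k (pcompose \<phi> [:0, k:] - F)" for k
  have N: "poly (N k) x = - poly g x - k * (poly \<phi> (k * x) - poly F x)" for k x
    by (simp add: N_def poly_pcompose mult.commute)
  \<comment> \<open>The value of \<open>N k\<close> at \<open>1\<close> is a polynomial in
    \<open>k\<close>; every exceptional slope is a root of it, so finiteness follows once
    \<open>R\<close> is not zero.\<close>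
  define R where "R = - [:poly g 1:] - [:0, 1:] * (\<phi> - [:poly F 1:])"
  have R: "poly R k = poly (N k) 1" for k by (simp add: R_def N algebra_simps)
  have "R \<noteq> 0"
  proof
    assume "R = 0"
    then have *: "- poly g 1 - k * (poly \<phi> k - poly F 1) = 0" for k using R[of k] N[of k 1] by simp
    have g1: "poly g 1 = 0" using *[of 0] by simp
    have "poly \<phi> k = poly F 1" if "k \<noteq> 0" for k using *[of k] g1 that by simp
    then have "poly (\<phi> - [:poly F 1:]) k = 0" if "k \<noteq> 0" for k using that by simp
    then have "infinite {k. poly (\<phi> - [:poly F 1:]) k = 0}"
      using infinite_super[of "- {0}" "{k. poly (\<phi> - [:poly F 1:]) k = 0}"] infinite_UNIV_char_0
      by (auto simp: finite_compl)
    then have "\<phi> - [:poly F 1:] = 0" using poly_roots_finite by blast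
    then have "\<phi> = [:poly F 1:]" by simp
    moreover have "poly \<phi> 0 = 0" by (rule lowest_term_zero[OF \<phi>])
    ultimately have "\<phi> = 0" by simp
    then show False using lowest_term_sign[OF \<phi>]
      by (metis abs_of_pos order_refl less_irrefl mult_zero_left poly_0)
  qed
  define E where "E = {k. N k = 0}"
  have "E \<subseteq> {k. poly R k = 0}"
    unfolding E_def R by (intro Collect_mono impI) (simp only: poly_0)
  then have finE: "finite E"
    using poly_roots_finite[OF \<open>R \<noteq> 0\<close>] finite_subset by blast
  have dec: "(\<forall>\<^sub>F t in at_top. y t > k * x t) \<or> (\<forall>\<^sub>F t in at_top. y t < k * x t)" if "k \<notin> E" for k
  proof -
    have "N k \<noteq> 0" using that by (simp add: E_def)
    from poly_nonzero_sign_right[OF this]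
    obtain s \<delta> where s: "s \<noteq> 0" "\<delta> > 0" "\<And>x. 0 < x \<Longrightarrow> x < \<delta> \<Longrightarrow> s * poly (N k) x > 0"
      by blast
    have "\<forall>\<^sub>F t in at_top. x t < \<delta>" using order_tendstoD(2)[OF x0 s(2)] .
    then obtain T0 where T0: "\<And>t. t \<ge> T0 \<Longrightarrow> x t < \<delta>"
      unfolding eventually_at_top_linorder by blast
    define T where "T = max T0 1"
    have T: "T > 0" "\<And>t. t \<ge> T \<Longrightarrow> x t < \<delta>" using T0 by (auto simp: T_def)
    define w where "w t = s * (y t - k * x t)" for t
    have dw: "DERIV w t :> s * (- poly g (x t) - k * (poly \<phi> (y t) - poly F (x t)))" if "t > 0" for t
      unfolding w_def by (intro DERIV_cmult DERIV_diff dx dy that)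
    have "(\<forall>\<^sub>F t in at_top. w t > 0) \<or> (\<forall>\<^sub>F t in at_top. w t < 0)"
    proof (cases "\<exists>t1\<ge>T. w t1 \<ge> 0")
      case False
      then show ?thesis unfolding eventually_at_top_linorder by (meson not_le)
    next
      case True
      then obtain t1 where t1: "t1 \<ge> T" "w t1 \<ge> 0" by blast
      have "w t > 0" if "t > t1" for t
      proof (rule cross_pos[of t1 t w])
        show "t1 < t" "w t1 \<ge> 0" by (fact that t1(2))+
        show "continuous_on {t1..t} w"
          by (intro DERIV_atLeastAtMost_imp_continuous_on) (use dw t1 T in \<open>meson less_le_trans\<close>)
        fix u assume u: "u \<in> {t1..t}" "w u = 0"
        then have yu: "y u = k * x u" using s(1) by (simp add: w_def)
        have u0: "u > 0" using u t1 T by auto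
        have "DERIV w u :> s * poly (N k) (x u)" using dw[OF u0] by (simp add: N yu)
        moreover have "s * poly (N k) (x u) > 0" using s(3) xpos[OF u0] T(2)[of u] u t1 by auto
        ultimately show "\<exists>d>0. (w has_real_derivative d) (at u within {t1..t})"
          by (blast intro: has_field_derivative_at_within)
      qed
      then have "\<forall>\<^sub>F t in at_top. w t > 0"
        by (rule eventually_mono[OF eventually_gt_at_top[of t1]])
      then show ?thesis ..
    qed
    then show ?thesis using s(1)
      by (cases "s > 0") (auto simp: w_def zero_less_mult_iff mult_less_0_iff)
  qed
  \<comment> \<open>Slopes may be unbounded when the direction becomes vertical; angles are bounded,
    and exceptional slopes become exceptional angles.\<close>
  define f where "f t = arctan (y t / x t)" for t
  have "\<exists>l. (f \<longlongrightarrow> l) at_top"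
  proof (rule converges_if_levels_decided[of _ _ "pi/2" "arctan ` E"])
    show "\<bar>f t\<bar> \<le> pi / 2" for t using arctan_bounded[of "y t / x t"] by (auto simp: f_def)
    show "finite (arctan ` E)" using finE by simp
    fix \<theta> assume \<theta>: "\<theta> \<notin> arctan ` E"
    consider "\<theta> \<le> - (pi/2)" | "\<theta> \<ge> pi/2" | "- (pi/2) < \<theta>" "\<theta> < pi/2" by linarith
    then show "(\<forall>\<^sub>F t in at_top. \<theta> < f t) \<or> (\<forall>\<^sub>F t in at_top. f t < \<theta>)"
    proof cases
      case 1
      then have "\<theta> < f t" for t using arctan_bounded[of "y t / x t"] by (simp add: f_def)
      then show ?thesis by simp
    next
      case 2
      then have "\<theta> > f t" for t using arctan_bounded[of "y t / x t"] by (simp add: f_def)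
      then show ?thesis by simp
    next
      case 3
      then have at: "arctan (tan \<theta>) = \<theta>" by (simp add: arctan_tan)
      then have "tan \<theta> \<notin> E" using \<theta> by force
      from dec[OF this] show ?thesis
      proof
        assume "\<forall>\<^sub>F t in at_top. tan \<theta> * x t < y t"
        then have "\<forall>\<^sub>F t in at_top. \<theta> < f t" using eventually_gt_at_top[of 0]
        proof eventually_elim
          case (elim t)
          then have "tan \<theta> < y t / x t" using xpos[of t] by (simp add: field_simps)
          then show ?case using at arctan_less_iff by (metis f_def)
        qed
        then show ?thesis ..
      next
        assume "\<forall>\<^sub>F t in at_top. y t < tan \<theta> * x t"
        then have "\<forall>\<^sub>F t in at_top. f t < \<theta>" using eventually_gt_at_top[of 0]
        proof eventually_elim
          case (elim t)
          then have "tan \<theta> > y t / x t" using xpos[of t] by (simp add: field_simps)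
          then show ?case using at arctan_less_iff by (metis f_def)
        qed
        then show ?thesis ..
      qed
    qed
  qed simp
  then obtain l where l: "(f \<longlongrightarrow> l) at_top" by blast
  have "((\<lambda>t. (cos (f t), sin (f t))) \<longlongrightarrow> (cos l, sin l)) at_top" by (intro tendsto_intros l)
  moreover have "\<forall>\<^sub>F t in at_top. (cos (f t), sin (f t)) = sgn (\<gamma> t)" using eventually_gt_at_top[of 0]
  proof eventually_elim
    case (elim t)
    have x: "x t > 0" using xpos elim by simp
    have "sqrt (1 + (y t / x t)\<^sup>2) = norm (\<gamma> t) / x t"
    proof -
      have "1 + (y t / x t)\<^sup>2 = ((x t)\<^sup>2 + (y t)\<^sup>2) / (x t)\<^sup>2" using x by (simp add: field_simps)
      then have "sqrt (1 + (y t / x t)\<^sup>2) = sqrt ((x t)\<^sup>2 + (y t)\<^sup>2) / x t"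
        using x by (simp add: real_sqrt_divide)
      then show ?thesis by (simp add: norm_prod_def x_def y_def)
    qed
    then have "cos (f t) = x t / norm (\<gamma> t)" "sin (f t) = y t / norm (\<gamma> t)"
      using x by (simp_all add: f_def cos_arctan sin_arctan)
    moreover have "\<gamma> t = (x t, y t)" by (simp add: x_def y_def)
    ultimately show ?case by (simp add: sgn_div_norm divide_inverse mult.commute scaleR_prod_def)
  qed
  ultimately have "((\<lambda>t. sgn (\<gamma> t)) \<longlongrightarrow> (cos l, sin l)) at_top" by (rule Lim_transform_eventually)
  then show ?thesis ..
qed

end

section \<open>Reflections and shooting\<close>

lemma first_hit:
  fixes w :: "real \<Rightarrow> real"
  assumes ab: "a \<le> b" and cont: "continuous_on {a..b} w" and wa: "w a < k" and wb: "w b \<ge> k"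
  obtains T where "a < T" "T \<le> b" "w T = k" "\<And>s. a \<le> s \<Longrightarrow> s < T \<Longrightarrow> w s < k"
proof -
  define Z where "Z = {t\<in>{a..b}. k \<le> w t}"
  have "closed Z" unfolding Z_def
    using continuous_on_closed_Collect_le[of "{a..b}" "\<lambda>_. k" w] cont by simp
  moreover have "bounded Z" by (rule bounded_subset[of "{a..b}"]) (auto simp: Z_def)
  ultimately have "compact Z" by (simp add: compact_eq_bounded_closed)
  moreover have "b \<in> Z" using wb ab by (simp add: Z_def)
  ultimately obtain T where T: "T \<in> Z" "\<And>t. t \<in> Z \<Longrightarrow> T \<le> t"
    using compact_attains_inf[of Z] by (metis empty_iff)
  have less: "w s < k" if "a \<le> s" "s < T" for s
  proof (rule ccontr)
    assume "\<not> w s < k"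
    then have "s \<in> Z" using that T(1) by (auto simp: Z_def)
    with T(2)[of s] that show False by simp
  qed
  have Tab: "a \<le> T" "T \<le> b" "w T \<ge> k" using T(1) by (auto simp: Z_def)
  then have "a < T" using wa by (cases "a = T") auto
  have "w T = k"
  proof (rule ccontr)
    assume "w T \<noteq> k"
    then have "k < w T" using Tab by simp
    have "\<exists>s\<ge>a. s \<le> T \<and> w s = k"
      using \<open>k < w T\<close> wa Tab by (intro IVT') (auto intro: continuous_on_subset[OF cont])
    then obtain s where "a \<le> s" "s \<le> T" "w s = k" by blast
    with less[of s] \<open>w T \<noteq> k\<close> show False by (cases "s = T") auto
  qed
  with that \<open>a < T\<close> Tab less show thesis by blast
qed

section \<open>Symmetries acting on characteristic orbits\<close>

definition has_characteristic_orbit :: "(real \<times> real \<Rightarrow> real \<times> real) \<Rightarrow> bool" where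
  "has_characteristic_orbit X \<longleftrightarrow> (\<exists>\<gamma>. characteristic_orbit X (0, 0) \<gamma>)"

lemma has_characteristic_orbit_reverse:
  assumes "has_characteristic_orbit X"
  shows "has_characteristic_orbit (\<lambda>v. - X v)"
proof -
  obtain \<gamma> where \<gamma>: "characteristic_orbit X (0, 0) \<gamma>"
    using assms by (auto simp: has_characteristic_orbit_def)
  have bt: "filterlim uminus at_bot (at_top :: real filter)" "filterlim uminus at_top (at_bot :: real filter)"
    by (rule filterlim_uminus_at_bot_at_top filterlim_uminus_at_top_at_bot)+
  have 1: "((\<lambda>t. f (- t)) \<longlongrightarrow> l) at_bot" if "(f \<longlongrightarrow> l) at_top" for f :: "real \<Rightarrow> real \<times> real" and l
    by (rule filterlim_compose[OF that bt(2)])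
  have 2: "((\<lambda>t. f (- t)) \<longlongrightarrow> l) at_top" if "(f \<longlongrightarrow> l) at_bot" for f :: "real \<Rightarrow> real \<times> real" and l
    by (rule filterlim_compose[OF that bt(1)])
  have "characteristic_orbit (\<lambda>v. - X v) (0, 0) (\<lambda>t. \<gamma> (- t))"
    using \<gamma> unfolding characteristic_orbit_def
  proof (elim disjE conjE exE)
    fix u assume "integral_curve X {0..} \<gamma>" "\<forall>t\<ge>0. \<gamma> t \<noteq> (0, 0)" "(\<gamma> \<longlongrightarrow> (0, 0)) at_top"
      "((\<lambda>t. sgn (\<gamma> t - (0, 0))) \<longlongrightarrow> u) at_top"
    then show "(integral_curve (\<lambda>v. - X v) {0..} (\<lambda>t. \<gamma> (- t)) \<and> (\<forall>t\<ge>0. \<gamma> (- t) \<noteq> (0, 0)) \<and>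
         ((\<lambda>t. \<gamma> (- t)) \<longlongrightarrow> (0, 0)) at_top \<and> (\<exists>u. ((\<lambda>t. sgn (\<gamma> (- t) - (0, 0))) \<longlongrightarrow> u) at_top)) \<or>
      (integral_curve (\<lambda>v. - X v) {..0} (\<lambda>t. \<gamma> (- t)) \<and> (\<forall>t\<le>0. \<gamma> (- t) \<noteq> (0, 0)) \<and>
         ((\<lambda>t. \<gamma> (- t)) \<longlongrightarrow> (0, 0)) at_bot \<and> (\<exists>u. ((\<lambda>t. sgn (\<gamma> (- t) - (0, 0))) \<longlongrightarrow> u) at_bot))"
      using integral_curve_reflect[of X "{0..}" \<gamma>] 1[of \<gamma>] 1[of "\<lambda>t. sgn (\<gamma> t - (0, 0))" u]
      by (intro disjI2 conjI exI[of _ u]) auto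
  next
    fix u assume "integral_curve X {..0} \<gamma>" "\<forall>t\<le>0. \<gamma> t \<noteq> (0, 0)" "(\<gamma> \<longlongrightarrow> (0, 0)) at_bot"
      "((\<lambda>t. sgn (\<gamma> t - (0, 0))) \<longlongrightarrow> u) at_bot"
    then show "(integral_curve (\<lambda>v. - X v) {0..} (\<lambda>t. \<gamma> (- t)) \<and> (\<forall>t\<ge>0. \<gamma> (- t) \<noteq> (0, 0)) \<and>
         ((\<lambda>t. \<gamma> (- t)) \<longlongrightarrow> (0, 0)) at_top \<and> (\<exists>u. ((\<lambda>t. sgn (\<gamma> (- t) - (0, 0))) \<longlongrightarrow> u) at_top)) \<or>
      (integral_curve (\<lambda>v. - X v) {..0} (\<lambda>t. \<gamma> (- t)) \<and> (\<forall>t\<le>0. \<gamma> (- t) \<noteq> (0, 0)) \<and>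
         ((\<lambda>t. \<gamma> (- t)) \<longlongrightarrow> (0, 0)) at_bot \<and> (\<exists>u. ((\<lambda>t. sgn (\<gamma> (- t) - (0, 0))) \<longlongrightarrow> u) at_bot))"
      using integral_curve_reflect[of X "{..0}" \<gamma>] 2[of \<gamma>] 2[of "\<lambda>t. sgn (\<gamma> t - (0, 0))" u]
      by (intro disjI1 conjI exI[of _ u]) auto
  qed
  then show ?thesis by (auto simp: has_characteristic_orbit_def)
qed

text \<open>With \<open>s1\<close> and \<open>s2\<close> equal to \<open>1\<close> or
  \<open>-1\<close> this covers the reflections in both axes and the half-turn in one
  notion.\<close>

definition axis_reflection :: "real \<Rightarrow> real \<Rightarrow> real \<times> real \<Rightarrow> real \<times> real" where
  "axis_reflection s1 s2 v = (s1 * fst v, s2 * snd v)"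

lemma bounded_linear_axis_reflection: "bounded_linear (axis_reflection s1 s2)"
  unfolding axis_reflection_def[abs_def]
  by (intro bounded_linear_Pair bounded_linear_const_mult bounded_linear_fst bounded_linear_snd)

lemma integral_curve_axis_reflection:
  assumes "integral_curve X S \<gamma>" and s: "s1 * s1 = 1" "s2 * s2 = 1"
  shows "integral_curve (\<lambda>v. axis_reflection s1 s2 (X (axis_reflection s1 s2 v))) S (\<lambda>t. axis_reflection s1 s2 (\<gamma> t))"
proof -
  have "axis_reflection s1 s2 (axis_reflection s1 s2 v) = v" for v
    by (cases v) (simp add: axis_reflection_def s flip: mult.assoc)
  then show ?thesis
    using assms(1) bounded_linear.has_vector_derivative[OF bounded_linear_axis_reflection]
    unfolding integral_curve_def by simp
qed

lemma has_characteristic_orbit_axis_reflection: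
  assumes "has_characteristic_orbit X" and s: "s1 * s1 = 1" "s2 * s2 = 1"
  shows "has_characteristic_orbit (\<lambda>v. axis_reflection s1 s2 (X (axis_reflection s1 s2 v)))"
proof -
  let ?R = "axis_reflection s1 s2"
  obtain \<gamma> where \<gamma>: "characteristic_orbit X (0, 0) \<gamma>"
    using assms by (auto simp: has_characteristic_orbit_def)
  have "s1 = 1 \<or> s1 = -1" "s2 = 1 \<or> s2 = -1" using s by (simp_all add: square_eq_1_iff)
  then have norm: "norm (?R v) = norm v" for v
    by (auto simp: axis_reflection_def norm_prod_def)
  have sgn: "sgn (?R v) = ?R (sgn v)" for v
    by (simp add: sgn_div_norm norm) (simp add: axis_reflection_def scaleR_prod_def)
  have nz: "?R v \<noteq> (0, 0)" if "v \<noteq> (0, 0)" for v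
    using norm[of v] that by (metis norm_eq_zero zero_prod_def)
  have lim: "((\<lambda>t. ?R (f t)) \<longlongrightarrow> ?R l) H" if "(f \<longlongrightarrow> l) H" for f l and H :: "real filter"
    by (rule bounded_linear.tendsto[OF bounded_linear_axis_reflection that])
  have R0: "?R (0, 0) = (0, 0)" by (simp add: axis_reflection_def)
  have z: "v - (0, 0) = v" for v :: "real \<times> real" by (simp flip: zero_prod_def)
  have "characteristic_orbit (\<lambda>v. ?R (X (?R v))) (0, 0) (\<lambda>t. ?R (\<gamma> t))"
    using \<gamma> unfolding characteristic_orbit_def z sgn
    using integral_curve_axis_reflection[OF _ s] nz lim lim[of \<gamma> "(0, 0)", unfolded R0] by meson
  then show ?thesis by (auto simp: has_characteristic_orbit_def)
qed

lemma lienard_field_reverse: "(\<lambda>v. - lienard_field \<phi> F g v) = lienard_field (- \<phi>) (- F) (- g)"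
  by (simp add: lienard_field_def fun_eq_iff)

lemma lienard_field_reflect_x:
  "(\<lambda>v. axis_reflection (-1) 1 (lienard_field \<phi> F g (axis_reflection (-1) 1 v))) =
    lienard_field (- \<phi>) (- reflect_poly_arg F) (reflect_poly_arg g)"
  by (simp add: lienard_field_def axis_reflection_def fun_eq_iff poly_pcompose)

lemma lienard_field_reflect_y:
  "(\<lambda>v. axis_reflection 1 (-1) (lienard_field \<phi> F g (axis_reflection 1 (-1) v))) =
    lienard_field (reflect_poly_arg \<phi>) F (- g)"
  by (simp add: lienard_field_def axis_reflection_def fun_eq_iff poly_pcompose)

lemma pcompose_reflect_twice: "reflect_poly_arg (reflect_poly_arg P) = (P :: real poly)"
  by (simp add: poly_eq_poly_eq_iff[symmetric] fun_eq_iff poly_pcompose)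

lemma pcompose_reflect_minus: "reflect_poly_arg (- P) = - reflect_poly_arg P" for P :: "real poly"
  by (simp add: poly_eq_poly_eq_iff[symmetric] fun_eq_iff poly_pcompose)

lemma characteristic_lienard_reverse:
  "has_characteristic_orbit (lienard_field (- \<phi>) (- F) (- g)) \<longleftrightarrow> has_characteristic_orbit (lienard_field \<phi> F g)"
  using has_characteristic_orbit_reverse[of "lienard_field \<phi> F g"]
    has_characteristic_orbit_reverse[of "lienard_field (- \<phi>) (- F) (- g)"]
  by (auto simp: lienard_field_reverse)

lemma characteristic_lienard_reflect_x:
  "has_characteristic_orbit (lienard_field (- \<phi>) (- reflect_poly_arg F) (reflect_poly_arg g)) \<longleftrightarrow>
    has_characteristic_orbit (lienard_field \<phi> F g)"
  using has_characteristic_orbit_axis_reflection[of "lienard_field \<phi> F g" "-1" 1]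
    has_characteristic_orbit_axis_reflection[of "lienard_field (- \<phi>) (- reflect_poly_arg F) (reflect_poly_arg g)" "-1" 1]
  by (auto simp: lienard_field_reflect_x pcompose_reflect_twice pcompose_reflect_minus)

lemma characteristic_lienard_reflect_y:
  "has_characteristic_orbit (lienard_field (reflect_poly_arg \<phi>) F (- g)) \<longleftrightarrow>
    has_characteristic_orbit (lienard_field \<phi> F g)"
  using has_characteristic_orbit_axis_reflection[of "lienard_field \<phi> F g" 1 "-1"]
    has_characteristic_orbit_axis_reflection[of "lienard_field (reflect_poly_arg \<phi>) F (- g)" 1 "-1"]
  by (auto simp: lienard_field_reflect_y pcompose_reflect_twice)

context lienard
begin

lemma reverse_lienard: "lienard (- \<phi>) (- F) (- g) p q r (- a) (- b) (- c)"
  using \<phi> F g by unfold_locales (auto intro: lowest_term_minus)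

lemma reflect_x_lienard:
  "lienard (- \<phi>) (- reflect_poly_arg F) (reflect_poly_arg g) p q r (- a) (- ((-1) ^ q * b)) ((-1) ^ r * c)"
  using \<phi> F g by unfold_locales (intro lowest_term_minus lowest_term_reflect; assumption)+

lemma reflect_y_lienard:
  "lienard (reflect_poly_arg \<phi>) F (- g) p q r ((-1) ^ p * a) b (- c)"
  using \<phi> F g by unfold_locales (assumption | intro lowest_term_minus lowest_term_reflect; assumption)+

text \<open>The condition on \<open>g\<close> concerns positive \<open>x\<close> only, since the
  arguments take place in the right half-plane and the left one is reached through reflections.
  Multiplying by \<open>c\<close> avoids fixing its sign.\<close>

definition good_radius :: "real \<Rightarrow> bool" where
  "good_radius \<rho> \<longleftrightarrow> \<rho> > 0 \<and> (\<forall>y. \<bar>y\<bar> \<le> \<rho> \<longrightarrow> poly \<phi> y = 0 \<longrightarrow> y = 0) \<and>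
     (\<forall>x. 0 < x \<longrightarrow> x \<le> \<rho> \<longrightarrow> poly g x * c > 0)"

lemma good_radius_ex:
  obtains \<rho>0 where "\<And>\<rho>. 0 < \<rho> \<Longrightarrow> \<rho> \<le> \<rho>0 \<Longrightarrow> good_radius \<rho>" "\<rho>0 > 0"
proof -
  obtain \<rho>1 where 1: "\<rho>1 > 0" "\<And>x. \<bar>x\<bar> \<le> \<rho>1 \<Longrightarrow> x \<noteq> 0 \<Longrightarrow> poly \<phi> x * (a * x ^ p) > 0"
    using lowest_term_sign[OF \<phi>] by blast
  obtain \<rho>2 where 2: "\<rho>2 > 0" "\<And>x. \<bar>x\<bar> \<le> \<rho>2 \<Longrightarrow> x \<noteq> 0 \<Longrightarrow> poly g x * (c * x ^ r) > 0"
    using lowest_term_sign[OF g] by blast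
  show thesis
  proof (rule that[of "min \<rho>1 \<rho>2"])
    fix \<rho> :: real assume \<rho>: "0 < \<rho>" "\<rho> \<le> min \<rho>1 \<rho>2"
    have "y = 0" if "\<bar>y\<bar> \<le> \<rho>" "poly \<phi> y = 0" for y
      using 1(2)[of y] \<rho> that by (cases "y = 0") auto
    moreover have "poly g x * c > 0" if "0 < x" "x \<le> \<rho>" for x
    proof -
      have "(poly g x * c) * x ^ r > 0" using 2(2)[of x] \<rho> that by (simp add: mult.assoc)
      then show ?thesis by (rule zero_less_mult_pos2) (use that in simp)
    qed
    ultimately show "good_radius \<rho>" using \<rho> by (auto simp: good_radius_def)
  qed (use 1 2 in auto)
qed

lemma half_plane_characteristic:
  assumes "good_radius \<rho>" and \<gamma>: "integral_curve X {0..} \<gamma>" and nz: "\<And>t. t \<ge> 0 \<Longrightarrow> \<gamma> t \<noteq> (0, 0)"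
    and box: "\<And>t. t \<ge> 0 \<Longrightarrow> \<gamma> t \<in> square_box \<rho>"
    and pos: "\<And>t. t \<ge> 0 \<Longrightarrow> fst (\<gamma> t) \<ge> 0"
  shows "has_characteristic_orbit X"
proof -
  have \<rho>: "\<And>y. \<bar>y\<bar> \<le> \<rho> \<Longrightarrow> poly \<phi> y = 0 \<Longrightarrow> y = 0" "\<And>x. 0 < x \<Longrightarrow> x \<le> \<rho> \<Longrightarrow> poly g x * c > 0"
    using assms(1) by (auto simp: good_radius_def)
  have lim: "(\<gamma> \<longlongrightarrow> (0, 0)) at_top" by (rule half_plane_converges[OF \<gamma> box pos \<rho>])
  have "\<exists>u. ((\<lambda>t. sgn (\<gamma> t)) \<longlongrightarrow> u) at_top"
    by (rule half_plane_direction[OF \<gamma> _ lim], rule half_plane_interior[OF \<gamma> nz box pos \<rho>(1)])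
  then have "characteristic_orbit X (0, 0) \<gamma>"
    unfolding characteristic_orbit_def using \<gamma> nz lim by (simp flip: zero_prod_def)
  then show ?thesis by (auto simp: has_characteristic_orbit_def)
qed

lemma half_plane_characteristic_backward:
  assumes "good_radius \<rho>" and \<gamma>: "integral_curve X {..0} \<gamma>" and nz: "\<And>t. t \<le> 0 \<Longrightarrow> \<gamma> t \<noteq> (0, 0)"
    and box: "\<And>t. t \<le> 0 \<Longrightarrow> \<gamma> t \<in> square_box \<rho>"
    and pos: "\<And>t. t \<le> 0 \<Longrightarrow> fst (\<gamma> t) \<ge> 0"
  shows "has_characteristic_orbit X"
proof -
  interpret rev: lienard "- \<phi>" "- F" "- g" p q r "- a" "- b" "- c" by (rule reverse_lienard)
  have "integral_curve rev.X {0..} (\<lambda>t. \<gamma> (- t))"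
    using integral_curve_reflect[OF \<gamma>] by (simp add: lienard_field_reverse)
  moreover have "rev.good_radius \<rho>" using assms(1) by (simp add: good_radius_def rev.good_radius_def)
  moreover have "\<gamma> (- t) \<noteq> (0, 0)" "\<gamma> (- t) \<in> square_box \<rho>" "fst (\<gamma> (- t)) \<ge> 0" if "t \<ge> 0" for t
    using that by (intro nz box pos; simp)+
  ultimately have "has_characteristic_orbit rev.X"
    by (intro rev.half_plane_characteristic[of \<rho> "\<lambda>t. \<gamma> (- t)"])
  then show ?thesis by (simp add: characteristic_lienard_reverse)
qed

text \<open>Solutions starting ever closer to the origin need ever more time to leave the box, so a limit
  of their exit points has a backward orbit that never leaves it.\<close>

lemma shooting:
  assumes good: "good_radius \<rho>" and P: "P \<longlonglongrightarrow> (0, 0)" "\<And>n. P n \<noteq> (0, 0)"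
    and W: "closed W" "\<And>v. v \<in> W \<Longrightarrow> fst v \<ge> 0"
    and inv: "\<And>n T \<gamma>. T \<ge> 0 \<Longrightarrow> integral_curve X {0..T} \<gamma> \<Longrightarrow> \<gamma> 0 = P n \<Longrightarrow>
      (\<And>t. t \<in> {0..T} \<Longrightarrow> \<gamma> t \<in> square_box \<rho>) \<Longrightarrow> \<gamma> T \<in> W"
  shows "has_characteristic_orbit X"
proof -
  have \<rho>: "\<rho> > 0" using good by (simp add: good_radius_def)
  obtain f L B where f: "L \<ge> 0" "\<And>u v. norm (f u - f v) \<le> L * norm (u - v)" "\<And>v. norm (f v) \<le> B"
    "\<And>v. v \<in> square_box \<rho> \<Longrightarrow> f v = X v"
    by (rule lienard_field_extension[of \<rho> \<phi> F g]) blast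
  have f0: "f (0, 0) = (0, 0)" using f(4)[of "(0, 0)"] X_zero \<rho> by (simp add: square_box_def)
  have "\<forall>n. \<exists>\<gamma>. \<gamma> 0 = P n \<and> integral_curve f UNIV \<gamma>"
    using integral_curve_global[OF f(2,3)] by blast
  from choice[OF this] obtain \<gamma> where \<gamma>: "\<And>n. \<gamma> n 0 = P n" "\<And>n. integral_curve f UNIV (\<gamma> n)"
    by blast
  have toX: "integral_curve X S \<theta>" if "integral_curve f UNIV \<theta>" "\<And>t. t \<in> S \<Longrightarrow> \<theta> t \<in> square_box \<rho>" for S \<theta>
    by (rule integral_curve_cong_field[OF integral_curve_subset[OF that(1)]]) (auto simp: that(2) f(4))
  have inW: "\<gamma> n T \<in> W" if "T \<ge> 0" "\<And>t. t \<in> {0..T} \<Longrightarrow> \<gamma> n t \<in> square_box \<rho>" for n T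
    by (rule inv[OF that(1) toX[OF \<gamma>(2)] \<gamma>(1)]) (use that in auto)
  show ?thesis
  \<comment> \<open>If one of the starting points has an orbit that stays in the box forever, that
    forward orbit is already characteristic.\<close>
  proof (cases "\<exists>n. \<forall>t\<ge>0. \<gamma> n t \<in> square_box \<rho>")
    case True
    then obtain n where n: "\<And>t. t \<ge> 0 \<Longrightarrow> \<gamma> n t \<in> square_box \<rho>" by blast
    have curve: "integral_curve X {0..} (\<gamma> n)" by (rule toX[OF \<gamma>(2)]) (use n in auto)
    show ?thesis
    proof (rule half_plane_characteristic[OF good curve])
      show "\<gamma> n t \<noteq> (0, 0)" if "t \<ge> 0" for t
        by (rule curve_nonzero[OF curve, of 0]) (use that \<gamma>(1) P(2) in auto)
      show "fst (\<gamma> n t) \<ge> 0" if "t \<ge> 0" for t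
        by (rule W(2), rule inW[OF that]) (use n in auto)
    qed (use n in auto)
  next
    case False
    define N where "N n t = max \<bar>fst (\<gamma> n t)\<bar> \<bar>snd (\<gamma> n t)\<bar>" for n t
    have box_N: "\<gamma> n t \<in> square_box \<rho> \<longleftrightarrow> N n t \<le> \<rho>" for n t by (auto simp: square_box_def N_def)
    have contN: "continuous_on S (N n)" for n S
      unfolding N_def[abs_def] using integral_curve_continuous[OF integral_curve_subset[OF \<gamma>(2)[of n], of S]]
      by (intro continuous_intros) auto
    have N_norm: "N n t \<le> norm (\<gamma> n t)" for n t
      using norm_fst_le[of "fst (\<gamma> n t)" "snd (\<gamma> n t)"] norm_snd_le[of "snd (\<gamma> n t)" "fst (\<gamma> n t)"] by (simp add: N_def)
    have "\<forall>\<^sub>F n in sequentially. norm (P n) < \<rho>"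
      using tendstoD[OF P(1) \<rho>] by (simp add: dist_norm flip: zero_prod_def)
    then obtain n0 where n0: "\<And>n. n \<ge> n0 \<Longrightarrow> norm (P n) < \<rho>"
      unfolding eventually_sequentially by blast
    have "\<exists>T>0. (\<forall>t\<in>{0..T}. \<gamma> n t \<in> square_box \<rho>) \<and> \<rho> \<le> norm (\<gamma> n T)" if n: "n \<ge> n0" for n
    proof -
      have 0: "N n 0 < \<rho>" using N_norm[of n 0] n0[OF n] \<gamma>(1) by simp
      obtain t1 where t1: "t1 \<ge> 0" "N n t1 > \<rho>" using False box_N by (meson not_le)
      obtain T where T: "0 < T" "T \<le> t1" "N n T = \<rho>" "\<And>s. 0 \<le> s \<Longrightarrow> s < T \<Longrightarrow> N n s < \<rho>"
        using first_hit[OF t1(1) contN 0] t1(2) by (metis less_imp_le)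
      show ?thesis
      proof (intro exI[of _ T] conjI ballI)
        show "\<gamma> n t \<in> square_box \<rho>" if "t \<in> {0..T}" for t
          using T(3) T(4)[of t] that by (cases "t = T") (auto simp: box_N)
        show "\<rho> \<le> norm (\<gamma> n T)" using N_norm[of n T] T(3) by simp
      qed fact
    qed
    then obtain T where T: "\<And>n. n \<ge> n0 \<Longrightarrow> T n > 0"
      "\<And>n t. n \<ge> n0 \<Longrightarrow> t \<in> {0..T n} \<Longrightarrow> \<gamma> n t \<in> square_box \<rho>"
      "\<And>n. n \<ge> n0 \<Longrightarrow> \<rho> \<le> norm (\<gamma> n (T n))" by metis
    \<comment> \<open>The exit points have norm at least \<open>\<rho>\<close>, so their limit
      \<open>E0\<close> is not the origin.\<close>
    define E where "E n = \<gamma> (n + n0) (T (n + n0))" for n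
    have "E n \<in> square_box \<rho>" for n
      unfolding E_def using T(1)[of "n + n0"] by (intro T(2)) auto
    then obtain E0 \<sigma> where E0: "E0 \<in> square_box \<rho>" "strict_mono \<sigma>" "(E \<circ> \<sigma>) \<longlonglongrightarrow> E0"
      using compact_square_box[of \<rho>] unfolding compact_def by metis
    have "norm E0 \<ge> \<rho>"
      by (rule tendsto_lowerbound[OF tendsto_norm[OF E0(3)]]) (auto simp: E_def intro!: always_eventually T(3))
    then have E0nz: "E0 \<noteq> (0, 0)" using \<rho> by (auto simp flip: zero_prod_def)
    obtain \<gamma>0 where \<gamma>0: "\<gamma>0 0 = E0" "integral_curve f UNIV \<gamma>0"
      using integral_curve_global[OF f(2,3), of E0] by blast
    \<comment> \<open>Comparison with the equilibrium: in time \<open>s\<close> the distance to the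
      origin grows at most by the factor \<open>exp (L * s)\<close>, so orbits starting close enough
      to the origin need at least time \<open>s\<close> to reach norm \<open>\<rho>\<close>.\<close>
    have Tlarge: "\<forall>\<^sub>F n in sequentially. T (\<sigma> n + n0) \<ge> s" for s
    proof -
      have "filterlim (\<lambda>n. \<sigma> n + n0) at_top sequentially"
        by (rule filterlim_at_top_mono[OF filterlim_subseq[OF E0(2)]]) auto
      then have "(\<lambda>n. P (\<sigma> n + n0)) \<longlonglongrightarrow> (0, 0)" by (rule filterlim_compose[OF P(1)])
      then have "\<forall>\<^sub>F n in sequentially. dist (P (\<sigma> n + n0)) (0, 0) < \<rho> / exp (L * s)"
        by (rule tendstoD) (simp add: \<rho>)
      then show ?thesis
      proof eventually_elim
        case (elim n)
        define m where "m = \<sigma> n + n0"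
        have m: "m \<ge> n0" by (simp add: m_def)
        show ?case
        proof (rule ccontr)
          assume "\<not> T (\<sigma> n + n0) \<ge> s"
          then have Ts: "T m < s" by (simp add: m_def)
          have zero: "integral_curve f {0..T m} (\<lambda>_. (0, 0))"
            unfolding integral_curve_def f0 by (auto simp: zero_prod_def intro!: derivative_eq_intros)
          have "\<rho> \<le> norm (\<gamma> m (T m) - (0, 0))" using T(3)[OF m] by (simp flip: zero_prod_def)
          also have "\<dots> \<le> exp (L * T m) * norm (\<gamma> m 0 - (0, 0))"
            by (rule integral_curve_gronwall[OF f(2) integral_curve_subset[OF \<gamma>(2)] zero]) (use T(1)[OF m] in auto)
          also have "\<dots> \<le> exp (L * s) * norm (\<gamma> m 0 - (0, 0))"
            using Ts f(1) by (intro mult_right_mono) (auto intro: mult_left_mono)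
          also have "\<dots> < exp (L * s) * (\<rho> / exp (L * s))"
            using elim by (intro mult_strict_left_mono) (simp_all add: \<gamma>(1) m_def dist_norm)
          finally show False by simp
        qed
      qed
    qed
    \<comment> \<open>Backward comparison from the exit points: \<open>\<gamma>0 (- s)\<close> is
      the limit of the points that the approximating orbits occupy at time \<open>s\<close> before
      their exit, and these lie in \<open>W\<close> and in the box, both closed.\<close>
    have main: "\<gamma>0 (- s) \<in> W \<inter> square_box \<rho>" if s: "s \<ge> 0" for s
    proof -
      let ?u = "\<lambda>n. \<gamma> (\<sigma> n + n0) (T (\<sigma> n + n0) - s)"
      have ev: "\<forall>\<^sub>F n in sequentially. ?u n \<in> W \<inter> square_box \<rho> \<and>
          norm (\<gamma>0 (- s) - ?u n) \<le> exp (L * s) * norm (E0 - (E \<circ> \<sigma>) n)"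
        using Tlarge[of s]
      proof eventually_elim
        case (elim n)
        define m where "m = \<sigma> n + n0"
        have m: "m \<ge> n0" by (simp add: m_def)
        have Ts: "s \<le> T m" using elim by (simp add: m_def)
        have 1: "\<gamma> m t \<in> square_box \<rho>" if "t \<in> {0..T m - s}" for t
          using T(2)[OF m, of t] that s by auto
        have 2: "\<gamma> m (T m - s) \<in> W" by (rule inW) (use 1 Ts in auto)
        have 3: "norm (\<gamma>0 (- s) - \<gamma> m (- s + T m)) \<le> exp (L * (0 - - s)) * norm (\<gamma>0 0 - \<gamma> m (0 + T m))"
          by (rule integral_curve_gronwall_back[OF f(2) integral_curve_subset[OF \<gamma>0(2)] integral_curve_shift[OF \<gamma>(2)]])
            (use s in auto)
        show ?case
          using 1[of "T m - s"] 2 3 Ts by (simp add: m_def \<gamma>0(1) E_def add.commute)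
      qed
      have "(\<lambda>n. exp (L * s) * norm (E0 - (E \<circ> \<sigma>) n)) \<longlonglongrightarrow> exp (L * s) * norm (E0 - E0)"
        by (intro tendsto_intros E0(3))
      then have "(\<lambda>n. exp (L * s) * norm (E0 - (E \<circ> \<sigma>) n)) \<longlonglongrightarrow> 0" by simp
      then have "(\<lambda>n. \<gamma>0 (- s) - ?u n) \<longlonglongrightarrow> 0"
        by (rule Lim_null_comparison[rotated]) (use ev in \<open>auto elim: eventually_mono\<close>)
      from tendsto_diff[OF tendsto_const[of "\<gamma>0 (- s)"] this]
      have lim: "?u \<longlonglongrightarrow> \<gamma>0 (- s)" by simp
      show ?thesis
        by (rule Lim_in_closed_set[OF closed_Int[OF W(1) closed_square_box] _ _ lim])
          (use ev in \<open>auto elim: eventually_mono\<close>)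
    qed
    have main': "\<gamma>0 t \<in> W" "\<gamma>0 t \<in> square_box \<rho>" if "t \<le> 0" for t
      using main[of "- t"] that by auto
    have curve: "integral_curve X {..0} \<gamma>0" by (rule toX[OF \<gamma>0(2)]) (use main' in auto)
    show ?thesis
    proof (rule half_plane_characteristic_backward[OF good curve])
      show "\<gamma>0 t \<noteq> (0, 0)" if "t \<le> 0" for t
        by (rule curve_nonzero[OF curve, of 0]) (use that \<gamma>0(1) E0nz in auto)
    qed (use main' W(2) in auto)
  qed
qed

end

section \<open>Existence of characteristic orbits\<close>

context lienard
begin

lemma segment_components:
  assumes "integral_curve X {0..T} \<gamma>" "0 \<le> t" "t \<le> T"
  shows "((\<lambda>t. fst (\<gamma> t)) has_real_derivative poly \<phi> (snd (\<gamma> t)) - poly F (fst (\<gamma> t))) (at t within {0..T})"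
    and "((\<lambda>t. snd (\<gamma> t)) has_real_derivative - poly g (fst (\<gamma> t))) (at t within {0..T})"
  using integral_curve_components[OF assms(1), of t] assms(2,3) by auto

lemma y_increasing:
  assumes good: "good_radius \<rho>" and c: "c < 0"
    and \<gamma>: "integral_curve X {0..T} \<gamma>" and box: "\<And>t. t \<in> {0..T} \<Longrightarrow> \<gamma> t \<in> square_box \<rho>"
    and v: "0 \<le> v" "v \<le> T" and pos: "\<And>t. 0 < t \<Longrightarrow> t < v \<Longrightarrow> fst (\<gamma> t) > 0"
  shows "snd (\<gamma> 0) \<le> snd (\<gamma> v)"
proof (rule deriv_nonneg_imp_mono_open[OF v(1)])
  show "continuous_on {0..v} (\<lambda>t. snd (\<gamma> t))"
    using integral_curve_continuous[OF integral_curve_subset[OF \<gamma>, of "{0..v}"]] v by (auto intro: continuous_intros)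
  fix t assume t: "0 < t" "t < v"
  have "DERIV (\<lambda>t. snd (\<gamma> t)) t :> - poly g (fst (\<gamma> t))"
    using integral_curve_components_at(2)[OF \<gamma>, of t] t v by simp
  moreover have "poly g (fst (\<gamma> t)) < 0"
    using good c pos[OF t] box[of t] t v by (auto simp: good_radius_def square_box_def zero_less_mult_iff)
  ultimately show "\<exists>y. DERIV (\<lambda>t. snd (\<gamma> t)) t :> y \<and> 0 \<le> y" by (intro exI conjI) auto
qed

lemma inverse_sequence: "(\<lambda>n. d / (real n + 2)) \<longlonglongrightarrow> 0"
  by real_asymp

text \<open>Orbits starting on the positive \<open>y\<close>-axis enter \<open>x > 0\<close>, where
  \<open>c < 0\<close> makes \<open>y\<close> grow; to return to the axis they would have to meet it
  against the field, because \<open>\<phi>\<close> is positive at small positive heights. So the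
  \<open>y\<close>-axis itself serves as the boundary for shooting.\<close>

lemma characteristic_if_axis_crossed_outward:
  assumes a: "a > 0" and c: "c < 0"
  shows "has_characteristic_orbit X"
proof -
  obtain \<rho>0 where \<rho>0: "\<And>\<rho>. 0 < \<rho> \<Longrightarrow> \<rho> \<le> \<rho>0 \<Longrightarrow> good_radius \<rho>" "\<rho>0 > 0" using good_radius_ex by blast
  obtain \<rho>1 where \<rho>1: "\<rho>1 > 0" "\<And>x. \<bar>x\<bar> \<le> \<rho>1 \<Longrightarrow> x \<noteq> 0 \<Longrightarrow> poly \<phi> x * (a * x ^ p) > 0"
    using lowest_term_sign[OF \<phi>] by blast
  define \<rho> where "\<rho> = min \<rho>0 \<rho>1"
  have good: "good_radius \<rho>" using \<rho>0 \<rho>1 by (auto simp: \<rho>_def)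
  have \<phi>pos: "poly \<phi> y > 0" if "0 < y" "y \<le> \<rho>" for y
  proof -
    have "poly \<phi> y * (a * y ^ p) > 0" using \<rho>1(2)[of y] that by (simp add: \<rho>_def)
    moreover have "a * y ^ p > 0" using a that by simp
    ultimately show ?thesis by (rule zero_less_mult_pos2)
  qed
  show ?thesis
  proof (rule shooting[OF good, of "\<lambda>n. (0, 1 / (real n + 2))" "{v. fst v \<ge> 0}"])
    show "(\<lambda>n. (0, 1 / (real n + 2))) \<longlonglongrightarrow> (0::real, 0)"
      by (intro tendsto_intros inverse_sequence)
    show "closed {v :: real \<times> real. 0 \<le> fst v}" by (intro closed_Collect_le continuous_intros)
    fix n T \<gamma> assume T: "0 \<le> T" and \<gamma>: "integral_curve X {0..T} \<gamma>" and \<gamma>0: "\<gamma> 0 = (0, 1 / (real n + 2))"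
      and box: "\<And>t. t \<in> {0..T} \<Longrightarrow> \<gamma> t \<in> square_box \<rho>"
    have cont: "continuous_on {0..t} (\<lambda>t. fst (\<gamma> t))" "continuous_on {0..t} (\<lambda>t. snd (\<gamma> t))" if "t \<le> T" for t
      using integral_curve_continuous[OF integral_curve_subset[OF \<gamma>, of "{0..t}"]] that by (auto intro: continuous_intros)
    have cross: "fst (\<gamma> t) > 0" if t: "0 < t" "t \<le> T" and y: "\<And>s. 0 \<le> s \<Longrightarrow> s \<le> t \<Longrightarrow> snd (\<gamma> s) > 0" for t
    proof (rule cross_pos[OF t(1) cont(1)[OF t(2)]])
      show "0 \<le> fst (\<gamma> 0)" by (simp add: \<gamma>0)
      fix s assume s: "s \<in> {0..t}" "fst (\<gamma> s) = 0"
      have "poly \<phi> (snd (\<gamma> s)) > 0" using y[of s] box[of s] s t by (intro \<phi>pos) (auto simp: square_box_def)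
      then show "\<exists>d>0. ((\<lambda>t. fst (\<gamma> t)) has_real_derivative d) (at s within {0..t})"
        using segment_components(1)[OF integral_curve_subset[OF \<gamma>, of "{0..t}"], of s] s t lowest_term_zero[OF F]
        by auto
    qed
    \<comment> \<open>Positivity of \<open>x\<close> relies on \<open>y > 0\<close>, and the growth
      of \<open>y\<close> relies on \<open>x > 0\<close>; the circle is broken at the first zero
      \<open>v\<close> of \<open>y\<close>, as both hold strictly between \<open>0\<close> and
      \<open>v\<close>.\<close>
    have ypos: "snd (\<gamma> t) > 0" if t: "0 \<le> t" "t \<le> T" for t
    proof (rule ccontr)
      assume neg: "\<not> snd (\<gamma> t) > 0"
      obtain v where v: "0 < v" "v \<le> t" "- snd (\<gamma> v) = 0" "\<And>s. 0 \<le> s \<Longrightarrow> s < v \<Longrightarrow> - snd (\<gamma> s) < 0"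
        by (rule first_hit[OF t(1), of "\<lambda>t. - snd (\<gamma> t)" 0])
          (use neg cont(2)[OF t(2)] in \<open>auto simp: \<gamma>0 intro: continuous_intros\<close>)
      have "snd (\<gamma> 0) \<le> snd (\<gamma> v)"
        by (rule y_increasing[OF good c \<gamma> box]) (use v t cross in force)+
      then show False using v(3) by (simp add: \<gamma>0 divide_le_0_iff)
    qed
    show "\<gamma> T \<in> {v. 0 \<le> fst v}"
      using cross[of T] ypos T by (cases "T = 0") (force simp: \<gamma>0)+
  qed (auto simp: add_nonneg_eq_0_iff)
qed

text \<open>On the curve \<open>y = B (x)\<close> the function \<open>B (x) - y\<close> increases
  along orbits, so an orbit starting on the curve stays below it afterwards. Since \<open>B\<close>
  vanishes at \<open>0\<close>, reaching the axis would force \<open>y \<le> 0\<close>, although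
  \<open>y\<close> starts positive and grows while \<open>x > 0\<close>. Hence the axis is never
  reached.\<close>

lemma characteristic_if_barrier:
  fixes B :: "real poly"
  assumes c: "c < 0" and B0: "poly B 0 = 0" and \<delta>: "\<delta> > 0"
    and B: "\<And>x. 0 < x \<Longrightarrow> x < \<delta> \<Longrightarrow> poly B x > 0"
    and B': "\<And>x. 0 < x \<Longrightarrow> x < \<delta> \<Longrightarrow> poly (pderiv B) x * (poly \<phi> (poly B x) - poly F x) + poly g x > 0"
  shows "has_characteristic_orbit X"
proof -
  obtain \<rho>0 where \<rho>0: "\<And>\<rho>. 0 < \<rho> \<Longrightarrow> \<rho> \<le> \<rho>0 \<Longrightarrow> good_radius \<rho>" "\<rho>0 > 0" using good_radius_ex by blast
  define \<rho> where "\<rho> = min \<rho>0 (\<delta> / 2)"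
  have good: "good_radius \<rho>" using \<rho>0 \<delta> by (auto simp: \<rho>_def)
  have \<rho>: "0 < \<rho>" "\<rho> < \<delta>" using \<rho>0 \<delta> by (auto simp: \<rho>_def)
  define u where "u n = \<rho> / (real n + 2)" for n
  have u: "0 < u n" "u n < \<delta>" for n
  proof -
    have "u n \<le> \<rho> / 1" unfolding u_def using \<rho> by (intro divide_left_mono) auto
    then show "u n < \<delta>" using \<rho> by simp
    show "0 < u n" unfolding u_def using \<rho> by (simp add: add_nonneg_pos)
  qed
  show ?thesis
  proof (rule shooting[OF good, of "\<lambda>n. (u n, poly B (u n))" "{v. fst v \<ge> 0}"])
    have "u \<longlonglongrightarrow> 0" unfolding u_def[abs_def] by (rule inverse_sequence)
    then have "(\<lambda>n. (u n, poly B (u n))) \<longlonglongrightarrow> (0, poly B 0)" by (intro tendsto_intros)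
    then show "(\<lambda>n. (u n, poly B (u n))) \<longlonglongrightarrow> (0, 0)" by (simp add: B0)
    show "closed {v :: real \<times> real. 0 \<le> fst v}" by (intro closed_Collect_le continuous_intros)
    show "(u n, poly B (u n)) \<noteq> (0, 0)" for n using u(1)[of n] by simp
    fix n T \<gamma> assume T: "0 \<le> T" and \<gamma>: "integral_curve X {0..T} \<gamma>" and \<gamma>0: "\<gamma> 0 = (u n, poly B (u n))"
      and box: "\<And>t. t \<in> {0..T} \<Longrightarrow> \<gamma> t \<in> square_box \<rho>"
    define x y where "x t = fst (\<gamma> t)" and "y t = snd (\<gamma> t)" for t
    define h where "h t = poly B (x t) - y t" for t
    have cont: "continuous_on {0..t} x" "continuous_on {0..t} y" if "t \<le> T" for t
      using integral_curve_continuous[OF integral_curve_subset[OF \<gamma>, of "{0..t}"]] that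
      by (auto intro: continuous_intros simp: x_def[abs_def] y_def[abs_def])
    then have conth: "continuous_on {0..t} h" if "t \<le> T" for t
      unfolding h_def[abs_def] using that by (intro continuous_intros) auto
    have h0: "h 0 = 0" "x 0 > 0" "y 0 > 0" using u[of n] B by (auto simp: h_def x_def y_def \<gamma>0)
    have cross: "h t > 0" if t: "0 < t" "t \<le> T" and pos: "\<And>s. 0 \<le> s \<Longrightarrow> s \<le> t \<Longrightarrow> x s > 0" for t
    proof (rule cross_pos[OF t(1) conth[OF t(2)]])
      show "0 \<le> h 0" by (simp add: h0)
      fix s assume s: "s \<in> {0..t}" "h s = 0"
      have xs: "0 < x s" "x s < \<delta>" using pos[of s] box[of s] s t \<rho> by (auto simp: square_box_def x_def)
      have ys: "y s = poly B (x s)" using s by (simp add: h_def)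
      have d: "(x has_real_derivative (poly \<phi> (y s) - poly F (x s))) (at s within {0..t})"
        "(y has_real_derivative (- poly g (x s))) (at s within {0..t})"
        using segment_components[OF integral_curve_subset[OF \<gamma>, of "{0..t}"], of s] s t
        by (auto simp: x_def[abs_def] y_def[abs_def])
      have "(h has_real_derivative (poly (pderiv B) (x s) * (poly \<phi> (y s) - poly F (x s)) - (- poly g (x s)))) (at s within {0..t})"
        unfolding h_def[abs_def] by (intro DERIV_diff d DERIV_chain2[OF poly_DERIV])
      then show "\<exists>d>0. (h has_real_derivative d) (at s within {0..t})"
        using B'[OF xs] ys by (intro exI conjI) auto
    qed
    have xpos: "x t > 0" if t: "0 \<le> t" "t \<le> T" for t
    proof (rule ccontr)
      assume neg: "\<not> x t > 0"
      obtain v where v: "0 < v" "v \<le> t" "- x v = 0" "\<And>s. 0 \<le> s \<Longrightarrow> s < v \<Longrightarrow> - x s < 0"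
        by (rule first_hit[OF t(1), of "\<lambda>t. - x t" 0])
          (use neg cont(1)[OF t(2)] h0 in \<open>auto intro: continuous_intros\<close>)
      have "y 0 \<le> y v"
        unfolding y_def by (rule y_increasing[OF good c \<gamma> box]) (use v t in \<open>auto simp: x_def\<close>)
      \<comment> \<open>Positivity of \<open>h\<close> is available only before \<open>v\<close>; a
        negative value at \<open>v\<close> would be preceded by negative values at times where
        \<open>h\<close> is positive.\<close>
      moreover have "h v \<ge> 0"
      proof (rule ccontr)
        assume "\<not> h v \<ge> 0"
        have "\<exists>s\<ge>0. s \<le> v \<and> h s = h v / 2"
          using \<open>\<not> h v \<ge> 0\<close> h0 v conth[of v] t by (intro IVT2') auto
        then obtain s where s: "0 \<le> s" "s \<le> v" "h s = h v / 2" by blast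
        have "s < v" using s \<open>\<not> h v \<ge> 0\<close> by (cases "s = v") auto
        have "s > 0" using s \<open>\<not> h v \<ge> 0\<close> h0 by (cases "s = 0") auto
        have "h s > 0" by (rule cross) (use \<open>s > 0\<close> \<open>s < v\<close> v t in force)+
        with s \<open>\<not> h v \<ge> 0\<close> show False by simp
      qed
      ultimately show False using v(3) B0 h0 by (simp add: h_def)
    qed
    show "\<gamma> T \<in> {v. 0 \<le> fst v}" using xpos[of T] T by (auto simp: x_def)
  qed auto
qed

section \<open>Barriers of power type\<close>

lemma factors:
  obtains \<phi>1 F1 g1 where "\<And>x. poly \<phi> x = x ^ p * poly \<phi>1 x" "poly \<phi>1 0 = a"
    "\<And>x. poly F x = x ^ q * poly F1 x" "poly F1 0 = b"
    "\<And>x. poly g x = x ^ r * poly g1 x" "poly g1 0 = c"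
  using \<phi> F g unfolding lowest_term_def by blast

lemma exponents_pos: "p \<ge> 1" "q \<ge> 1" "r \<ge> 1"
  using \<phi> F g by (auto simp: lowest_term_def)

lemma coefficients_nonzero: "a \<noteq> 0" "b \<noteq> 0" "c \<noteq> 0"
  using \<phi> F g by (auto simp: lowest_term_def)

text \<open>For \<open>y = k x^\<mu>\<close> with \<open>\<mu> = r + 1 - q\<close> the terms from
  \<open>F\<close> and \<open>g\<close> both enter the barrier inequality at order \<open>r\<close>,
  while \<open>\<phi>\<close> comes in at higher order because \<open>p \<mu> > q\<close>. As
  \<open>b < 0\<close>, a large \<open>k\<close> decides the sign.\<close>

lemma characteristic_if_friction_dominates:
  assumes c: "c < 0" and b: "b < 0" and ineq: "p * (r + 1) > q * (p + 1)"
  shows "has_characteristic_orbit X"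
proof -
  obtain \<phi>1 F1 g1 where f: "\<And>x. poly \<phi> x = x ^ p * poly \<phi>1 x" "poly \<phi>1 0 = a"
    "\<And>x. poly F x = x ^ q * poly F1 x" "poly F1 0 = b"
    "\<And>x. poly g x = x ^ r * poly g1 x" "poly g1 0 = c" by (rule factors) blast
  have "q < r + 1"
  proof (rule ccontr)
    assume "\<not> q < r + 1"
    then have "p * (r + 1) \<le> (p + 1) * q" by (intro mult_mono) auto
    with ineq show False by (simp add: mult.commute)
  qed
  define \<mu> where "\<mu> = r + 1 - q"
  have \<mu>: "\<mu> \<ge> 1" "\<mu> + q = r + 1" using \<open>q < r + 1\<close> by (auto simp: \<mu>_def)
  have "p * \<mu> + p * q = p * (r + 1)" using \<mu>(2) by (metis distrib_left)
  then have pmu: "p * \<mu> > q" using ineq by (simp add: algebra_simps)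
  \<comment> \<open>Solves \<open>- k * \<mu> * b + c = 1\<close>; the left side is the leading
    coefficient \<open>h 0\<close> of the barrier inequality.\<close>
  define k where "k = (- c + 1) / (\<mu> * (- b))"
  have "\<mu> * (- b) > 0" using b \<mu> by (simp add: mult_pos_neg)
  moreover have "k * (\<mu> * (- b)) = - c + 1" using b \<mu> by (simp add: k_def)
  moreover have "k > 0" using calculation(1) c unfolding k_def by (intro divide_pos_pos) auto
  ultimately have k: "k > 0" "k * \<mu> * (- b) = - c + 1" by (simp_all only: mult.assoc)
  define h where "h x = k * \<mu> * (k ^ p * x ^ (p * \<mu> - q) * poly \<phi>1 (k * x ^ \<mu>) - poly F1 x) + poly g1 x" for x
  have "h 0 = 1" using pmu \<mu> k f by (simp add: h_def power_0_left)
  moreover have "isCont h 0" unfolding h_def[abs_def] by (intro continuous_intros)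
  ultimately have "\<forall>\<^sub>F x in at 0. h x > 0"
    by (intro order_tendstoD(1)) (auto simp: isCont_def)
  then obtain \<delta> where \<delta>: "\<delta> > 0" "\<And>x. x \<noteq> 0 \<Longrightarrow> dist x 0 < \<delta> \<Longrightarrow> h x > 0"
    by (auto simp: eventually_at)
  show ?thesis
  proof (rule characteristic_if_barrier[OF c _ \<delta>(1), of "monom k \<mu>"])
    show "poly (monom k \<mu>) 0 = 0" using \<mu> by (simp add: poly_monom power_0_left)
    fix x assume x: "0 < x" "x < \<delta>"
    show "poly (monom k \<mu>) x > 0" using x k by (simp add: poly_monom)
    have e1: "x ^ (\<mu> - 1) * x ^ q = x ^ r" using \<mu> by (simp flip: power_add)
    have e2: "x ^ (p * \<mu>) = x ^ q * x ^ (p * \<mu> - q)" using pmu by (simp flip: power_add)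
    have "poly (pderiv (monom k \<mu>)) x * (poly \<phi> (poly (monom k \<mu>) x) - poly F x) + poly g x
      = k * \<mu> * x ^ (\<mu> - 1) * (k ^ p * x ^ (p * \<mu>) * poly \<phi>1 (k * x ^ \<mu>) - x ^ q * poly F1 x) + x ^ r * poly g1 x"
      by (simp add: pderiv_monom poly_monom f power_mult_distrib mult_ac flip: power_mult)
    also have "\<dots> = (x ^ (\<mu> - 1) * x ^ q) * (k * \<mu> * (k ^ p * x ^ (p * \<mu> - q) * poly \<phi>1 (k * x ^ \<mu>) - poly F1 x)) + x ^ r * poly g1 x"
      unfolding e2 by (simp add: algebra_simps)
    also have "\<dots> = x ^ r * h x" unfolding e1 h_def by (simp add: algebra_simps)
    finally show "poly (pderiv (monom k \<mu>)) x * (poly \<phi> (poly (monom k \<mu>) x) - poly F x) + poly g x > 0"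
      using \<delta>(2)[of x] x by simp
  qed
qed

text \<open>The barrier \<open>y = x\<^sup>s (k0 + K x)\<close> follows the invariant curve \<open>y = k0 x\<^sup>s\<close> of the quasi-homogeneous
  leading part; the correction with large \<open>K\<close> settles the case of equality.\<close>

lemma characteristic_if_balanced:
  assumes a: "a = -1" and c: "c < 0" and b: "b < 0" and eq: "p * (r + 1) = q * (p + 1)"
    and ineq: "c \<ge> - (real q * \<bar>b / (real p + 1)\<bar> powr ((real p + 1) / real p))"
  shows "has_characteristic_orbit X"
proof -
  obtain \<phi>1 F1 g1 where f: "\<And>x. poly \<phi> x = x ^ p * poly \<phi>1 x" "poly \<phi>1 0 = a"
    "\<And>x. poly F x = x ^ q * poly F1 x" "poly F1 0 = b"
    "\<And>x. poly g x = x ^ r * poly g1 x" "poly g1 0 = c" by (rule factors) blast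
  have p: "p \<ge> 1" and q: "q \<ge> 1" by (fact exponents_pos)+
  \<comment> \<open>The balance of exponents forces \<open>p\<close> to divide \<open>q\<close>, so
    \<open>s = q / p\<close> is an integer and the barrier a polynomial.\<close>
  have "p dvd q * (p + 1)" using eq by (metis dvd_triv_left)
  moreover have "coprime p (p + 1)" by simp
  ultimately have "p dvd q" by (simp only: coprime_dvd_mult_left_iff)
  then obtain s where s: "q = p * s" by blast
  have s1: "s \<ge> 1" using s q by (cases s) auto
  have "p * (r + 1) = p * (s * (p + 1))" using eq s by (simp add: mult_ac)
  then have rs: "r + 1 = s * (p + 1)" using p by (metis mult_cancel1 not_one_le_zero)
  have rs': "s - 1 + p * s = r" using rs s1 by (simp add: algebra_simps)
  define \<beta> where "\<beta> = - b / (real p + 1)"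
  have "real p + 1 > 0" by simp
  then have "\<beta> > 0" unfolding \<beta>_def using b by (intro divide_pos_pos) auto
  moreover have "b = - (real p + 1) * \<beta>" using \<open>real p + 1 > 0\<close> unfolding \<beta>_def by (simp add: field_simps)
  ultimately have \<beta>: "\<beta> > 0" "b = - (real p + 1) * \<beta>" .
  \<comment> \<open>The choice \<open>k ^ p = \<beta>\<close> maximizes
    \<open>s * k * (- k ^ p - b) + c\<close> over positive \<open>k\<close>; the maximum is
    \<open>c + q * \<beta> * k\<close>, and \<open>ineq\<close> says that it is nonnegative.\<close>
  define k where "k = \<beta> powr (1 / real p)"
  have k: "k > 0" using \<beta> by (simp add: k_def)
  have kp: "k ^ p = \<beta>"
    using \<beta> p by (simp add: k_def powr_powr flip: powr_realpow)
  have "b / (real p + 1) = - \<beta>" by (simp add: \<beta>_def)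
  then have "\<bar>b / (real p + 1)\<bar> = \<beta>" using \<beta>(1) by simp
  moreover have "\<beta> powr ((real p + 1) / real p) = \<beta> * k"
    using \<beta> p by (simp add: k_def add_divide_distrib powr_add)
  ultimately have R0: "c + real q * \<beta> * k \<ge> 0" using ineq by simp
  \<comment> \<open>\<open>C\<close> collects the part of the derivative of \<open>h\<close> at
    \<open>0\<close> that is independent of \<open>K\<close>; the rest adds up to
    \<open>K * (p * \<beta>)\<close>. The factor \<open>0 ^ (s - 1)\<close> is \<open>1\<close> for
    \<open>s = 1\<close> and \<open>0\<close> otherwise.\<close>
  define C where "C = s * k * (k ^ p * (poly (pderiv \<phi>1) 0 * (k * s * 0 ^ (s - 1))) - poly (pderiv F1) 0) + poly (pderiv g1) 0"
  define K where "K = (\<bar>C\<bar> + 1) / (p * \<beta>)"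
  have K: "K > 0" "K * (p * \<beta>) = \<bar>C\<bar> + 1" using \<beta> p by (auto simp: K_def)
  define B where "B = monom k s + monom K (s + 1)"
  have B: "poly B x = x ^ s * (k + K * x)" for x by (simp add: B_def poly_monom algebra_simps)
  have B': "poly (pderiv B) x = x ^ (s - 1) * (s * k + (s + 1) * K * x)" for x
    using s1 by (cases s) (auto simp: B_def pderiv_monom pderiv_add poly_monom algebra_simps)
  define h where "h x = (s * k + (s + 1) * K * x) * ((k + K * x) ^ p * poly \<phi>1 (poly B x) - poly F1 x) + poly g1 x" for x
  have B0: "poly B 0 = 0" using s1 by (simp add: B power_0_left)
  have h0: "h 0 \<ge> 0"
  proof -
    have "h 0 = s * k * (- (k ^ p) - b) + c" by (simp add: h_def B0 f a)
    also have "\<dots> = c + real q * \<beta> * k" by (simp add: kp \<beta>(2) s algebra_simps)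
    finally show ?thesis using R0 by simp
  qed
  have dh: "(h has_real_derivative (s + 1) * K * (k ^ p * a - b) + s * k * (p * k ^ (p - 1) * K * a) + C) (at 0)"
  proof -
    have B'0: "poly (pderiv B) 0 = k * s * 0 ^ (s - 1)" by (simp add: B')
    have "(h has_real_derivative ((s + 1) * K) * ((k + K * 0) ^ p * poly \<phi>1 (poly B 0) - poly F1 0)
        + (s * k + (s + 1) * K * 0) * (((p * (k + K * 0) ^ (p - 1) * K) * poly \<phi>1 (poly B 0)
          + (k + K * 0) ^ p * (poly (pderiv \<phi>1) (poly B 0) * poly (pderiv B) 0)) - poly (pderiv F1) 0)
        + poly (pderiv g1) 0) (at 0)"
      unfolding h_def[abs_def]
      by (auto intro!: derivative_eq_intros DERIV_chain2[OF poly_DERIV] simp: algebra_simps)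
    then show ?thesis by (rule DERIV_cong) (simp add: B0 f B'0 C_def algebra_simps)
  qed
  have kk: "k * k ^ (p - 1) = \<beta>" using kp p by (metis power_eq_if not_one_le_zero)
  have "(s + 1) * K * (k ^ p * a - b) + s * k * (p * k ^ (p - 1) * K * a) + C
    = (s + 1) * K * (p * \<beta>) - s * p * K * (k * k ^ (p - 1)) + C"
    by (simp add: kp \<beta>(2) a algebra_simps)
  also have "\<dots> = K * (p * \<beta>) + C" unfolding kk by (simp add: algebra_simps)
  also have "\<dots> > 0" using K(2) by linarith
  \<comment> \<open>In the limiting case \<open>h 0\<close> vanishes; the positive derivative still
    makes \<open>h\<close> positive to the right of \<open>0\<close>.\<close>
  finally obtain \<delta> where \<delta>: "\<delta> > 0" "\<And>x. 0 < x \<Longrightarrow> x < \<delta> \<Longrightarrow> h 0 < h (0 + x)"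
    using DERIV_pos_inc_right[OF dh] by blast
  show ?thesis
  proof (rule characteristic_if_barrier[OF c B0 \<delta>(1)])
    fix x assume x: "0 < x" "x < \<delta>"
    show "poly B x > 0" using x k K by (simp add: B add_pos_pos)
    have e1: "x ^ (s - 1) * x ^ q = x ^ r" using rs' s by (simp flip: power_add)
    have e2: "poly \<phi> (poly B x) = x ^ q * ((k + K * x) ^ p * poly \<phi>1 (poly B x))"
      unfolding f(1) unfolding B by (simp add: s power_mult_distrib mult_ac flip: power_mult)
    have "poly (pderiv B) x * (poly \<phi> (poly B x) - poly F x) + poly g x
      = (x ^ (s - 1) * x ^ q) * ((s * k + (s + 1) * K * x) * ((k + K * x) ^ p * poly \<phi>1 (poly B x) - poly F1 x)) + x ^ r * poly g1 x"
      unfolding e2 B' f(3,5) by (simp add: algebra_simps)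
    also have "\<dots> = x ^ r * h x" unfolding e1 h_def by (simp add: algebra_simps)
    finally show "poly (pderiv B) x * (poly \<phi> (poly B x) - poly F x) + poly g x > 0"
      using \<delta>(2)[of x] h0 x by simp
  qed
qed

end

section \<open>The remaining signs and parities by symmetry\<close>

lemma (in lienard) characteristic_if_c_pos:
  assumes "a < 0" "c > 0"
  shows "has_characteristic_orbit X"
proof -
  interpret rev: lienard "- \<phi>" "- F" "- g" p q r "- a" "- b" "- c" by (rule reverse_lienard)
  show ?thesis using rev.characteristic_if_axis_crossed_outward assms characteristic_lienard_reverse by simp
qed

text \<open>For even \<open>r\<close>, reflection in the \<open>y\<close>-axis keeps
  \<open>c\<close> and makes the coefficient of \<open>\<phi>\<close> positive: seen from the left,
  the positive \<open>y\<close>-axis is crossed outward.\<close>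

lemma (in lienard) characteristic_if_even_r:
  assumes "a < 0" "c < 0" "even r"
  shows "has_characteristic_orbit X"
proof -
  interpret ref: lienard "- \<phi>" "- reflect_poly_arg F" "reflect_poly_arg g" p q r "- a" "- ((-1) ^ q * b)" "(-1) ^ r * c"
    by (rule reflect_x_lienard)
  show ?thesis using ref.characteristic_if_axis_crossed_outward assms characteristic_lienard_reflect_x by simp
qed

text \<open>For even \<open>p\<close>, the reflection \<open>y -> - y\<close> keeps \<open>a\<close>
  and changes the sign of \<open>c\<close>.\<close>

lemma (in lienard) characteristic_if_even_p:
  assumes "a < 0" "c < 0" "even p"
  shows "has_characteristic_orbit X"
proof -
  interpret ref: lienard "reflect_poly_arg \<phi>" F "- g" p q r "(-1) ^ p * a" b "- c"
    by (rule reflect_y_lienard)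
  show ?thesis using ref.characteristic_if_c_pos assms characteristic_lienard_reflect_y by simp
qed

text \<open>The barriers need \<open>b < 0\<close>. For odd \<open>p\<close>, reflecting
  \<open>y\<close> and reversing time restores \<open>a\<close> and \<open>c\<close> and changes
  only the sign of \<open>b\<close>.\<close>

lemma (in lienard) characteristic_if_odd:
  assumes "a = -1" "c < 0" "odd p" "p * (r + 1) \<ge> q * (p + 1)"
    and eq: "p * (r + 1) = q * (p + 1) \<Longrightarrow> c \<ge> - (real q * \<bar>b / (real p + 1)\<bar> powr ((real p + 1) / real p))"
  shows "has_characteristic_orbit X"
proof (cases "b < 0")
  case True
  then show ?thesis using assms characteristic_if_friction_dominates characteristic_if_balanced
    by (cases "p * (r + 1) = q * (p + 1)") auto
next
  case False
  interpret ref: lienard "reflect_poly_arg \<phi>" F "- g" p q r "(-1) ^ p * a" b "- c"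
    by (rule reflect_y_lienard)
  interpret rr: lienard "- reflect_poly_arg \<phi>" "- F" "- (- g)" p q r "- ((-1) ^ p * a)" "- b" "- (- c)"
    by (rule ref.reverse_lienard)
  have "- b < 0" using False coefficients_nonzero by simp
  then have "has_characteristic_orbit rr.X"
    using assms rr.characteristic_if_friction_dominates rr.characteristic_if_balanced
    by (cases "p * (r + 1) = q * (p + 1)") auto
  then show ?thesis using characteristic_lienard_reverse characteristic_lienard_reflect_y by metis
qed

lemma (in lienard) not_monodromic:
  assumes a: "a = -1"
    and not: "\<not> (p * (r + 1) < q * (p + 1) \<and> odd p \<and> odd r \<and> c < 0)"
      "\<not> (p * (r + 1) = q * (p + 1) \<and> odd p \<and> odd r \<and> c < - (real q * \<bar>b / (real p + 1)\<bar> powr ((real p + 1) / real p)))"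
  shows "has_characteristic_orbit X"
proof -
  consider "c > 0" | "c < 0" "even p" | "c < 0" "even r" | "c < 0" "odd p" "odd r"
    using coefficients_nonzero by (meson linorder_neqE)
  then show ?thesis
  proof cases
    case 4
    then show ?thesis using characteristic_if_odd[OF a] not by (meson not_le)
  qed (use a characteristic_if_c_pos characteristic_if_even_p characteristic_if_even_r in auto)
qed

section \<open>Absence of characteristic orbits\<close>

text \<open>The right-hand side is the tangent at \<open>\<tau>\<close> to the convex function
  \<open>Y^(p + 1)\<close>; Bernoulli's inequality gives the bound after rescaling by
  \<open>\<tau>\<close>. Keeping \<open>\<tau>\<close> free gives Young's inequality with a constant
  that can be made sharp.\<close>

lemma young_tangent:
  fixes Y \<tau> :: real
  assumes "Y \<ge> 0" "\<tau> \<ge> 0" "p \<ge> 1"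
  shows "Y ^ (p + 1) \<ge> (real p + 1) * \<tau> ^ p * Y - p * \<tau> ^ (p + 1)"
proof (cases "\<tau> = 0")
  case True
  then show ?thesis using assms by (simp add: power_0_left)
next
  case False
  then have \<tau>: "\<tau> > 0" using assms by simp
  have "1 + real (p + 1) * (Y / \<tau> - 1) \<le> (1 + (Y / \<tau> - 1)) ^ (p + 1)"
    by (rule Bernoulli_inequality) (use assms \<tau> in auto)
  then have "\<tau> ^ (p + 1) * (1 + real (p + 1) * (Y / \<tau> - 1)) \<le> \<tau> ^ (p + 1) * (Y / \<tau>) ^ (p + 1)"
    using \<tau> by (intro mult_left_mono) auto
  also have "\<dots> = Y ^ (p + 1)" using \<tau> by (simp add: power_divide)
  also have "\<tau> ^ (p + 1) * (1 + real (p + 1) * (Y / \<tau> - 1)) = (real p + 1) * \<tau> ^ p * Y - p * \<tau> ^ (p + 1)"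
    using \<tau> by (simp add: field_simps)
  finally show ?thesis .
qed

context lienard
begin

text \<open>(M1) and (M2) differ only in the comparison; in the case of equality
  \<open>c < 0\<close> is implied by the bound. Including \<open>a = -1\<close> lets the condition
  travel to the reflected fields as one unit.\<close>

definition monodromy_condition :: bool where
  "monodromy_condition \<longleftrightarrow> a = -1 \<and> c < 0 \<and> odd p \<and> odd r \<and>
    (p * (r + 1) < q * (p + 1) \<or>
     p * (r + 1) = q * (p + 1) \<and> c < - (real q * \<bar>b / (real p + 1)\<bar> powr ((real p + 1) / real p)))"

text \<open>The exponent of the quasi-homogeneous scaling: with \<open>y\<close> of size
  \<open>x^weight\<close> the terms \<open>x^(r + 1)\<close> and \<open>y^(p + 1)\<close> have the
  same order.\<close>

definition weight :: real where "weight = (real r + 1) / (real p + 1)"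

lemma weight_pos: "weight > 0"
  by (simp add: weight_def add_nonneg_pos)

lemma weight_powr:
  assumes "x > 0"
  shows "(x powr weight) ^ (p + 1) = x ^ (r + 1)"
proof -
  have "(x powr weight) ^ (p + 1) = x powr (weight * real (p + 1))"
    using assms powr_realpow[of "x powr weight" "p + 1"] by (simp only: powr_powr) simp
  also have "weight * real (p + 1) = real (r + 1)"
    by (simp add: weight_def field_simps)
  finally show ?thesis using assms by (simp only: powr_realpow)
qed

text \<open>In the case of strict inequality \<open>F\<close> is negligible and \<open>b0\<close> may be taken \<open>0\<close>.\<close>

lemma friction_bound:
  assumes M: "monodromy_condition"
  obtains b0 where "b0 \<ge> 0" "weight * p * (b0 / (real p + 1)) powr ((real p + 1) / real p) < - c"
    "\<And>\<eta>. \<eta> > 0 \<Longrightarrow> \<exists>\<rho>>0. \<forall>x. 0 < x \<longrightarrow> x \<le> \<rho> \<longrightarrow> \<bar>poly F x\<bar> \<le> (b0 + \<eta>) * (x powr weight) ^ p"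
proof (cases "p * (r + 1) = q * (p + 1)")
  case True
  have "real p * (real r + 1) = real q * (real p + 1)"
    using arg_cong[OF True, of real] unfolding of_nat_mult of_nat_add of_nat_1 .
  then have wq: "weight * p = q" by (simp add: weight_def field_simps add_nonneg_eq_0_iff)
  show thesis
  proof (rule that[of "\<bar>b\<bar>"])
    have "\<bar>b / (real p + 1)\<bar> = \<bar>b\<bar> / (real p + 1)" by (simp add: abs_divide)
    then show "weight * p * (\<bar>b\<bar> / (real p + 1)) powr ((real p + 1) / real p) < - c"
      using M True unfolding wq by (simp add: monodromy_condition_def)
    fix \<eta> :: real assume \<eta>: "\<eta> > 0"
    obtain \<rho> where \<rho>: "\<rho> > 0" "\<And>x. \<bar>x\<bar> \<le> \<rho> \<Longrightarrow> \<bar>poly F x - b * x ^ q\<bar> \<le> \<eta> * \<bar>x\<bar> ^ q"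
      using lowest_term_approx[OF F \<eta>] by blast
    have "\<bar>poly F x\<bar> \<le> (\<bar>b\<bar> + \<eta>) * (x powr weight) ^ p" if x: "0 < x" "x \<le> \<rho>" for x
    proof -
      have "(x powr weight) ^ p = x powr (weight * p)" using x by (simp add: powr_powr flip: powr_realpow)
      also have "\<dots> = x ^ q" using x unfolding wq by (simp add: powr_realpow)
      finally have e: "(x powr weight) ^ p = x ^ q" .
      have "\<bar>b * x ^ q\<bar> = \<bar>b\<bar> * x ^ q" using x by (simp add: abs_mult)
      then show ?thesis using \<rho>(2)[of x] x unfolding e by (simp add: algebra_simps)
    qed
    then show "\<exists>\<rho>>0. \<forall>x. 0 < x \<longrightarrow> x \<le> \<rho> \<longrightarrow> \<bar>poly F x\<bar> \<le> (\<bar>b\<bar> + \<eta>) * (x powr weight) ^ p"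
      using \<rho>(1) by blast
  qed simp
next
  case False
  then have "p * (r + 1) < q * (p + 1)" using M by (auto simp: monodromy_condition_def)
  then have "real p * (real r + 1) < real q * (real p + 1)" by (metis of_nat_1 of_nat_add of_nat_less_iff of_nat_mult)
  \<comment> \<open>So \<open>x^q\<close> is of higher order than \<open>x^(weight * p)\<close>, and
    any positive multiple of the latter dominates \<open>F\<close> near \<open>0\<close>.\<close>
  then have wq: "weight * p < q" by (simp add: weight_def field_simps add_nonneg_pos)
  show thesis
  proof (rule that[of 0])
    show "weight * p * (0 / (real p + 1)) powr ((real p + 1) / real p) < - c"
      using M by (simp add: monodromy_condition_def)
    fix \<eta> :: real assume \<eta>: "\<eta> > 0"
    obtain \<rho> where \<rho>: "\<rho> > 0" "\<And>x. \<bar>x\<bar> \<le> \<rho> \<Longrightarrow> \<bar>poly F x - b * x ^ q\<bar> \<le> 1 * \<bar>x\<bar> ^ q"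
      using lowest_term_approx[OF F, of 1] by auto
    have "((\<lambda>x. (\<bar>b\<bar> + 1) * x powr (real q - weight * p)) \<longlongrightarrow> (\<bar>b\<bar> + 1) * 0 powr (real q - weight * p)) (at_right 0)"
      using wq by (intro tendsto_intros) (auto simp: eventually_at_right_less intro: eventually_mono[OF eventually_at_right_less])
    then have "\<forall>\<^sub>F x in at_right 0. (\<bar>b\<bar> + 1) * x powr (real q - weight * p) < \<eta>"
      by (rule order_tendstoD(2)) (use \<eta> in simp)
    then obtain \<delta> where \<delta>: "\<delta> > 0" "\<And>x. 0 < x \<Longrightarrow> x < \<delta> \<Longrightarrow> (\<bar>b\<bar> + 1) * x powr (real q - weight * p) < \<eta>"
      unfolding eventually_at_right_field by blast
    have "\<bar>poly F x\<bar> \<le> (0 + \<eta>) * (x powr weight) ^ p" if x: "0 < x" "x \<le> min \<rho> (\<delta> / 2)" for x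
    proof -
      have e: "(x powr weight) ^ p = x powr (weight * p)" using x by (simp add: powr_powr flip: powr_realpow)
      have "\<bar>b * x ^ q\<bar> = \<bar>b\<bar> * x ^ q" using x by (simp add: abs_mult)
      then have "\<bar>poly F x\<bar> \<le> (\<bar>b\<bar> + 1) * x ^ q" using \<rho>(2)[of x] x by (simp add: algebra_simps)
      also have "x ^ q = x powr (real q - weight * p) * x powr (weight * p)"
        using x by (simp add: powr_realpow flip: powr_add)
      also have "(\<bar>b\<bar> + 1) * \<dots> \<le> \<eta> * x powr (weight * p)"
        using \<delta>(2)[of x] x \<delta>(1) unfolding mult.assoc[symmetric] by (intro mult_right_mono) auto
      finally show ?thesis unfolding e by simp
    qed
    then show "\<exists>\<rho>>0. \<forall>x. 0 < x \<longrightarrow> x \<le> \<rho> \<longrightarrow> \<bar>poly F x\<bar> \<le> (0 + \<eta>) * (x powr weight) ^ p"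
      using \<rho>(1) \<delta>(1) by (intro exI[of _ "min \<rho> (\<delta> / 2)"]) auto
  qed simp
qed

text \<open>The first expression is, up to a positive power of \<open>x\<close>, the derivative of
  the slope \<open>y / x^weight\<close>; the second bounds the derivative of \<open>ln x\<close> by
  the same quasi-homogeneous quantity. Only the mixed term with \<open>F\<close> could stop the
  rotation, and the tangent inequality absorbs it thanks to the strict bound on \<open>c\<close>
  from \<open>friction_bound\<close>.\<close>

lemma rotation_estimate:
  assumes M: "monodromy_condition"
  obtains \<rho> \<epsilon> C where "\<rho> > 0" "\<epsilon> > 0" "C > 0"
    "\<And>x y. 0 < x \<Longrightarrow> x \<le> \<rho> \<Longrightarrow> \<bar>y\<bar> \<le> \<rho> \<Longrightarrow>
      \<epsilon> * (x ^ (r + 1) + \<bar>y\<bar> ^ (p + 1)) \<le> - poly g x * x - weight * y * (poly \<phi> y - poly F x)"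
    "\<And>x y. 0 < x \<Longrightarrow> x \<le> \<rho> \<Longrightarrow> \<bar>y\<bar> \<le> \<rho> \<Longrightarrow>
      x powr weight * \<bar>poly \<phi> y - poly F x\<bar> \<le> C * (x ^ (r + 1) + \<bar>y\<bar> ^ (p + 1))"
proof -
  have M': "a = -1" "c < 0" "odd p" "odd r" using M by (auto simp: monodromy_condition_def)
  have p1: "p \<ge> 1" by (fact exponents_pos)
  obtain b0 where b0: "b0 \<ge> 0" "weight * p * (b0 / (real p + 1)) powr ((real p + 1) / real p) < - c"
    "\<And>\<eta>. \<eta> > 0 \<Longrightarrow> \<exists>\<rho>>0. \<forall>x. 0 < x \<longrightarrow> x \<le> \<rho> \<longrightarrow> \<bar>poly F x\<bar> \<le> (b0 + \<eta>) * (x powr weight) ^ p"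
    by (rule friction_bound[OF M]) blast
  \<comment> \<open>\<open>A \<eta>\<close> is the coefficient of
    \<open>\<bar>y\<bar>^(p + 1)\<close> left after the relative error \<open>\<eta>\<close> of
    \<open>\<phi>\<close> and a reserve \<open>\<eta>\<close> for the final estimate;
    \<open>s \<eta>\<close> is the \<open>p\<close>-th power of the tangent point that matches the
    mixed term. Both converge as \<open>\<eta>\<close> tends to \<open>0\<close>, so the strict
    inequality persists for some \<open>\<eta> > 0\<close>.\<close>
  define A where "A \<eta> = weight * (1 - \<eta>) - \<eta>" for \<eta>
  define s where "s \<eta> = weight * (b0 + \<eta>) / ((real p + 1) * A \<eta>)" for \<eta>
  have p0: "real p + 1 > 0" by simp
  have A0: "(A \<longlongrightarrow> weight) (at_right 0)"
    unfolding A_def[abs_def] by (auto intro!: tendsto_eq_intros)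
  have "(s \<longlongrightarrow> weight * (b0 + 0) / ((real p + 1) * weight)) (at_right 0)"
    unfolding s_def[abs_def] using weight_pos p0 by (intro tendsto_intros A0) auto
  then have s0: "(s \<longlongrightarrow> b0 / (real p + 1)) (at_right 0)" using weight_pos by simp
  have Apos: "\<forall>\<^sub>F \<eta> in at_right 0. A \<eta> > 0" by (rule order_tendstoD(1)[OF A0 weight_pos])
  have spos: "\<forall>\<^sub>F \<eta> in at_right 0. s \<eta> \<ge> 0" using Apos eventually_at_right_less[of 0]
    by eventually_elim (use weight_pos b0 in \<open>auto simp: s_def\<close>)
  have "((\<lambda>\<eta>. - c - 2 * \<eta> - A \<eta> * p * s \<eta> powr ((real p + 1) / real p)) \<longlongrightarrow>
      - c - 2 * 0 - weight * p * (b0 / (real p + 1)) powr ((real p + 1) / real p)) (at_right 0)"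
    using p1 by (intro tendsto_intros A0 tendsto_powr'[OF s0]) (auto simp: spos)
  then have "\<forall>\<^sub>F \<eta> in at_right 0. - c - 2 * \<eta> - A \<eta> * p * s \<eta> powr ((real p + 1) / real p) > 0"
    by (rule order_tendstoD(1)) (use b0(2) in simp)
  then have "\<forall>\<^sub>F \<eta> in at_right 0. 0 < \<eta> \<and> \<eta> < 1 \<and> A \<eta> > 0 \<and> s \<eta> \<ge> 0 \<and>
      - c - 2 * \<eta> - A \<eta> * p * s \<eta> powr ((real p + 1) / real p) > 0"
    using Apos spos eventually_at_right_less[of 0] eventually_at_right_real[OF zero_less_one]
    by eventually_elim auto
  then obtain \<eta> where \<eta>: "0 < \<eta>" "\<eta> < 1" "A \<eta> > 0" "s \<eta> \<ge> 0"
    "- c - 2 * \<eta> - A \<eta> * p * s \<eta> powr ((real p + 1) / real p) > 0"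
    using eventually_happens'[OF trivial_limit_at_right_real] by blast
  define t where "t = s \<eta> powr (1 / real p)"
  have t0: "t \<ge> 0" by (simp add: t_def)
  have tp: "t ^ p = s \<eta>"
  proof (cases "s \<eta> = 0")
    case True
    then show ?thesis using p1 by (simp add: t_def power_0_left)
  next
    case False
    then show ?thesis using \<eta>(4) p1 by (simp add: t_def powr_powr flip: powr_realpow)
  qed
  have tp1: "t ^ (p + 1) = s \<eta> powr ((real p + 1) / real p)"
  proof -
    have "s \<eta> powr ((real p + 1) / real p) = s \<eta> powr 1 * s \<eta> powr (1 / real p)"
    proof -
      have "(real p + 1) / real p = 1 + 1 / real p" using p1 by (simp add: field_simps)
      then show ?thesis by (simp only: powr_add)
    qed
    then show ?thesis using tp \<eta>(4) by (simp add: t_def[symmetric] mult.commute)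
  qed
  obtain \<rho>F where \<rho>F: "\<rho>F > 0" "\<And>x. 0 < x \<Longrightarrow> x \<le> \<rho>F \<Longrightarrow> \<bar>poly F x\<bar> \<le> (b0 + \<eta>) * (x powr weight) ^ p"
    using b0(3)[OF \<eta>(1)] by blast
  obtain \<rho>g where \<rho>g: "\<rho>g > 0" "\<And>x. \<bar>x\<bar> \<le> \<rho>g \<Longrightarrow> \<bar>poly g x - c * x ^ r\<bar> \<le> \<eta> * \<bar>x\<bar> ^ r"
    using lowest_term_approx[OF g \<eta>(1)] by blast
  obtain \<rho>\<phi> where \<rho>\<phi>: "\<rho>\<phi> > 0" "\<And>x. \<bar>x\<bar> \<le> \<rho>\<phi> \<Longrightarrow> \<bar>poly \<phi> x - a * x ^ p\<bar> \<le> \<eta> * \<bar>x\<bar> ^ p"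
    using lowest_term_approx[OF \<phi> \<eta>(1)] by blast
  define \<rho> where "\<rho> = min \<rho>F (min \<rho>g \<rho>\<phi>)"
  show thesis
  proof (rule that[of \<rho> \<eta> "2 + b0 + \<eta>"])
    show "\<rho> > 0" "\<eta> > 0" "2 + b0 + \<eta> > 0" using \<rho>F \<rho>g \<rho>\<phi> \<eta> b0 by (auto simp: \<rho>_def)
    fix x y :: real assume x: "0 < x" "x \<le> \<rho>" and y: "\<bar>y\<bar> \<le> \<rho>"
    define Y Z where "Y = \<bar>y\<bar>" and "Z = x powr weight"
    have Y0: "Y \<ge> 0" and Z0: "Z > 0" using x by (auto simp: Y_def Z_def)
    have Zp: "Z ^ (p + 1) = x ^ (r + 1)" unfolding Z_def by (rule weight_powr[OF x(1)])
    have Fx: "\<bar>poly F x\<bar> \<le> (b0 + \<eta>) * Z ^ p" using \<rho>F(2)[of x] x by (simp add: \<rho>_def Z_def)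
    have gx: "- poly g x * x \<ge> (- c - \<eta>) * Z ^ (p + 1)"
    proof -
      have "poly g x \<le> (c + \<eta>) * x ^ r" using \<rho>g(2)[of x] x by (simp add: \<rho>_def algebra_simps)
      then have "poly g x * x \<le> (c + \<eta>) * x ^ r * x" using x by (intro mult_right_mono) auto
      then show ?thesis unfolding Zp by (simp add: algebra_simps)
    qed
    have \<phi>y: "\<bar>poly \<phi> y - - (y ^ p)\<bar> \<le> \<eta> * Y ^ p" using \<rho>\<phi>(2)[of y] y M' by (simp add: \<rho>_def Y_def)
    \<comment> \<open>Odd \<open>p\<close> enters here: the power \<open>p + 1\<close> does not see
      the sign of \<open>y\<close>.\<close>
    have yy: "y * y ^ p = Y ^ (p + 1)"
    proof -
      have "even (p + 1)" using M' by simp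
      then have "Y ^ (p + 1) = y ^ (p + 1)" unfolding Y_def by (rule power_even_abs)
      then show ?thesis by simp
    qed
    have y\<phi>: "- (y * poly \<phi> y) \<ge> (1 - \<eta>) * Y ^ (p + 1)"
    proof -
      have "y * (poly \<phi> y - - (y ^ p)) \<le> \<bar>y\<bar> * \<bar>poly \<phi> y - - (y ^ p)\<bar>" by (metis abs_ge_self abs_mult)
      also have "\<dots> \<le> Y * (\<eta> * Y ^ p)" unfolding Y_def[symmetric] by (intro mult_left_mono \<phi>y Y0)
      finally show ?thesis using yy by (simp add: algebra_simps)
    qed
    have yF: "y * poly F x \<ge> - (Y * ((b0 + \<eta>) * Z ^ p))"
    proof -
      have "- (y * poly F x) \<le> \<bar>y\<bar> * \<bar>poly F x\<bar>" by (metis abs_ge_minus_self abs_mult)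
      also have "\<dots> \<le> Y * ((b0 + \<eta>) * Z ^ p)" unfolding Y_def[symmetric] by (intro mult_left_mono Fx Y0)
      finally show ?thesis by simp
    qed
    have young: "A \<eta> * Y ^ (p + 1) \<ge> weight * (b0 + \<eta>) * (Y * Z ^ p) - A \<eta> * p * t ^ (p + 1) * Z ^ (p + 1)"
    proof -
      have *: "A \<eta> * Y ^ (p + 1) \<ge> A \<eta> * ((real p + 1) * (t * Z) ^ p * Y - p * (t * Z) ^ (p + 1))"
        by (rule mult_left_mono[OF young_tangent]) (use \<eta> Y0 Z0 t0 p1 in auto)
      have "A \<eta> * ((real p + 1) * (t * Z) ^ p * Y) = (real p + 1) * A \<eta> * t ^ p * (Y * Z ^ p)"
        by (simp add: power_mult_distrib mult_ac)
      moreover have "(real p + 1) * A \<eta> * t ^ p = weight * (b0 + \<eta>)"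
        unfolding tp s_def using \<eta>(3) p0 by simp
      ultimately have "A \<eta> * ((real p + 1) * (t * Z) ^ p * Y - p * (t * Z) ^ (p + 1))
          = weight * (b0 + \<eta>) * (Y * Z ^ p) - A \<eta> * p * t ^ (p + 1) * Z ^ (p + 1)"
        by (simp only: right_diff_distrib) (simp add: power_mult_distrib)
      with * show ?thesis by linarith
    qed
    have "- poly g x * x - weight * y * (poly \<phi> y - poly F x)
      = - poly g x * x + weight * (- (y * poly \<phi> y)) + weight * (y * poly F x)" by (simp add: algebra_simps)
    also have "\<dots> \<ge> (- c - \<eta>) * Z ^ (p + 1) + weight * ((1 - \<eta>) * Y ^ (p + 1)) + weight * (- (Y * ((b0 + \<eta>) * Z ^ p)))"
      by (intro add_mono mult_left_mono gx y\<phi> yF) (use weight_pos in auto)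
    moreover have "(- c - \<eta>) * Z ^ (p + 1) + weight * ((1 - \<eta>) * Y ^ (p + 1)) + weight * (- (Y * ((b0 + \<eta>) * Z ^ p)))
      = (- c - \<eta>) * Z ^ (p + 1) + \<eta> * Y ^ (p + 1) + (A \<eta> * Y ^ (p + 1) - weight * (b0 + \<eta>) * (Y * Z ^ p))"
      by (simp add: A_def algebra_simps)
    moreover have "\<dots> \<ge> (- c - \<eta> - A \<eta> * p * t ^ (p + 1)) * Z ^ (p + 1) + \<eta> * Y ^ (p + 1)"
      using young by (simp add: algebra_simps)
    moreover have "(- c - \<eta> - A \<eta> * p * t ^ (p + 1)) * Z ^ (p + 1) \<ge> \<eta> * Z ^ (p + 1)"
      using \<eta>(5) Z0 unfolding tp1 by (intro mult_right_mono) auto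
    ultimately show "\<eta> * (x ^ (r + 1) + \<bar>y\<bar> ^ (p + 1)) \<le> - poly g x * x - weight * y * (poly \<phi> y - poly F x)"
      unfolding Y_def[symmetric] Zp[symmetric] distrib_left by linarith
    have ZY: "Z * Y ^ p \<le> Z ^ (p + 1) + Y ^ (p + 1)"
    proof (cases "Z \<le> Y")
      case True
      then have "Z * Y ^ p \<le> Y * Y ^ p" using Y0 by (intro mult_right_mono) auto
      moreover have "0 \<le> Z ^ (p + 1)" using Z0 by simp
      ultimately show ?thesis by simp
    next
      case False
      then have "Z * Y ^ p \<le> Z * Z ^ p" using Y0 Z0 by (intro mult_left_mono power_mono) auto
      moreover have "0 \<le> Y ^ (p + 1)" using Y0 by simp
      ultimately show ?thesis by simp
    qed
    have "\<bar>poly \<phi> y - poly F x\<bar> \<le> 2 * Y ^ p + (b0 + \<eta>) * Z ^ p"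
    proof -
      have "\<bar>- (y ^ p)\<bar> = Y ^ p" by (simp add: Y_def power_abs)
      moreover have "\<eta> * Y ^ p \<le> 1 * Y ^ p" using \<eta> Y0 by (intro mult_right_mono) auto
      ultimately show ?thesis using \<phi>y Fx by linarith
    qed
    then have "Z * \<bar>poly \<phi> y - poly F x\<bar> \<le> Z * (2 * Y ^ p + (b0 + \<eta>) * Z ^ p)"
      using Z0 by (intro mult_left_mono) auto
    also have "\<dots> = 2 * (Z * Y ^ p) + (b0 + \<eta>) * Z ^ (p + 1)" by (simp add: algebra_simps)
    also have "\<dots> \<le> 2 * (Z ^ (p + 1) + Y ^ (p + 1)) + (b0 + \<eta>) * (Z ^ (p + 1) + Y ^ (p + 1))"
      using ZY b0 \<eta> Y0 by (intro add_mono mult_left_mono) auto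
    also have "\<dots> = (2 + b0 + \<eta>) * (Z ^ (p + 1) + Y ^ (p + 1))" by (simp add: algebra_simps)
    finally show "x powr weight * \<bar>poly \<phi> y - poly F x\<bar> \<le> (2 + b0 + \<eta>) * (x ^ (r + 1) + \<bar>y\<bar> ^ (p + 1))"
      unfolding Y_def[symmetric] Z_def[symmetric] Zp[symmetric] .
  qed
qed

text \<open>In quasi-homogeneous coordinates the slope \<open>u = y / x\<^sup>w\<close> grows at least proportionally to the
  variation of \<open>ln x\<close>; since \<open>u\<close> stays negative, \<open>x\<close> cannot tend to \<open>0\<close>.\<close>

lemma not_eventually_right:
  assumes M: "monodromy_condition" and \<gamma>: "integral_curve X {0..} \<gamma>"
    and lim: "(\<gamma> \<longlongrightarrow> (0, 0)) at_top"
  shows "\<not> (\<forall>\<^sub>F t in at_top. fst (\<gamma> t) > 0)"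
proof
  assume ev: "\<forall>\<^sub>F t in at_top. fst (\<gamma> t) > 0"
  define x y where "x t = fst (\<gamma> t)" and "y t = snd (\<gamma> t)" for t
  have c: "c < 0" using M by (simp add: monodromy_condition_def)
  obtain \<rho> \<epsilon> C where \<rho>: "\<rho> > 0" "\<epsilon> > 0" "C > 0"
    "\<And>x y. 0 < x \<Longrightarrow> x \<le> \<rho> \<Longrightarrow> \<bar>y\<bar> \<le> \<rho> \<Longrightarrow>
      \<epsilon> * (x ^ (r + 1) + \<bar>y\<bar> ^ (p + 1)) \<le> - poly g x * x - weight * y * (poly \<phi> y - poly F x)"
    "\<And>x y. 0 < x \<Longrightarrow> x \<le> \<rho> \<Longrightarrow> \<bar>y\<bar> \<le> \<rho> \<Longrightarrow>
      x powr weight * \<bar>poly \<phi> y - poly F x\<bar> \<le> C * (x ^ (r + 1) + \<bar>y\<bar> ^ (p + 1))"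
    by (rule rotation_estimate[OF M]) blast
  obtain \<rho>0 where \<rho>0: "\<And>\<rho>. 0 < \<rho> \<Longrightarrow> \<rho> \<le> \<rho>0 \<Longrightarrow> good_radius \<rho>" "\<rho>0 > 0" using good_radius_ex by blast
  have x0: "(x \<longlongrightarrow> 0) at_top" and y0: "(y \<longlongrightarrow> 0) at_top"
    using tendsto_fst[OF lim] tendsto_snd[OF lim] by (simp_all add: x_def[abs_def] y_def[abs_def])
  have "\<forall>\<^sub>F t in at_top. t > 0 \<and> 0 < x t \<and> x t < min \<rho> \<rho>0 \<and> \<bar>y t\<bar> < \<rho>"
    using ev eventually_gt_at_top[of 0] order_tendstoD(2)[OF x0, of "min \<rho> \<rho>0"]
      order_tendstoD(2)[OF tendsto_rabs[OF y0], of \<rho>] \<rho>(1) \<rho>0(2)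
    by (simp add: x_def eventually_conj_iff)
  then obtain T where T: "\<And>t. t \<ge> T \<Longrightarrow> t > 0 \<and> 0 < x t \<and> x t < min \<rho> \<rho>0 \<and> \<bar>y t\<bar> < \<rho>"
    unfolding eventually_at_top_linorder by blast
  have dx: "DERIV x t :> poly \<phi> (y t) - poly F (x t)" and dy: "DERIV y t :> - poly g (x t)" if "t \<ge> T" for t
    using curve_components[OF \<gamma>, of t] T[OF that] by (auto simp: x_def[abs_def] y_def[abs_def])
  have ymono: "y s \<le> y t" if "T \<le> s" "s \<le> t" for s t
  proof (rule DERIV_nonneg_imp_nondecreasing[OF that(2)])
    fix u assume u: "s \<le> u" "u \<le> t"
    have "good_radius \<rho>0" using \<rho>0 by simp
    then have "poly g (x u) * c > 0" using T[of u] u that by (simp add: good_radius_def)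
    then have "poly g (x u) < 0" using c by (simp add: zero_less_mult_iff)
    then show "\<exists>z. DERIV y u :> z \<and> 0 \<le> z" using dy[of u] u that by (intro exI conjI) auto
  qed
  \<comment> \<open>\<open>y\<close> does not decrease and tends to \<open>0\<close>, hence it is
    never positive after \<open>T\<close>.\<close>
  have yneg: "y t \<le> 0" if "t \<ge> T" for t
    by (rule tendsto_lowerbound[OF y0])
      (use ymono that in \<open>auto intro!: eventually_mono[OF eventually_ge_at_top[of t]]\<close>)
  \<comment> \<open>The quotient of the two rotation constants: with this factor the growth of the
    slope outweighs any decrease of \<open>ln x\<close>, so \<open>L\<close> does not
    decrease.\<close>
  define K where "K = C / \<epsilon>"
  define u where "u t = y t * x t powr (- weight)" for t
  define L where "L t = ln (x t) + K * u t" for t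
  have dL: "\<exists>z. DERIV L t :> z \<and> 0 \<le> z" if t: "t \<ge> T" for t
  proof -
    define x' y' where "x' = poly \<phi> (y t) - poly F (x t)" and "y' = - poly g (x t)"
    note d = dx[OF t, folded x'_def] dy[OF t, folded y'_def]
    have xt: "0 < x t" "x t \<le> \<rho>" "\<bar>y t\<bar> \<le> \<rho>" using T[OF t] by auto
    define P where "P = x t powr (- weight - 1)"
    have P: "P > 0" using xt by (simp add: P_def)
    have e1: "x t powr (- weight) = P * x t"
    proof -
      have "P * x t = x t powr (- weight - 1) * x t powr 1" using xt by (simp add: P_def)
      also have "\<dots> = x t powr (- weight - 1 + 1)" by (simp only: powr_add)
      finally show ?thesis by simp
    qed
    have "DERIV u t :> y' * x t powr (- weight) + (- weight * x t powr (- weight - 1) * x') * y t"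
      unfolding u_def[abs_def] by (rule DERIV_mult[OF d(2) DERIV_cong[OF has_real_derivative_powr[THEN DERIV_chain2, OF xt(1) d(1)] refl]])
    then have du: "DERIV u t :> P * (y' * x t - weight * y t * x')"
      unfolding e1 P_def[symmetric] by (rule DERIV_cong) (simp add: algebra_simps)
    have "DERIV (\<lambda>t. ln (x t)) t :> 1 / x t * x'"
      by (rule DERIV_chain2[OF DERIV_ln_divide[OF xt(1)] d(1)])
    then have dL: "DERIV L t :> 1 / x t * x' + K * (P * (y' * x t - weight * y t * x'))"
      unfolding L_def[abs_def] by (intro DERIV_add DERIV_cmult du)
    have "1 / x t = P * x t powr weight"
      unfolding P_def powr_add[symmetric] using xt by (simp add: powr_minus_divide)
    then have "- (1 / x t * x') = P * (x t powr weight * (- x'))" by simp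
    also have "\<dots> \<le> P * (x t powr weight * \<bar>x'\<bar>)"
      using P xt by (intro mult_left_mono) auto
    also have "\<dots> \<le> P * (C * (x t ^ (r + 1) + \<bar>y t\<bar> ^ (p + 1)))"
      using \<rho>(5)[OF xt] P unfolding x'_def by (intro mult_left_mono) auto
    also have "\<dots> = K * (P * (\<epsilon> * (x t ^ (r + 1) + \<bar>y t\<bar> ^ (p + 1))))" using \<rho>(2) by (simp add: K_def)
    also have "\<dots> \<le> K * (P * (y' * x t - weight * y t * x'))"
      using \<rho>(4)[OF xt] P \<rho>(2,3) unfolding x'_def y'_def by (intro mult_left_mono) (auto simp: K_def)
    finally show ?thesis using dL by (intro exI conjI) auto
  qed
  have "x t \<ge> exp (L T)" if t: "t \<ge> T" for t
  proof -
    have "L T \<le> L t" by (rule DERIV_nonneg_imp_nondecreasing[OF t]) (use dL in auto)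
    moreover have "K \<ge> 0" "u t \<le> 0" using yneg[OF t] \<rho>(2,3)
      by (simp_all add: K_def u_def mult_nonpos_nonneg)
    then have "K * u t \<le> 0" by (rule mult_nonneg_nonpos)
    ultimately have "L T \<le> ln (x t)" by (simp add: L_def)
    then show ?thesis using T[OF t] by (metis exp_le_cancel_iff exp_ln)
  qed
  then have "0 \<ge> exp (L T)"
    by (intro tendsto_lowerbound[OF x0]) (auto intro!: eventually_mono[OF eventually_ge_at_top[of T]])
  then show False using exp_gt_zero[of "L T"] by linarith
qed

section \<open>The half-turn and the time-reversing reflection\<close>

lemma point_reflection_lienard:
  "lienard (- reflect_poly_arg \<phi>) (- reflect_poly_arg F) (- reflect_poly_arg g) p q r
    (- ((-1) ^ p * a)) (- ((-1) ^ q * b)) (- ((-1) ^ r * c))"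
  using \<phi> F g by unfold_locales (intro lowest_term_minus lowest_term_reflect; assumption)+

text \<open>The map \<open>y -> - y\<close> with time reversed preserves the half-planes and
  \<open>g\<close> and negates \<open>F\<close>. It exchanges forward and backward orbits and also
  the two signs in the comparison of \<open>F\<close> across the axis.\<close>

lemma time_reflection_lienard:
  "lienard (- reflect_poly_arg \<phi>) (- F) g p q r (- ((-1) ^ p * a)) (- b) c"
  using \<phi> F g by unfold_locales (assumption | intro lowest_term_minus lowest_term_reflect; assumption | rule lowest_term_minus; assumption)+

end

lemma lienard_field_point_reflection:
  "(\<lambda>v. axis_reflection (-1) (-1) (lienard_field \<phi> F g (axis_reflection (-1) (-1) v))) =
    lienard_field (- reflect_poly_arg \<phi>) (- reflect_poly_arg F) (- reflect_poly_arg g)"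
  by (simp add: lienard_field_def axis_reflection_def fun_eq_iff poly_pcompose)

lemma lienard_field_time_reflection:
  "(\<lambda>v. axis_reflection 1 (-1) (- lienard_field \<phi> F g (axis_reflection 1 (-1) v))) =
    lienard_field (- reflect_poly_arg \<phi>) (- F) g"
  by (simp add: lienard_field_def axis_reflection_def fun_eq_iff poly_pcompose)

lemma axis_reflection_tendsto:
  "(f \<longlongrightarrow> l) H \<Longrightarrow> ((\<lambda>t. axis_reflection s1 s2 (f t)) \<longlongrightarrow> axis_reflection s1 s2 l) H"
  by (rule bounded_linear.tendsto[OF bounded_linear_axis_reflection])

context lienard
begin

lemma monodromy_point_reflection:
  assumes "monodromy_condition"
  shows "lienard.monodromy_condition p q r (- ((-1) ^ p * a)) (- ((-1) ^ q * b)) (- ((-1) ^ r * c))"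
proof -
  interpret ref: lienard "- reflect_poly_arg \<phi>" "- reflect_poly_arg F" "- reflect_poly_arg g" p q r
    "- ((-1) ^ p * a)" "- ((-1) ^ q * b)" "- ((-1) ^ r * c)"
    by (rule point_reflection_lienard)
  show ?thesis
    unfolding ref.monodromy_condition_def using assms[unfolded monodromy_condition_def]
    by (auto simp: abs_mult power_abs)
qed

lemma monodromy_time_reflection:
  assumes "monodromy_condition"
  shows "lienard.monodromy_condition p q r (- ((-1) ^ p * a)) (- b) c"
proof -
  interpret ref: lienard "- reflect_poly_arg \<phi>" "- F" g p q r "- ((-1) ^ p * a)" "- b" c
    by (rule time_reflection_lienard)
  show ?thesis
    unfolding ref.monodromy_condition_def using assms[unfolded monodromy_condition_def] by auto
qed

lemma not_eventually_left:
  assumes M: "monodromy_condition" and \<gamma>: "integral_curve X {0..} \<gamma>"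
    and lim: "(\<gamma> \<longlongrightarrow> (0, 0)) at_top"
  shows "\<not> (\<forall>\<^sub>F t in at_top. fst (\<gamma> t) < 0)"
proof -
  interpret ref: lienard "- reflect_poly_arg \<phi>" "- reflect_poly_arg F" "- reflect_poly_arg g" p q r
    "- ((-1) ^ p * a)" "- ((-1) ^ q * b)" "- ((-1) ^ r * c)"
    by (rule point_reflection_lienard)
  have "ref.monodromy_condition" by (rule monodromy_point_reflection[OF M])
  moreover have "integral_curve ref.X {0..} (\<lambda>t. axis_reflection (-1) (-1) (\<gamma> t))"
    using integral_curve_axis_reflection[OF \<gamma>, of "-1" "-1"] by (simp add: lienard_field_point_reflection)
  moreover have "((\<lambda>t. axis_reflection (-1) (-1) (\<gamma> t)) \<longlongrightarrow> (0, 0)) at_top"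
    using axis_reflection_tendsto[OF lim, of "-1" "-1"] by (simp add: axis_reflection_def)
  ultimately show ?thesis
    using ref.not_eventually_right by (fastforce simp: axis_reflection_def)
qed

text \<open>A nonvertical limiting direction would eventually keep \<open>x\<close> of one sign. A
  vertical one keeps \<open>y\<close> of one sign, and then the \<open>y\<close>-axis can be crossed
  in one direction only, so again \<open>x\<close> is eventually of one sign. Either way the orbit
  would tend to the origin inside one half-plane.\<close>

lemma no_forward_characteristic_orbit:
  assumes M: "monodromy_condition" and \<gamma>: "integral_curve X {0..} \<gamma>"
    and nz: "\<And>t. t \<ge> 0 \<Longrightarrow> \<gamma> t \<noteq> (0, 0)"
    and lim: "(\<gamma> \<longlongrightarrow> (0, 0)) at_top"
    and dir: "((\<lambda>t. sgn (\<gamma> t)) \<longlongrightarrow> u) at_top"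
  shows False
proof -
  define x y where "x t = fst (\<gamma> t)" and "y t = snd (\<gamma> t)" for t
  have M': "a = -1" "odd p" using M by (auto simp: monodromy_condition_def)
  have x0: "(x \<longlongrightarrow> 0) at_top" and y0: "(y \<longlongrightarrow> 0) at_top"
    using tendsto_fst[OF lim] tendsto_snd[OF lim] by (simp_all add: x_def[abs_def] y_def[abs_def])
  have dirx: "((\<lambda>t. fst (sgn (\<gamma> t))) \<longlongrightarrow> fst u) at_top" and diry: "((\<lambda>t. snd (sgn (\<gamma> t))) \<longlongrightarrow> snd u) at_top"
    using tendsto_fst[OF dir] tendsto_snd[OF dir] by simp_all
  have sx: "fst (sgn v) = fst v / norm v" "snd (sgn v) = snd v / norm v" for v :: "real \<times> real"
    by (simp_all add: sgn_div_norm divide_inverse mult.commute)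
  have R: "\<not> (\<forall>\<^sub>F t in at_top. x t > 0)" and Lf: "\<not> (\<forall>\<^sub>F t in at_top. x t < 0)"
    using not_eventually_right[OF M \<gamma> lim] not_eventually_left[OF M \<gamma> lim] by (simp_all add: x_def)
  have "\<not> fst u > 0"
  proof
    assume "fst u > 0"
    then have "\<forall>\<^sub>F t in at_top. fst (sgn (\<gamma> t)) > 0" using order_tendstoD(1)[OF dirx] by blast
    then have "\<forall>\<^sub>F t in at_top. x t > 0"
      by (rule eventually_mono) (auto simp: sx x_def zero_less_divide_iff)
    with R show False ..
  qed
  moreover have "\<not> fst u < 0"
  proof
    assume "fst u < 0"
    then have "\<forall>\<^sub>F t in at_top. fst (sgn (\<gamma> t)) < 0" using order_tendstoD(2)[OF dirx] by blast
    then have "\<forall>\<^sub>F t in at_top. x t < 0"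
      by (rule eventually_mono) (auto simp: sx x_def divide_less_0_iff)
    with Lf show False ..
  qed
  ultimately have u1: "fst u = 0" by linarith
  have "norm u = 1"
  proof (rule tendsto_unique[OF _ tendsto_norm[OF dir]])
    show "((\<lambda>t. norm (sgn (\<gamma> t))) \<longlongrightarrow> 1) at_top"
      by (rule tendsto_eventually)
        (use nz in \<open>auto simp: norm_sgn zero_prod_def intro!: eventually_mono[OF eventually_ge_at_top[of 0]]\<close>)
  qed simp
  then have "\<bar>snd u\<bar> = 1" using u1 by (simp add: norm_prod_def)
  then consider "snd u > 0" | "snd u < 0" by linarith
  then have ysign: "(\<forall>\<^sub>F t in at_top. y t > 0) \<or> (\<forall>\<^sub>F t in at_top. y t < 0)"
  proof cases
    case 1
    then have "\<forall>\<^sub>F t in at_top. snd (sgn (\<gamma> t)) > 0" using order_tendstoD(1)[OF diry] by blast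
    then have "\<forall>\<^sub>F t in at_top. y t > 0"
      by (rule eventually_mono) (auto simp: sx y_def zero_less_divide_iff)
    then show ?thesis ..
  next
    case 2
    then have "\<forall>\<^sub>F t in at_top. snd (sgn (\<gamma> t)) < 0" using order_tendstoD(2)[OF diry] by blast
    then have "\<forall>\<^sub>F t in at_top. y t < 0"
      by (rule eventually_mono) (auto simp: sx y_def divide_less_0_iff)
    then show ?thesis ..
  qed
  then obtain s :: real where s: "s = 1 \<or> s = -1" "\<forall>\<^sub>F t in at_top. s * y t > 0"
    by (elim disjE) (force intro: that)+
  obtain \<rho> where \<rho>: "\<rho> > 0" "\<And>x. \<bar>x\<bar> \<le> \<rho> \<Longrightarrow> x \<noteq> 0 \<Longrightarrow> poly \<phi> x * (a * x ^ p) > 0"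
    using lowest_term_sign[OF \<phi>] by blast
  have "\<forall>\<^sub>F t in at_top. t > 0 \<and> s * y t > 0 \<and> \<bar>y t\<bar> < \<rho>"
    using s(2) eventually_gt_at_top[of 0] order_tendstoD(2)[OF tendsto_rabs[OF y0], of \<rho>] \<rho>(1)
    by (simp add: eventually_conj_iff)
  then obtain T where T: "\<And>t. t \<ge> T \<Longrightarrow> t > 0 \<and> s * y t > 0 \<and> \<bar>y t\<bar> < \<rho>"
    unfolding eventually_at_top_linorder by blast
  \<comment> \<open>With \<open>s\<close> the eventual sign of \<open>y\<close>, the function
    \<open>- s * x\<close> increases at every crossing of the axis, because \<open>\<phi>\<close>
    has the sign opposite to \<open>y\<close>.\<close>
  define w where "w t = - s * x t" for t
  have dw: "DERIV w t :> - s * (poly \<phi> (y t) - poly F (x t))" if "t \<ge> T" for t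
    using curve_components(1)[OF \<gamma>, of t] T[OF that] unfolding w_def[abs_def] x_def[abs_def] y_def
    by (intro DERIV_cmult) auto
  have wcross: "w t > 0" if t: "T \<le> t1" "t1 < t" "w t1 \<ge> 0" for t1 t
  proof (rule cross_pos[of t1 t w])
    show "t1 < t" "w t1 \<ge> 0" by (fact t)+
    show "continuous_on {t1..t} w"
      by (intro DERIV_atLeastAtMost_imp_continuous_on) (use dw t in \<open>meson order_trans\<close>)
    fix v assume v: "v \<in> {t1..t}" "w v = 0"
    then have x: "x v = 0" using s by (auto simp: w_def)
    have v': "v \<ge> T" using v t by simp
    have "y v \<noteq> 0" using T[OF v'] by auto
    then have "poly \<phi> (y v) * (- (y v ^ p)) > 0" using \<rho>(2)[of "y v"] T[OF v'] M' by auto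
    then have "- s * poly \<phi> (y v) > 0"
      using s(1) T[OF v'] M'(2) by (auto simp: mult_less_0_iff zero_less_mult_iff zero_less_power_eq power_less_zero_eq)
    then have "- s * (poly \<phi> (y v) - poly F (x v)) > 0" using x lowest_term_zero[OF F] by simp
    then show "\<exists>d>0. (w has_real_derivative d) (at v within {t1..t})"
      using dw[OF v'] by (blast intro: has_field_derivative_at_within)
  qed
  have "(\<forall>\<^sub>F t in at_top. w t > 0) \<or> (\<forall>\<^sub>F t in at_top. w t < 0)"
  proof (cases "\<exists>t1\<ge>T. w t1 \<ge> 0")
    case True
    then obtain t1 where "t1 \<ge> T" "w t1 \<ge> 0" by blast
    then have "\<forall>\<^sub>F t in at_top. w t > 0"
      by (intro eventually_mono[OF eventually_gt_at_top[of t1]] wcross[of t1]) auto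
    then show ?thesis ..
  next
    case False
    then have "\<forall>t\<ge>T. w t < 0" by (meson not_le)
    then have "\<forall>\<^sub>F t in at_top. w t < 0" unfolding eventually_at_top_linorder by blast
    then show ?thesis ..
  qed
  with R Lf s(1) show False by (auto simp: w_def)
qed

lemma no_characteristic_orbit:
  assumes M: "monodromy_condition"
  shows "\<not> has_characteristic_orbit X"
proof
  assume "has_characteristic_orbit X"
  then obtain \<gamma> where "characteristic_orbit X (0, 0) \<gamma>" by (auto simp: has_characteristic_orbit_def)
  then consider u where "integral_curve X {0..} \<gamma>" "\<forall>t\<ge>0. \<gamma> t \<noteq> (0, 0)" "(\<gamma> \<longlongrightarrow> (0, 0)) at_top"
      "((\<lambda>t. sgn (\<gamma> t - (0, 0))) \<longlongrightarrow> u) at_top"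
    | u where "integral_curve X {..0} \<gamma>" "\<forall>t\<le>0. \<gamma> t \<noteq> (0, 0)" "(\<gamma> \<longlongrightarrow> (0, 0)) at_bot"
      "((\<lambda>t. sgn (\<gamma> t - (0, 0))) \<longlongrightarrow> u) at_bot"
    unfolding characteristic_orbit_def by blast
  then show False
  proof cases
    case 1
    then show False using no_forward_characteristic_orbit[OF M, of \<gamma> u] by (simp flip: zero_prod_def)
  next
    case 2
    interpret ref: lienard "- reflect_poly_arg \<phi>" "- F" g p q r "- ((-1) ^ p * a)" "- b" c
      by (rule time_reflection_lienard)
    let ?R = "axis_reflection 1 (-1)"
    have M': "ref.monodromy_condition" by (rule monodromy_time_reflection[OF M])
    have "integral_curve (\<lambda>v. - X v) {0..} (\<lambda>t. \<gamma> (- t))" using integral_curve_reflect[OF 2(1)] by simp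
    from integral_curve_axis_reflection[OF this, of 1 "-1"]
    have 1: "integral_curve ref.X {0..} (\<lambda>t. ?R (\<gamma> (- t)))" by (simp add: lienard_field_time_reflection)
    have bot: "filterlim uminus at_bot (at_top :: real filter)" by (rule filterlim_uminus_at_bot_at_top)
    have 3: "((\<lambda>t. ?R (\<gamma> (- t))) \<longlongrightarrow> (0, 0)) at_top"
      using axis_reflection_tendsto[OF filterlim_compose[OF 2(3) bot], of 1 "-1"] by (simp add: axis_reflection_def)
    have "sgn (?R v) = ?R (sgn v)" for v
      by (cases v) (simp add: sgn_div_norm axis_reflection_def norm_prod_def)
    then have 4: "((\<lambda>t. sgn (?R (\<gamma> (- t)))) \<longlongrightarrow> ?R u) at_top"
      using axis_reflection_tendsto[OF filterlim_compose[OF 2(4) bot], of 1 "-1"] by (simp flip: zero_prod_def)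
    have "?R (\<gamma> (- t)) \<noteq> (0, 0)" if "t \<ge> 0" for t
      using 2(2)[rule_format, of "- t"] that by (cases "\<gamma> (- t)") (simp add: axis_reflection_def)
    from ref.no_forward_characteristic_orbit[OF M' 1 this 3 4] show False by simp
  qed
qed

lemma characteristic_orbit_iff:
  assumes "a = -1"
  shows "has_characteristic_orbit X \<longleftrightarrow> \<not> monodromy_condition"
proof (cases "monodromy_condition")
  case False
  have "c < 0" if "c < - (real q * \<bar>b / (real p + 1)\<bar> powr ((real p + 1) / real p))"
    by (rule less_le_trans[OF that]) simp
  then have "has_characteristic_orbit X"
    by (intro not_monodromic[OF assms]) (use False[unfolded monodromy_condition_def] assms in blast)+
  with False show ?thesis by simp
qed (simp add: no_characteristic_orbit)

end

section \<open>Level sets near an extremum of even order\<close>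

text \<open>Complex arguments make holomorphic inverse functions and the isolation of zeros
  applicable.\<close>

definition complex_poly :: "real poly \<Rightarrow> complex \<Rightarrow> complex" where
  "complex_poly P w = (\<Sum>i\<le>degree P. complex_of_real (coeff P i) * w ^ i)"

lemma complex_poly_of_real: "complex_poly P (of_real x) = of_real (poly P x)"
  by (simp add: complex_poly_def poly_altdef)

lemma complex_poly_holomorphic: "f holomorphic_on S \<Longrightarrow> (\<lambda>w. complex_poly P (f w)) holomorphic_on S"
  unfolding complex_poly_def by (intro holomorphic_intros)

lemma nonzero_constant_sign:
  fixes D :: "real \<Rightarrow> real"
  assumes cont: "continuous_on {0<..<\<tau>} D" and nz: "\<And>t. 0 < t \<Longrightarrow> t < \<tau> \<Longrightarrow> D t \<noteq> 0"
  shows "(\<forall>t. 0 < t \<and> t < \<tau> \<longrightarrow> D t > 0) \<or> (\<forall>t. 0 < t \<and> t < \<tau> \<longrightarrow> D t < 0)"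
proof (rule ccontr)
  assume "\<not> ?thesis"
  then obtain s t where st: "0 < s" "s < \<tau>" "D s < 0" "0 < t" "t < \<tau>" "D t > 0"
    using nz by (metis linorder_neqE)
  have "connected (D ` {0<..<\<tau>})" using cont by (intro connected_continuous_image) auto
  moreover have "D s \<in> D ` {0<..<\<tau>}" "D t \<in> D ` {0<..<\<tau>}" using st by auto
  ultimately have "0 \<in> D ` {0<..<\<tau>}" using st connected_contains_Icc[of "D ` {0<..<\<tau>}" "D s" "D t"] by auto
  with nz show False by auto
qed

text \<open>With \<open>h x = x Q(x)\<^sup>1\<^sup>/\<^sup>n\<close> the level sets of \<open>x\<^sup>n Q(x)\<close> are \<open>h x = \<plusminus> t\<close>, and the inverse \<open>k\<close> of \<open>h\<close> is
  analytic; hence so is \<open>F (k t) - F (k (- t))\<close>, which vanishes identically or has isolated zeros.\<close>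

lemma even_order_level_pairs:
  fixes Q F :: "real poly"
  assumes n: "even n" "n \<ge> 1" and Q0: "poly Q 0 > 0"
  obtains \<sigma> \<delta> where "\<delta> > 0" "\<sigma> 0 = 0" "(\<sigma> has_real_derivative -1) (at 0)"
    "\<And>x. x \<noteq> 0 \<Longrightarrow> \<bar>x\<bar> < \<delta> \<Longrightarrow> x * \<sigma> x < 0 \<and> \<sigma> x ^ n * poly Q (\<sigma> x) = x ^ n * poly Q x"
    "(\<forall>x z. 0 < x \<and> x < \<delta> \<and> - \<delta> < z \<and> z < 0 \<and> x ^ n * poly Q x = z ^ n * poly Q z \<longrightarrow> poly F x = poly F z) \<or>
     (\<forall>x z. 0 < x \<and> x < \<delta> \<and> - \<delta> < z \<and> z < 0 \<and> x ^ n * poly Q x = z ^ n * poly Q z \<longrightarrow> poly F x > poly F z) \<or>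
     (\<forall>x z. 0 < x \<and> x < \<delta> \<and> - \<delta> < z \<and> z < 0 \<and> x ^ n * poly Q x = z ^ n * poly Q z \<longrightarrow> poly F x < poly F z)"
proof -
  have contQ: "continuous_on UNIV (complex_poly Q)"
    unfolding complex_poly_def[abs_def] by (intro continuous_intros)
  have cQ0: "complex_poly Q 0 = of_real (poly Q 0)" using complex_poly_of_real[of Q 0] by simp
  have "isCont (complex_poly Q) 0" using contQ by (simp add: continuous_on_eq_continuous_at)
  then have "isCont (\<lambda>w. Re (complex_poly Q w)) 0" by (rule continuous_Re)
  then have "\<forall>\<^sub>F w in at 0. Re (complex_poly Q w) > 0"
    using Q0 cQ0 by (intro order_tendstoD(1)[where y = "Re (complex_poly Q 0)"]) (simp_all add: isCont_def)
  then obtain \<rho>1 where \<rho>1: "\<rho>1 > 0" "\<And>w. w \<noteq> 0 \<Longrightarrow> dist w 0 < \<rho>1 \<Longrightarrow> Re (complex_poly Q w) > 0"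
    unfolding eventually_at by auto
  have Re_pos: "Re (complex_poly Q w) > 0" if "norm w < \<rho>1" for w
    using \<rho>1(2)[of w] that Q0 cQ0 by (cases "w = 0") auto
  \<comment> \<open>A positive real part keeps \<open>Q\<close> off the cut of the principal power,
    which is therefore a holomorphic \<open>n\<close>-th root near \<open>0\<close>.\<close>
  define m where "m w = complex_poly Q w powr of_real (1 / real n)" for w
  define h where "h w = w * m w" for w
  have holm: "m holomorphic_on ball 0 \<rho>1"
    unfolding m_def[abs_def]
  proof (intro holomorphic_intros complex_poly_holomorphic)
    fix w :: complex assume "w \<in> ball 0 \<rho>1"
    then have "Re (complex_poly Q w) > 0" by (intro Re_pos) simp
    then show "complex_poly Q w \<notin> \<real>\<^sub>\<le>\<^sub>0" by (auto simp: complex_nonpos_Reals_iff)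
  qed
  then have holh: "h holomorphic_on ball 0 \<rho>1" unfolding h_def[abs_def] by (intro holomorphic_intros)
  define \<mu> where "\<mu> = poly Q 0 powr (1 / real n)"
  have \<mu>: "\<mu> > 0" using Q0 by (simp add: \<mu>_def)
  have m0: "m 0 = of_real \<mu>" using Q0 unfolding m_def cQ0 \<mu>_def by (subst powr_of_real) auto
  have dh: "(h has_field_derivative of_real \<mu>) (at 0)"
  proof -
    have "(m has_field_derivative deriv m 0) (at 0)"
      using holm \<rho>1(1) by (intro holomorphic_derivI[of _ "ball 0 \<rho>1"]) auto
    from DERIV_mult[OF DERIV_ident this] show ?thesis unfolding h_def[abs_def] by (simp add: m0)
  qed
  then have dnz: "deriv h 0 \<noteq> 0" using \<mu> by (simp add: DERIV_imp_deriv)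
  have in0: "0 \<in> ball (0::complex) \<rho>1" using \<rho>1(1) by simp
  obtain \<rho> where \<rho>: "\<rho> > 0" "ball (0::complex) \<rho> \<subseteq> ball 0 \<rho>1" "open (h ` ball 0 \<rho>)" "inj_on h (ball 0 \<rho>)"
    by (rule has_complex_derivative_locally_invertible[OF holh in0 open_ball dnz]) (rule that)
  have holh': "h holomorphic_on ball 0 \<rho>" using holh \<rho>(2) holomorphic_on_subset by blast
  obtain k where k: "k holomorphic_on h ` ball 0 \<rho>" "\<And>z. z \<in> ball 0 \<rho> \<Longrightarrow> deriv h z * deriv k (h z) = 1"
    "\<And>z. z \<in> ball 0 \<rho> \<Longrightarrow> k (h z) = z"
    using holomorphic_has_inverse[OF holh' open_ball \<rho>(4)] by metis
  have h0: "h 0 = 0" by (simp add: h_def)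
  have k0: "k 0 = 0" using k(3)[of 0] \<rho>(1) h0 by simp
  have \<rho>\<rho>: "\<bar>x\<bar> < \<rho>1" if "\<bar>x\<bar> < \<rho>" for x :: real
    using subsetD[OF \<rho>(2), of "of_real x"] that by simp
  define hr where "hr x = x * poly Q x powr (1 / real n)" for x
  have Qpos: "poly Q x > 0" if "\<bar>x\<bar> < \<rho>" for x
    using Re_pos[of "of_real x"] \<rho>\<rho>[OF that] by (simp add: complex_poly_of_real)
  have h_real: "h (of_real x) = of_real (hr x)" if "\<bar>x\<bar> < \<rho>" for x
    using powr_of_real[of "poly Q x" "1 / real n"] Qpos[OF that]
    by (simp add: h_def m_def hr_def complex_poly_of_real)
  have hr_pow: "hr x ^ n = x ^ n * poly Q x" if "\<bar>x\<bar> < \<rho>" for x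
  proof -
    have "(poly Q x powr (1 / real n)) ^ n = poly Q x"
      using Qpos[OF that] n by (simp add: powr_powr flip: powr_realpow)
    then show ?thesis by (simp add: hr_def power_mult_distrib)
  qed
  have hr_sign: "hr x > 0 \<longleftrightarrow> x > 0" "hr x < 0 \<longleftrightarrow> x < 0" if "\<bar>x\<bar> < \<rho>" for x
    using Qpos[OF that] by (auto simp: hr_def zero_less_mult_iff mult_less_0_iff)
  have hr_cont: "continuous_on {- (\<rho> / 2)..\<rho> / 2} hr"
  proof -
    have "poly Q x \<noteq> 0" if "x \<in> {- (\<rho> / 2)..\<rho> / 2}" for x
    proof -
      have "\<bar>x\<bar> < \<rho>" using that \<rho>(1) by (simp add: abs_less_iff)
      then show ?thesis using Qpos by fastforce
    qed
    then show ?thesis unfolding hr_def[abs_def] by (intro continuous_intros) auto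
  qed
  have k_hr: "k (of_real (hr x)) = of_real x" if "\<bar>x\<bar> < \<rho>" for x
    using k(3)[of "of_real x"] h_real[OF that] that by simp
  \<comment> \<open>By the intermediate value theorem every value of modulus at most
    \<open>\<tau>0\<close> is taken by \<open>hr\<close> between \<open>- \<rho> / 2\<close> and
    \<open>\<rho> / 2\<close>.\<close>
  define \<tau>0 where "\<tau>0 = min (hr (\<rho> / 2)) (- hr (- (\<rho> / 2)))"
  have \<tau>0: "\<tau>0 > 0" using hr_sign[of "\<rho> / 2"] hr_sign[of "- (\<rho> / 2)"] \<rho>(1) by (simp add: \<tau>0_def)
  have surj: "\<exists>x. \<bar>x\<bar> \<le> \<rho> / 2 \<and> hr x = t" if "\<bar>t\<bar> \<le> \<tau>0" for t
  proof -
    have "\<exists>x\<ge>- (\<rho> / 2). x \<le> \<rho> / 2 \<and> hr x = t"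
      by (rule IVT') (use that hr_cont \<rho>(1) in \<open>auto simp: \<tau>0_def\<close>)
    then obtain x where x: "- (\<rho> / 2) \<le> x" "x \<le> \<rho> / 2" "hr x = t" by blast
    then have "\<bar>x\<bar> \<le> \<rho> / 2" by (simp add: abs_le_iff)
    with x(3) show ?thesis by blast
  qed
  have "0 \<in> h ` ball 0 \<rho>" using h0 \<rho>(1) by (intro image_eqI[of _ _ 0]) auto
  then obtain \<eta>0 where \<eta>0: "\<eta>0 > 0" "ball 0 \<eta>0 \<subseteq> h ` ball 0 \<rho>"
    using \<rho>(3) open_contains_ball by blast
  define \<eta> where "\<eta> = min \<eta>0 \<tau>0"
  have \<eta>: "\<eta> > 0" "ball 0 \<eta> \<subseteq> h ` ball 0 \<rho>" using \<eta>0 \<tau>0 by (auto simp: \<eta>_def)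
  have pair: "\<exists>x z. \<bar>x\<bar> < \<rho> \<and> \<bar>z\<bar> < \<rho> \<and> hr x = t \<and> hr z = - t" if "\<bar>t\<bar> < \<eta>" for t
  proof -
    have "\<bar>t\<bar> \<le> \<tau>0" "\<bar>- t\<bar> \<le> \<tau>0" using that by (auto simp: \<eta>_def)
    then obtain x z where "\<bar>x\<bar> \<le> \<rho> / 2" "hr x = t" "\<bar>z\<bar> \<le> \<rho> / 2" "hr z = - t" using surj by metis
    then show ?thesis using \<rho>(1) by (intro exI[of _ x] exI[of _ z]) auto
  qed
  define \<Delta> where "\<Delta> w = complex_poly F (k w) - complex_poly F (k (- w))" for w
  have hol\<Delta>: "\<Delta> holomorphic_on ball 0 \<eta>"
  proof -
    have kh: "k holomorphic_on ball 0 \<eta>" using k(1) \<eta>(2) holomorphic_on_subset by blast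
    have "(k \<circ> uminus) holomorphic_on ball 0 \<eta>"
      by (rule holomorphic_on_compose_gen[OF _ kh]) (auto intro: holomorphic_intros)
    then have "(\<lambda>w. k (- w)) holomorphic_on ball 0 \<eta>" by (simp add: o_def)
    with kh show ?thesis unfolding \<Delta>_def[abs_def] by (intro holomorphic_intros complex_poly_holomorphic)
  qed
  have \<Delta>_pair: "\<Delta> (of_real t) = of_real (poly F x - poly F z)"
    if "\<bar>x\<bar> < \<rho>" "\<bar>z\<bar> < \<rho>" "hr x = t" "hr z = - t" for x z t
    using k_hr[OF that(1)] k_hr[OF that(2)] that(3,4) by (simp add: \<Delta>_def complex_poly_of_real)
  have "\<exists>\<tau>>0. \<tau> \<le> \<eta> \<and> ((\<forall>t. 0 < t \<and> t < \<tau> \<longrightarrow> \<Delta> (of_real t) = 0) \<or>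
    (\<forall>t. 0 < t \<and> t < \<tau> \<longrightarrow> Re (\<Delta> (of_real t)) > 0) \<or> (\<forall>t. 0 < t \<and> t < \<tau> \<longrightarrow> Re (\<Delta> (of_real t)) < 0))"
  proof (cases "\<exists>\<beta>\<in>ball 0 \<eta>. \<Delta> \<beta> \<noteq> 0")
    case False
    then show ?thesis using \<eta>(1) by (intro exI[of _ \<eta>]) auto
  next
    case True
    then obtain \<beta> where \<beta>: "\<beta> \<in> ball 0 \<eta>" "\<Delta> \<beta> \<noteq> 0" by blast
    have \<Delta>0: "\<Delta> 0 = 0" by (simp add: \<Delta>_def)
    have in0: "0 \<in> ball (0::complex) \<eta>" using \<eta>(1) by simp
    obtain s where s: "s > 0" "ball (0::complex) s \<subseteq> ball 0 \<eta>" "\<And>z. z \<in> ball 0 s - {0} \<Longrightarrow> \<Delta> z \<noteq> 0"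
      by (rule isolated_zeros[OF hol\<Delta> open_ball connected_ball in0 \<Delta>0 \<beta>]) (rule that)
    define \<tau> where "\<tau> = min s \<eta>"
    \<comment> \<open>On real arguments \<open>\<Delta>\<close> is real, so not vanishing means a
      nonzero real part.\<close>
    have nz: "Re (\<Delta> (of_real t)) \<noteq> 0" if "0 < t" "t < \<tau>" for t
    proof -
      have "\<bar>t\<bar> < \<eta>" using that by (simp add: \<tau>_def)
      then obtain x z where "\<bar>x\<bar> < \<rho>" "\<bar>z\<bar> < \<rho>" "hr x = t" "hr z = - t" using pair by blast
      from \<Delta>_pair[OF this] have "\<Delta> (of_real t) = of_real (poly F x - poly F z)" .
      moreover have "\<Delta> (of_real t) \<noteq> 0" using that by (intro s(3)) (auto simp: \<tau>_def)
      ultimately show ?thesis by simp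
    qed
    have "continuous_on {0<..<\<tau>} (\<lambda>t. Re (\<Delta> (of_real t)))"
      by (intro continuous_intros continuous_on_compose2[OF holomorphic_on_imp_continuous_on[OF hol\<Delta>]])
        (auto simp: \<tau>_def)
    from nonzero_constant_sign[OF this nz] show ?thesis using s(1) \<eta>(1) by (intro exI[of _ \<tau>]) (auto simp: \<tau>_def)
  qed
  then obtain \<tau> where \<tau>: "\<tau> > 0" "\<tau> \<le> \<eta>" and sign: "(\<forall>t. 0 < t \<and> t < \<tau> \<longrightarrow> \<Delta> (of_real t) = 0) \<or>
    (\<forall>t. 0 < t \<and> t < \<tau> \<longrightarrow> Re (\<Delta> (of_real t)) > 0) \<or> (\<forall>t. 0 < t \<and> t < \<tau> \<longrightarrow> Re (\<Delta> (of_real t)) < 0)"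
    by blast
  have "isCont hr 0"
    unfolding hr_def[abs_def] using Q0 by (intro continuous_intros) auto
  then obtain \<delta>0 where \<delta>0: "\<delta>0 > 0" "\<And>x. \<bar>x\<bar> < \<delta>0 \<Longrightarrow> \<bar>hr x\<bar> < \<tau>"
    using \<tau>(1) unfolding continuous_at_eps_delta by (force simp: dist_real_def hr_def)
  define \<delta> where "\<delta> = min \<delta>0 \<rho>"
  \<comment> \<open>The map \<open>k (- h)\<close> exchanges the two points of a level; its
    derivative at \<open>0\<close> is minus the product of the derivatives of \<open>k\<close> and
    \<open>h\<close>, that is \<open>-1\<close>.\<close>
  define \<sigma> where "\<sigma> x = Re (k (- h (of_real x)))" for x
  show thesis
  proof (rule that[of \<delta> \<sigma>])
    show "\<delta> > 0" using \<delta>0(1) \<rho>(1) by (simp add: \<delta>_def)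
    show "\<sigma> 0 = 0" by (simp add: \<sigma>_def h0 k0)
    show "(\<sigma> has_real_derivative -1) (at 0)"
    proof -
      have "(k has_field_derivative deriv k 0) (at 0)"
        by (rule holomorphic_derivI[OF k(1) \<rho>(3) \<open>0 \<in> h ` ball 0 \<rho>\<close>])
      then have "(k has_field_derivative deriv k 0) (at (- h (of_real 0)))" by (simp add: h0)
      moreover have "((\<lambda>w. - h w) has_field_derivative - of_real \<mu>) (at (of_real 0))"
        using dh by (auto intro!: derivative_eq_intros)
      ultimately have "((\<lambda>w. k (- h w)) has_field_derivative deriv k 0 * (- of_real \<mu>)) (at (of_real 0))"
        by (rule DERIV_chain2)
      moreover have "deriv k 0 * of_real \<mu> = 1"
        using k(2)[of 0] \<rho>(1) h0 DERIV_imp_deriv[OF dh] by (simp add: mult.commute)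
      ultimately have "((\<lambda>w. k (- h w)) has_field_derivative -1) (at (of_real 0))" by simp
      from has_vector_derivative_real_field[OF this]
      have "((\<lambda>x. k (- h (of_real x))) has_vector_derivative -1) (at 0)" .
      from bounded_linear.has_vector_derivative[OF bounded_linear_Re this]
      show ?thesis by (simp add: \<sigma>_def[abs_def] has_real_derivative_iff_has_vector_derivative)
    qed
    show "x * \<sigma> x < 0 \<and> \<sigma> x ^ n * poly Q (\<sigma> x) = x ^ n * poly Q x" if "x \<noteq> 0" "\<bar>x\<bar> < \<delta>" for x
    proof -
      have x: "\<bar>x\<bar> < \<rho>" "\<bar>hr x\<bar> < \<eta>" using that \<delta>0(2)[of x] \<tau>(2) by (auto simp: \<delta>_def)
      obtain z where z: "\<bar>z\<bar> < \<rho>" "hr z = - hr x" using pair[OF x(2)] by blast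
      have "\<sigma> x = z" using k_hr[OF z(1)] by (simp add: \<sigma>_def h_real[OF x(1)] z(2))
      moreover have "x * z < 0"
        using hr_sign[OF x(1)] hr_sign[OF z(1)] z(2) that(1) by (auto simp: mult_less_0_iff)
      moreover have "z ^ n * poly Q z = x ^ n * poly Q x"
        using hr_pow[OF x(1)] hr_pow[OF z(1)] n(1) by (simp add: z(2))
      ultimately show ?thesis by simp
    qed
    have lev: "\<Delta> (of_real (hr x)) = of_real (poly F x - poly F z)" "0 < hr x" "hr x < \<tau>"
      if "0 < x" "x < \<delta>" "- \<delta> < z" "z < 0" "x ^ n * poly Q x = z ^ n * poly Q z" for x z
    proof -
      have xz: "\<bar>x\<bar> < \<rho>" "\<bar>z\<bar> < \<rho>" "\<bar>hr x\<bar> < \<tau>" using that \<delta>0(2)[of x] by (auto simp: \<delta>_def)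
      have s: "hr x > 0" "hr z < 0" using hr_sign[OF xz(1)] hr_sign[OF xz(2)] that by auto
      have "hr x ^ n = (- hr z) ^ n" using that hr_pow[OF xz(1)] hr_pow[OF xz(2)] n(1) by simp
      then have "hr x = - hr z"
        by (rule power_eq_imp_eq_base) (use s n(2) in auto)
      then have "hr z = - hr x" by linarith
      then show "\<Delta> (of_real (hr x)) = of_real (poly F x - poly F z)" by (rule \<Delta>_pair[OF xz(1,2) refl])
      show "0 < hr x" "hr x < \<tau>" using s xz by auto
    qed
    show "(\<forall>x z. 0 < x \<and> x < \<delta> \<and> - \<delta> < z \<and> z < 0 \<and> x ^ n * poly Q x = z ^ n * poly Q z \<longrightarrow> poly F x = poly F z) \<or>
     (\<forall>x z. 0 < x \<and> x < \<delta> \<and> - \<delta> < z \<and> z < 0 \<and> x ^ n * poly Q x = z ^ n * poly Q z \<longrightarrow> poly F x > poly F z) \<or>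
     (\<forall>x z. 0 < x \<and> x < \<delta> \<and> - \<delta> < z \<and> z < 0 \<and> x ^ n * poly Q x = z ^ n * poly Q z \<longrightarrow> poly F x < poly F z)"
      using sign
    proof (elim disjE)
      assume *: "\<forall>t. 0 < t \<and> t < \<tau> \<longrightarrow> \<Delta> (of_real t) = 0"
      have "poly F x = poly F z" if "0 < x" "x < \<delta>" "- \<delta> < z" "z < 0" "x ^ n * poly Q x = z ^ n * poly Q z" for x z
        using lev[OF that] * by (metis eq_iff_diff_eq_0 of_real_eq_0_iff)
      then show ?thesis by blast
    next
      assume *: "\<forall>t. 0 < t \<and> t < \<tau> \<longrightarrow> Re (\<Delta> (of_real t)) > 0"
      have "poly F x > poly F z" if "0 < x" "x < \<delta>" "- \<delta> < z" "z < 0" "x ^ n * poly Q x = z ^ n * poly Q z" for x z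
        using lev[OF that] *[rule_format, of "hr x"] by simp
      then show ?thesis by blast
    next
      assume *: "\<forall>t. 0 < t \<and> t < \<tau> \<longrightarrow> Re (\<Delta> (of_real t)) < 0"
      have "poly F x < poly F z" if "0 < x" "x < \<delta>" "- \<delta> < z" "z < 0" "x ^ n * poly Q x = z ^ n * poly Q z" for x z
        using lev[OF that] *[rule_format, of "hr x"] by simp
      then show ?thesis by blast
    qed
  qed
qed

section \<open>Half-turns around the origin\<close>

context lienard
begin

text \<open>The added sign says that orbits cross the \<open>y\<close>-axis leftwards above the
  origin and rightwards below it.\<close>

definition section_radius :: "real \<Rightarrow> bool" where
  "section_radius \<rho> \<longleftrightarrow> good_radius \<rho> \<and> (\<forall>y. y \<noteq> 0 \<longrightarrow> \<bar>y\<bar> \<le> \<rho> \<longrightarrow> y * poly \<phi> y < 0)"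

definition right_path :: "real \<Rightarrow> real \<times> real \<Rightarrow> real \<times> real \<Rightarrow> (real \<Rightarrow> real \<times> real) \<Rightarrow> real \<Rightarrow> bool" where
  "right_path \<rho> v w \<gamma> T \<longleftrightarrow> T > 0 \<and> integral_curve X {0..T} \<gamma> \<and> \<gamma> 0 = v \<and> \<gamma> T = w \<and>
    (\<forall>t. 0 < t \<and> t < T \<longrightarrow> fst (\<gamma> t) > 0) \<and> (\<forall>t\<in>{0..T}. \<gamma> t \<in> square_box \<rho>)"

definition left_path :: "real \<Rightarrow> real \<times> real \<Rightarrow> real \<times> real \<Rightarrow> (real \<Rightarrow> real \<times> real) \<Rightarrow> real \<Rightarrow> bool" where
  "left_path \<rho> v w \<gamma> T \<longleftrightarrow> T > 0 \<and> integral_curve X {0..T} \<gamma> \<and> \<gamma> 0 = v \<and> \<gamma> T = w \<and>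
    (\<forall>t. 0 < t \<and> t < T \<longrightarrow> fst (\<gamma> t) < 0) \<and> (\<forall>t\<in>{0..T}. \<gamma> t \<in> square_box \<rho>)"

lemma section_radius_ex:
  assumes "monodromy_condition"
  obtains \<rho>0 where "\<And>\<rho>. 0 < \<rho> \<Longrightarrow> \<rho> \<le> \<rho>0 \<Longrightarrow> section_radius \<rho>" "\<rho>0 > 0"
proof -
  have M: "a = -1" "odd p" using assms by (auto simp: monodromy_condition_def)
  obtain \<rho>1 where \<rho>1: "\<And>\<rho>. 0 < \<rho> \<Longrightarrow> \<rho> \<le> \<rho>1 \<Longrightarrow> good_radius \<rho>" "\<rho>1 > 0" using good_radius_ex by blast
  obtain \<rho>2 where \<rho>2: "\<rho>2 > 0" "\<And>x. \<bar>x\<bar> \<le> \<rho>2 \<Longrightarrow> x \<noteq> 0 \<Longrightarrow> poly \<phi> x * (a * x ^ p) > 0"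
    using lowest_term_sign[OF \<phi>] by blast
  show thesis
  proof (rule that[of "min \<rho>1 \<rho>2"])
    fix \<rho> :: real assume \<rho>: "0 < \<rho>" "\<rho> \<le> min \<rho>1 \<rho>2"
    have "y * poly \<phi> y < 0" if "y \<noteq> 0" "\<bar>y\<bar> \<le> \<rho>" for y
    proof -
      have "poly \<phi> y * y ^ p < 0" using \<rho>2(2)[of y] that \<rho> M by simp
      then show ?thesis using that(1) M(2)
        by (cases "y > 0") (auto simp: mult_less_0_iff zero_less_power_eq power_less_zero_eq not_less)
    qed
    then show "section_radius \<rho>" using \<rho>1(1) \<rho> by (simp add: section_radius_def)
  qed (use \<rho>1 \<rho>2 in auto)
qed

text \<open>Contraposition of shooting: orbits that start arbitrarily close to the origin and fail
  to reach the positive \<open>y\<close>-axis in the box cannot enter \<open>x < 0\<close> there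
  either, and would produce a characteristic orbit. The admissible starting points form one half of
  the punctured plane, exchanged with the other half by \<open>v -> - v\<close>.\<close>

lemma right_path_forward:
  assumes nochar: "\<not> has_characteristic_orbit X" and sec: "section_radius \<rho>"
  obtains \<epsilon> where "\<epsilon> > 0" "\<And>v. norm v < \<epsilon> \<Longrightarrow> fst v > 0 \<or> (fst v = 0 \<and> snd v < 0) \<Longrightarrow>
    \<exists>\<gamma> T y. y > 0 \<and> right_path \<rho> v (0, y) \<gamma> T"
proof -
  have good: "good_radius \<rho>" using sec by (simp add: section_radius_def)
  let ?H = "\<lambda>v. fst v > 0 \<or> (fst v = 0 \<and> snd v < 0)"
  let ?Q = "\<lambda>v. \<exists>\<gamma> T y. y > 0 \<and> right_path \<rho> v (0, y) \<gamma> T"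
  have "\<exists>\<epsilon>>0. \<forall>v. norm v < \<epsilon> \<longrightarrow> ?H v \<longrightarrow> ?Q v"
  proof (rule ccontr)
    assume neg: "\<not> ?thesis"
    have "\<exists>v. norm v < 1 / (real n + 2) \<and> ?H v \<and> \<not> ?Q v" for n
    proof -
      have "1 / (real n + 2) > 0" by (simp add: add_nonneg_pos)
      then show ?thesis using neg by blast
    qed
    then have "\<forall>n. \<exists>v. norm v < 1 / (real n + 2) \<and> ?H v \<and> \<not> ?Q v" ..
    from choice[OF this] obtain P where P: "\<And>n. norm (P n) < 1 / (real n + 2)" "\<And>n. ?H (P n)" "\<And>n. \<not> ?Q (P n)"
      by blast
    have "P \<longlonglongrightarrow> 0"
      by (rule Lim_null_comparison[OF _ inverse_sequence[of 1]])
        (auto intro!: always_eventually less_imp_le P(1))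
    then have lim: "P \<longlonglongrightarrow> (0, 0)" by (simp add: zero_prod_def)
    have "has_characteristic_orbit X"
    proof (rule shooting[OF good lim, of "{v. fst v \<ge> 0}"])
      show Pnz: "P n \<noteq> (0, 0)" for n using P(2)[of n] by auto
      show "closed {v :: real \<times> real. 0 \<le> fst v}" by (intro closed_Collect_le continuous_intros)
      show "fst v \<ge> 0" if "v \<in> {v :: real \<times> real. fst v \<ge> 0}" for v using that by simp
      fix n T \<gamma> assume T: "0 \<le> T" and \<gamma>: "integral_curve X {0..T} \<gamma>" and \<gamma>0: "\<gamma> 0 = P n"
        and box: "\<And>t. t \<in> {0..T} \<Longrightarrow> \<gamma> t \<in> square_box \<rho>"
      define x where "x t = fst (\<gamma> t)" for t
      have contx: "continuous_on {s..t} x" if "0 \<le> s" "t \<le> T" for s t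
        using integral_curve_continuous[OF integral_curve_subset[OF \<gamma>, of "{s..t}"]] that
        by (auto intro: continuous_intros simp: x_def[abs_def])
      \<comment> \<open>An orbit entering \<open>x < 0\<close> first returns to the axis at some
        \<open>T1\<close>, where \<open>x\<close> is not increasing, hence at positive height; this
        is a right path, which \<open>P n\<close> does not have.\<close>
      have "\<not> x T < 0"
      proof
        assume xT: "x T < 0"
        \<comment> \<open>A start on the negative \<open>y\<close>-axis has \<open>x = 0\<close> at
          time \<open>0\<close>; the positive derivative gives an initial interval with
          \<open>x > 0\<close>, after which a first return makes sense.\<close>
        have "\<exists>s0. 0 \<le> s0 \<and> s0 < T \<and> x s0 > 0 \<and> (\<forall>t. 0 < t \<and> t \<le> s0 \<longrightarrow> x t > 0)"
        proof (cases "x 0 > 0")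
          case True
          then show ?thesis using xT T by (intro exI[of _ 0]) (cases "T = 0", auto)
        next
          case False
          then have v: "fst (P n) = 0" "snd (P n) < 0" using P(2)[of n] \<gamma>0 by (auto simp: x_def)
          have T0: "T > 0" using xT T v \<gamma>0 by (cases "T = 0") (auto simp: x_def)
          have "snd (P n) * poly \<phi> (snd (P n)) < 0"
            using sec box[of 0] T v \<gamma>0 by (auto simp: section_radius_def square_box_def)
          then have "poly \<phi> (snd (\<gamma> 0)) - poly F (fst (\<gamma> 0)) > 0"
            using v \<gamma>0 lowest_term_zero[OF F] by (simp add: mult_less_0_iff)
          from has_real_derivative_pos_inc_right[OF segment_components(1)[OF \<gamma>, of 0] this] T
          obtain e where e: "e > 0" "\<And>h. h > 0 \<Longrightarrow> 0 + h \<in> {0..T} \<Longrightarrow> h < e \<Longrightarrow> x 0 < x (0 + h)"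
            unfolding x_def by blast
          define s0 where "s0 = min (e / 2) (T / 2)"
          have s0: "0 < s0" "s0 < e" "s0 < T" using e(1) T0 by (auto simp: s0_def min_def)
          have x00: "x 0 = 0" using v \<gamma>0 by (simp add: x_def)
          have "x t > 0" if "0 < t" "t \<le> s0" for t using e(2)[of t] that s0 x00 by auto
          then show ?thesis using s0 by (intro exI[of _ s0]) auto
        qed
        then obtain s0 where s0: "0 \<le> s0" "s0 < T" "x s0 > 0" "\<And>t. 0 < t \<Longrightarrow> t \<le> s0 \<Longrightarrow> x t > 0" by blast
        obtain T1 where T1: "s0 < T1" "T1 \<le> T" "- x T1 = 0" "\<And>s. s0 \<le> s \<Longrightarrow> s < T1 \<Longrightarrow> - x s < 0"
          by (rule first_hit[of s0 T "\<lambda>t. - x t" 0])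
            (use s0 xT contx[of s0 T] in \<open>auto intro: continuous_intros\<close>)
        have pos: "x t > 0" if "0 < t" "t < T1" for t
          using s0(4)[of t] T1(4)[of t] that by (cases "t \<le> s0") auto
        have \<gamma>1: "integral_curve X {0..T1} \<gamma>" by (rule integral_curve_subset[OF \<gamma>]) (use T1 in auto)
        have "\<not> poly \<phi> (snd (\<gamma> T1)) - poly F (fst (\<gamma> T1)) > 0"
        proof
          assume "poly \<phi> (snd (\<gamma> T1)) - poly F (fst (\<gamma> T1)) > 0"
          moreover have "0 \<le> T1" using s0 T1 by simp
          ultimately obtain e where e: "e > 0" "\<And>h. h > 0 \<Longrightarrow> T1 - h \<in> {0..T1} \<Longrightarrow> h < e \<Longrightarrow> x (T1 - h) < x T1"
            using has_real_derivative_pos_inc_left[OF segment_components(1)[OF \<gamma>1 _ order_refl]]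
            unfolding x_def by blast
          define h where "h = min (e / 2) (T1 / 2)"
          have "0 < h" "h < e" "h < T1" using e(1) s0 T1 by (auto simp: h_def min_def)
          then show False using e(2)[of h] pos[of "T1 - h"] T1(3) by auto
        qed
        then have "\<not> poly \<phi> (snd (\<gamma> T1)) > 0" using T1(3) lowest_term_zero[OF F] by (simp add: x_def)
        moreover have nz: "snd (\<gamma> T1) \<noteq> 0"
        proof
          assume "snd (\<gamma> T1) = 0"
          then have "\<gamma> T1 = (0, 0)" using T1(3) by (simp add: prod_eq_iff x_def)
          moreover have "\<gamma> T1 \<noteq> (0, 0)"
            by (rule curve_nonzero[OF \<gamma>1, of 0]) (use Pnz \<gamma>0 s0 T1 in auto)
          ultimately show False by simp
        qed
        moreover have "snd (\<gamma> T1) * poly \<phi> (snd (\<gamma> T1)) < 0"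
          using sec nz box[of T1] s0 T1 by (auto simp: section_radius_def square_box_def)
        ultimately have ypos: "snd (\<gamma> T1) > 0" by (auto simp: mult_less_0_iff)
        have "\<gamma> T1 = (0, snd (\<gamma> T1))" using T1(3) by (simp add: prod_eq_iff x_def)
        then have "right_path \<rho> (P n) (0, snd (\<gamma> T1)) \<gamma> T1"
          unfolding right_path_def using s0 T1 \<gamma>1 \<gamma>0 pos box by (auto simp: x_def)
        with P(3)[of n] ypos show False by blast
      qed
      then show "\<gamma> T \<in> {v. 0 \<le> fst v}" by (simp add: x_def)
    qed
    with nochar show False ..
  qed
  then obtain \<epsilon> where "\<epsilon> > 0" "\<And>v. norm v < \<epsilon> \<Longrightarrow> ?H v \<Longrightarrow> ?Q v" by blast
  then show thesis by (rule that)
qed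

end

lemma axis_reflection_square_box:
  "s1 = 1 \<or> s1 = -1 \<Longrightarrow> s2 = 1 \<or> s2 = -1 \<Longrightarrow> axis_reflection s1 s2 v \<in> square_box \<rho> \<longleftrightarrow> v \<in> square_box \<rho>"
  by (auto simp: axis_reflection_def square_box_def)

context lienard
begin

lemma left_path_reflected:
  assumes "left_path \<rho> v w \<gamma> T"
  shows "lienard.right_path (- reflect_poly_arg \<phi>) (- reflect_poly_arg F) (- reflect_poly_arg g) \<rho>
    (axis_reflection (-1) (-1) v) (axis_reflection (-1) (-1) w) (\<lambda>t. axis_reflection (-1) (-1) (\<gamma> t)) T"
proof -
  interpret ref: lienard "- reflect_poly_arg \<phi>" "- reflect_poly_arg F" "- reflect_poly_arg g" p q r
    "- ((-1) ^ p * a)" "- ((-1) ^ q * b)" "- ((-1) ^ r * c)"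
    by (rule point_reflection_lienard)
  have "integral_curve X {0..T} \<gamma>" using assms by (simp add: left_path_def)
  from integral_curve_axis_reflection[OF this, of "-1" "-1"] show ?thesis
    using assms unfolding ref.right_path_def left_path_def
    by (simp add: lienard_field_point_reflection axis_reflection_square_box) (simp add: axis_reflection_def)
qed

lemma right_path_reflected:
  assumes "lienard.right_path (- reflect_poly_arg \<phi>) (- reflect_poly_arg F) (- reflect_poly_arg g) \<rho> v w \<gamma> T"
  shows "left_path \<rho> (axis_reflection (-1) (-1) v) (axis_reflection (-1) (-1) w) (\<lambda>t. axis_reflection (-1) (-1) (\<gamma> t)) T"
proof -
  interpret ref: lienard "- reflect_poly_arg \<phi>" "- reflect_poly_arg F" "- reflect_poly_arg g" p q r
    "- ((-1) ^ p * a)" "- ((-1) ^ q * b)" "- ((-1) ^ r * c)"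
    by (rule point_reflection_lienard)
  have "integral_curve ref.X {0..T} \<gamma>" using assms by (simp add: ref.right_path_def)
  from integral_curve_axis_reflection[OF this, of "-1" "-1"] show ?thesis
    using assms unfolding ref.right_path_def left_path_def
    by (simp add: lienard_field_point_reflection axis_reflection_square_box pcompose_reflect_minus pcompose_reflect_twice)
      (simp add: axis_reflection_def)
qed

lemma right_path_time_reflected:
  assumes "lienard.right_path (- reflect_poly_arg \<phi>) (- F) g \<rho> v w \<gamma> T"
  shows "right_path \<rho> (axis_reflection 1 (-1) w) (axis_reflection 1 (-1) v) (\<lambda>t. axis_reflection 1 (-1) (\<gamma> (T - t))) T"
proof -
  interpret ref: lienard "- reflect_poly_arg \<phi>" "- F" g p q r "- ((-1) ^ p * a)" "- b" c
    by (rule time_reflection_lienard)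
  have "integral_curve ref.X {0..T} \<gamma>" using assms by (simp add: ref.right_path_def)
  from integral_curve_axis_reflection[OF integral_curve_flip[OF this], of 1 "-1"] show ?thesis
    using assms unfolding ref.right_path_def right_path_def
    by (simp add: lienard_field_time_reflection axis_reflection_square_box pcompose_reflect_minus pcompose_reflect_twice)
      (simp add: axis_reflection_def)
qed

text \<open>All three kinds of half-turn come from \<open>right_path_forward\<close>: applied
  directly, to the time-reflected field for the right half-turn that ends at a given height, and to
  the point-reflected field for the left one.\<close>

lemma paths_ex:
  assumes M: "monodromy_condition"
  obtains \<rho>0 where "\<rho>0 > 0" "\<And>\<rho>. 0 < \<rho> \<Longrightarrow> \<rho> \<le> \<rho>0 \<Longrightarrow> section_radius \<rho> \<and> (\<exists>\<epsilon>>0.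
     (\<forall>v. norm v < \<epsilon> \<longrightarrow> fst v > 0 \<or> (fst v = 0 \<and> snd v < 0) \<longrightarrow> (\<exists>\<gamma> T y. y > 0 \<and> right_path \<rho> v (0, y) \<gamma> T)) \<and>
     (\<forall>y. 0 < y \<and> y < \<epsilon> \<longrightarrow> (\<exists>\<gamma> T y'. y' < 0 \<and> right_path \<rho> (0, y') (0, y) \<gamma> T)) \<and>
     (\<forall>y. 0 < y \<and> y < \<epsilon> \<longrightarrow> (\<exists>\<gamma> T y'. y' < 0 \<and> left_path \<rho> (0, y) (0, y') \<gamma> T)))"
proof -
  interpret pr: lienard "- reflect_poly_arg \<phi>" "- reflect_poly_arg F" "- reflect_poly_arg g" p q r
    "- ((-1) ^ p * a)" "- ((-1) ^ q * b)" "- ((-1) ^ r * c)"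
    by (rule point_reflection_lienard)
  interpret tr: lienard "- reflect_poly_arg \<phi>" "- F" g p q r "- ((-1) ^ p * a)" "- b" c
    by (rule time_reflection_lienard)
  have Mp: "pr.monodromy_condition" by (rule monodromy_point_reflection[OF M])
  have Mt: "tr.monodromy_condition" by (rule monodromy_time_reflection[OF M])
  obtain \<rho>1 where \<rho>1: "\<And>\<rho>. 0 < \<rho> \<Longrightarrow> \<rho> \<le> \<rho>1 \<Longrightarrow> section_radius \<rho>" "\<rho>1 > 0"
    by (rule section_radius_ex[OF M]) (rule that)
  obtain \<rho>2 where \<rho>2: "\<And>\<rho>. 0 < \<rho> \<Longrightarrow> \<rho> \<le> \<rho>2 \<Longrightarrow> pr.section_radius \<rho>" "\<rho>2 > 0"
    by (rule pr.section_radius_ex[OF Mp]) (rule that)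
  obtain \<rho>3 where \<rho>3: "\<And>\<rho>. 0 < \<rho> \<Longrightarrow> \<rho> \<le> \<rho>3 \<Longrightarrow> tr.section_radius \<rho>" "\<rho>3 > 0"
    by (rule tr.section_radius_ex[OF Mt]) (rule that)
  show thesis
  proof (rule that[of "min \<rho>1 (min \<rho>2 \<rho>3)"])
    show "0 < min \<rho>1 (min \<rho>2 \<rho>3)" using \<rho>1 \<rho>2 \<rho>3 by simp
    fix \<rho> :: real assume \<rho>: "0 < \<rho>" "\<rho> \<le> min \<rho>1 (min \<rho>2 \<rho>3)"
    have s1: "section_radius \<rho>" using \<rho>1(1) \<rho> by simp
    have s2: "pr.section_radius \<rho>" using \<rho>2(1) \<rho> by simp
    have s3: "tr.section_radius \<rho>" using \<rho>3(1) \<rho> by simp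
    obtain \<epsilon>1 where e1: "\<epsilon>1 > 0" "\<And>v. norm v < \<epsilon>1 \<Longrightarrow> fst v > 0 \<or> (fst v = 0 \<and> snd v < 0) \<Longrightarrow>
      \<exists>\<gamma> T y. y > 0 \<and> right_path \<rho> v (0, y) \<gamma> T"
      by (rule right_path_forward[OF no_characteristic_orbit[OF M] s1]) (rule that)
    obtain \<epsilon>2 where e2: "\<epsilon>2 > 0" "\<And>v. norm v < \<epsilon>2 \<Longrightarrow> fst v > 0 \<or> (fst v = 0 \<and> snd v < 0) \<Longrightarrow>
      \<exists>\<gamma> T y. y > 0 \<and> pr.right_path \<rho> v (0, y) \<gamma> T"
      by (rule pr.right_path_forward[OF pr.no_characteristic_orbit[OF Mp] s2]) (rule that)
    obtain \<epsilon>3 where e3: "\<epsilon>3 > 0" "\<And>v. norm v < \<epsilon>3 \<Longrightarrow> fst v > 0 \<or> (fst v = 0 \<and> snd v < 0) \<Longrightarrow>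
      \<exists>\<gamma> T y. y > 0 \<and> tr.right_path \<rho> v (0, y) \<gamma> T"
      by (rule tr.right_path_forward[OF tr.no_characteristic_orbit[OF Mt] s3]) (rule that)
    have R: "\<exists>\<gamma> T y'. y' < 0 \<and> right_path \<rho> (0, y') (0, y) \<gamma> T" if y: "0 < y" "y < \<epsilon>3" for y
    proof -
      obtain \<gamma> T y' where *: "y' > 0" "tr.right_path \<rho> (0, - y) (0, y') \<gamma> T"
        using e3(2)[of "(0, - y)"] y by auto
      have "right_path \<rho> (0, - y') (0, y) (\<lambda>t. axis_reflection 1 (-1) (\<gamma> (T - t))) T"
        using right_path_time_reflected[OF *(2)] by (simp add: axis_reflection_def)
      then show ?thesis using *(1) by (meson neg_less_0_iff_less)
    qed
    have L: "\<exists>\<gamma> T y'. y' < 0 \<and> left_path \<rho> (0, y) (0, y') \<gamma> T" if y: "0 < y" "y < \<epsilon>2" for y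
    proof -
      obtain \<gamma> T y' where *: "y' > 0" "pr.right_path \<rho> (0, - y) (0, y') \<gamma> T"
        using e2(2)[of "(0, - y)"] y by auto
      have "left_path \<rho> (0, y) (0, - y') (\<lambda>t. axis_reflection (-1) (-1) (\<gamma> t)) T"
        using right_path_reflected[OF *(2)] by (simp add: axis_reflection_def)
      then show ?thesis using *(1) by (meson neg_less_0_iff_less)
    qed
    show "section_radius \<rho> \<and> (\<exists>\<epsilon>>0.
     (\<forall>v. norm v < \<epsilon> \<longrightarrow> fst v > 0 \<or> (fst v = 0 \<and> snd v < 0) \<longrightarrow> (\<exists>\<gamma> T y. y > 0 \<and> right_path \<rho> v (0, y) \<gamma> T)) \<and>
     (\<forall>y. 0 < y \<and> y < \<epsilon> \<longrightarrow> (\<exists>\<gamma> T y'. y' < 0 \<and> right_path \<rho> (0, y') (0, y) \<gamma> T)) \<and>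
     (\<forall>y. 0 < y \<and> y < \<epsilon> \<longrightarrow> (\<exists>\<gamma> T y'. y' < 0 \<and> left_path \<rho> (0, y) (0, y') \<gamma> T)))"
    proof (intro conjI exI[of _ "min \<epsilon>1 (min \<epsilon>2 \<epsilon>3)"] allI impI)
      fix v :: "real \<times> real" assume "norm v < min \<epsilon>1 (min \<epsilon>2 \<epsilon>3)" "fst v > 0 \<or> (fst v = 0 \<and> snd v < 0)"
      then show "\<exists>\<gamma> T y. y > 0 \<and> right_path \<rho> v (0, y) \<gamma> T" by (intro e1(2)) auto
    next
      fix y assume "0 < y \<and> y < min \<epsilon>1 (min \<epsilon>2 \<epsilon>3)"
      then show "\<exists>\<gamma> T y'. y' < 0 \<and> right_path \<rho> (0, y') (0, y) \<gamma> T" by (intro R) auto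
    next
      fix y assume "0 < y \<and> y < min \<epsilon>1 (min \<epsilon>2 \<epsilon>3)"
      then show "\<exists>\<gamma> T y'. y' < 0 \<and> left_path \<rho> (0, y) (0, y') \<gamma> T" by (intro L) auto
    qed (use e1 e2 e3 s1 in auto)
  qed
qed

text \<open>Along a right path \<open>y\<close> is strictly increasing, so the path is a graph over the \<open>y\<close>-axis.\<close>

lemma right_path_graph:
  assumes c: "c < 0" and good: "good_radius \<rho>" and path: "right_path \<rho> (0, \<alpha>) (0, \<beta>) \<gamma> T"
  obtains x where "\<alpha> < \<beta>" "continuous_on {\<alpha>..\<beta>} x" "x \<alpha> = 0" "x \<beta> = 0"
    "\<And>y. \<alpha> < y \<Longrightarrow> y < \<beta> \<Longrightarrow> 0 < x y \<and> x y \<le> \<rho>"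
    "\<And>y. \<alpha> < y \<Longrightarrow> y < \<beta> \<Longrightarrow> DERIV x y :> (poly \<phi> y - poly F (x y)) / (- poly g (x y))"
proof -
  have T: "T > 0" and \<gamma>: "integral_curve X {0..T} \<gamma>" and ends: "\<gamma> 0 = (0, \<alpha>)" "\<gamma> T = (0, \<beta>)"
    and pos: "\<And>t. 0 < t \<Longrightarrow> t < T \<Longrightarrow> fst (\<gamma> t) > 0" and box: "\<And>t. t \<in> {0..T} \<Longrightarrow> \<gamma> t \<in> square_box \<rho>"
    using path by (auto simp: right_path_def)
  define h where "h t = snd (\<gamma> t)" for t
  have cont\<gamma>: "continuous_on {0..T} \<gamma>" by (rule integral_curve_continuous[OF \<gamma>])
  then have conth: "continuous_on {0..T} h" unfolding h_def[abs_def] by (intro continuous_intros)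
  have gneg: "- poly g (fst (\<gamma> t)) > 0" if "0 < t" "t < T" for t
    using good c pos[OF that] box[of t] that by (auto simp: good_radius_def square_box_def zero_less_mult_iff)
  have dh: "DERIV h t :> - poly g (fst (\<gamma> t))" if "0 < t" "t < T" for t
    unfolding h_def[abs_def] using integral_curve_components_at(2)[OF \<gamma>, of t] that by simp
  have dx: "DERIV (\<lambda>t. fst (\<gamma> t)) t :> poly \<phi> (h t) - poly F (fst (\<gamma> t))" if "0 < t" "t < T" for t
    unfolding h_def[abs_def] using integral_curve_components_at(1)[OF \<gamma>, of t] that by simp
  have mono: "h s < h t" if "0 \<le> s" "s < t" "t \<le> T" for s t
  proof (rule DERIV_pos_imp_increasing_open[OF that(2)])
    show "continuous_on {s..t} h" by (rule continuous_on_subset[OF conth]) (use that in auto)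
    fix u assume "s < u" "u < t"
    then have "0 < u" "u < T" using that by auto
    then show "\<exists>z. DERIV h u :> z \<and> 0 < z" using dh gneg by blast
  qed
  have hinj: "inj_on h {0..T}"
  proof (rule linorder_inj_onI)
    fix s t assume "s < t" "s \<in> {0..T}" "t \<in> {0..T}"
    then have "h s < h t" by (intro mono) auto
    then show "h s \<noteq> h t" by simp
  qed auto
  have h0T: "h 0 = \<alpha>" "h T = \<beta>" using ends by (simp_all add: h_def)
  have \<alpha>\<beta>: "\<alpha> < \<beta>" using mono[of 0 T] T h0T by simp
  have img: "h ` {0..T} = {\<alpha>..\<beta>}"
  proof
    show "h ` {0..T} \<subseteq> {\<alpha>..\<beta>}"
    proof
      fix y assume "y \<in> h ` {0..T}"
      then obtain t where t: "t \<in> {0..T}" "y = h t" by blast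
      have "h 0 \<le> h t" using mono[of 0 t] t by (cases "t = 0") auto
      moreover have "h t \<le> h T" using mono[of t T] t by (cases "t = T") auto
      ultimately show "y \<in> {\<alpha>..\<beta>}" using t h0T by simp
    qed
    show "{\<alpha>..\<beta>} \<subseteq> h ` {0..T}"
    proof
      fix y assume "y \<in> {\<alpha>..\<beta>}"
      then have "\<exists>t\<ge>0. t \<le> T \<and> h t = y" using T h0T conth by (intro IVT') auto
      then show "y \<in> h ` {0..T}" by auto
    qed
  qed
  define \<tau> where "\<tau> = inv_into {0..T} h"
  have \<tau>h: "\<tau> (h t) = t" if "t \<in> {0..T}" for t unfolding \<tau>_def using hinj that by simp
  have h\<tau>: "h (\<tau> y) = y" "\<tau> y \<in> {0..T}" if "y \<in> {\<alpha>..\<beta>}" for y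
    using that unfolding img[symmetric] \<tau>_def by (rule f_inv_into_f, rule inv_into_into)
  have cont\<tau>: "continuous_on {\<alpha>..\<beta>} \<tau>"
    using continuous_on_inv[OF conth compact_Icc, of \<tau>] \<tau>h unfolding img by blast
  have \<tau>in: "0 < \<tau> y" "\<tau> y < T" if "\<alpha> < y" "y < \<beta>" for y
  proof -
    have y: "y \<in> {\<alpha>..\<beta>}" using that by simp
    have "\<tau> y \<noteq> 0" "\<tau> y \<noteq> T" using h\<tau>(1)[OF y] h0T that by auto
    then show "0 < \<tau> y" "\<tau> y < T" using h\<tau>(2)[OF y] by auto
  qed
  show thesis
  proof (rule that[of "\<lambda>y. fst (\<gamma> (\<tau> y))", OF \<alpha>\<beta>])
    show "continuous_on {\<alpha>..\<beta>} (\<lambda>y. fst (\<gamma> (\<tau> y)))"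
      by (intro continuous_intros continuous_on_compose2[OF cont\<gamma> cont\<tau>]) (use h\<tau>(2) in blast)
    show "fst (\<gamma> (\<tau> \<alpha>)) = 0" using \<tau>h[of 0] T h0T ends by simp
    show "fst (\<gamma> (\<tau> \<beta>)) = 0" using \<tau>h[of T] T h0T ends by simp
    fix y assume y: "\<alpha> < y" "y < \<beta>"
    show "0 < fst (\<gamma> (\<tau> y)) \<and> fst (\<gamma> (\<tau> y)) \<le> \<rho>"
      using pos[OF \<tau>in[OF y]] box[of "\<tau> y"] \<tau>in[OF y] by (auto simp: square_box_def)
    have yi: "y \<in> {\<alpha>..\<beta>}" using y by simp
    have "isCont \<tau> y" by (rule continuous_on_interior[OF cont\<tau>]) (use y in simp)
    have "DERIV \<tau> y :> inverse (- poly g (fst (\<gamma> (\<tau> y))))"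
    proof (rule DERIV_inverse_function[where f = h and g = \<tau> and a = \<alpha> and b = \<beta>])
      show "DERIV h (\<tau> y) :> - poly g (fst (\<gamma> (\<tau> y)))" by (rule dh[OF \<tau>in[OF y]])
      show "- poly g (fst (\<gamma> (\<tau> y))) \<noteq> 0" using gneg[OF \<tau>in[OF y]] by simp
      show "h (\<tau> z) = z" if "\<alpha> < z" "z < \<beta>" for z using h\<tau>(1) that by simp
    qed fact+
    from DERIV_chain2[OF dx[OF \<tau>in[OF y]] this]
    show "DERIV (\<lambda>y. fst (\<gamma> (\<tau> y))) y :> (poly \<phi> y - poly F (fst (\<gamma> (\<tau> y)))) / (- poly g (fst (\<gamma> (\<tau> y))))"
      by (simp add: h\<tau>(1)[OF yi] divide_inverse)
  qed
qed

end

section \<open>Comparison of half-turns\<close>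

text \<open>The product \<open>- D * exp M\<close> does not decrease. \<open>M\<close> has to be
  continuous at the ends, but its derivative may blow up there, which is what a singular coefficient
  requires.\<close>

lemma exp_comparison:
  fixes D M :: "real \<Rightarrow> real"
  assumes se: "s < e" and contD: "continuous_on {s..e} D" and contM: "continuous_on {s..e} M"
    and dD: "\<And>t. s < t \<Longrightarrow> t < e \<Longrightarrow> DERIV D t :> D' t"
    and dM: "\<And>t. s < t \<Longrightarrow> t < e \<Longrightarrow> DERIV M t :> M' t"
    and le: "\<And>t. s < t \<Longrightarrow> t < e \<Longrightarrow> D' t \<le> M' t * (- D t)" and Ds: "D s < 0"
  shows "D e < 0"
proof -
  have "- D s * exp (M s) \<le> - D e * exp (M e)"
  proof (rule deriv_nonneg_imp_mono_open[of s e "\<lambda>t. - D t * exp (M t)"])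
    show "continuous_on {s..e} (\<lambda>t. - D t * exp (M t))" by (intro continuous_intros contD contM)
    fix t assume t: "s < t" "t < e"
    have "DERIV (\<lambda>t. - D t * exp (M t)) t :> - D' t * exp (M t) + (exp (M t) * M' t) * (- D t)"
      by (intro DERIV_mult DERIV_minus dD[OF t] DERIV_chain2[OF DERIV_exp dM[OF t]])
    moreover have "- D' t * exp (M t) + (exp (M t) * M' t) * (- D t) = exp (M t) * (M' t * (- D t) - D' t)"
      by (simp add: algebra_simps)
    moreover have "\<dots> \<ge> 0" using le[OF t] by simp
    ultimately show "\<exists>y. DERIV (\<lambda>t. - D t * exp (M t)) t :> y \<and> 0 \<le> y" by metis
  qed (use se in simp)
  moreover have "- D s * exp (M s) > 0" using Ds by (simp add: mult_neg_pos)
  ultimately have "- D e * exp (M e) > 0" by linarith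
  then show ?thesis by (simp add: zero_less_mult_iff mult_less_0_iff)
qed

context lienard
begin

text \<open>\<open>\<Gamma>\<close> stands for \<open>- G\<close> up to a constant. The bounds are
  put on \<open>- (x * poly g x)\<close>, which is positive on both sides of \<open>0\<close>, so
  that the notion survives \<open>x -> - x\<close>.\<close>

definition level_data :: "(real \<Rightarrow> real) \<Rightarrow> real \<Rightarrow> bool" where
  "level_data \<Gamma> \<delta> \<longleftrightarrow> \<delta> > 0 \<and> (\<forall>x. DERIV \<Gamma> x :> - poly g x) \<and>
    (\<exists>\<kappa>>0. \<exists>C>0. \<forall>x. x \<noteq> 0 \<longrightarrow> \<bar>x\<bar> < \<delta> \<longrightarrow>
      \<kappa> * \<bar>x\<bar> ^ (r + 1) \<le> - (x * poly g x) \<and> - (x * poly g x) \<le> C * \<bar>x\<bar> ^ (r + 1))"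

text \<open>A half-turn with time eliminated; the sign \<open>s\<close> tells the side of the
  axis.\<close>

definition branch :: "real \<Rightarrow> real \<Rightarrow> real \<Rightarrow> real \<Rightarrow> (real \<Rightarrow> real) \<Rightarrow> bool" where
  "branch \<rho> s \<alpha> \<beta> x \<longleftrightarrow> \<alpha> < \<beta> \<and> continuous_on {\<alpha>..\<beta>} x \<and> x \<alpha> = 0 \<and> x \<beta> = 0 \<and>
    (\<forall>y. \<alpha> < y \<and> y < \<beta> \<longrightarrow> 0 < s * x y \<and> \<bar>x y\<bar> \<le> \<rho> \<and>
      DERIV x y :> (poly \<phi> y - poly F (x y)) / (- poly g (x y)))"

lemma level_data_increasing:
  assumes \<Gamma>: "\<And>x. DERIV \<Gamma> x :> - poly g x" and neg: "\<And>x. 0 < x \<Longrightarrow> x < \<delta> \<Longrightarrow> - poly g x > 0"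
    and x: "0 \<le> x" "x < x'" "x' < \<delta>"
  shows "\<Gamma> x < \<Gamma> x'"
proof (rule DERIV_pos_imp_increasing_open[OF x(2)])
  show "continuous_on {x..x'} \<Gamma>" by (intro DERIV_atLeastAtMost_imp_continuous_on) (use \<Gamma> in blast)
  fix u assume "x < u" "u < x'"
  then have "- poly g u > 0" using x by (intro neg) auto
  then show "\<exists>y. DERIV \<Gamma> u :> y \<and> 0 < y" using \<Gamma> by blast
qed

text \<open>The difference \<open>D\<close> of the levels satisfies a linear differential inequality whose coefficient
  \<open>X1\<^sup>-\<^sup>r\<close> is singular at the upper end; there it is dominated by the derivative of \<open>- X1\<close>.\<close>

lemma graph_comparison:
  assumes \<Gamma>: "\<And>x. DERIV \<Gamma> x :> - poly g x" and \<kappa>: "\<kappa> > 0" and C: "C > 0"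
    and gb: "\<And>x. 0 < x \<Longrightarrow> x < \<delta> \<Longrightarrow> \<kappa> * x ^ r \<le> - poly g x \<and> - poly g x \<le> C * x ^ r"
    and \<beta>: "poly \<phi> \<beta> < 0"
    and X1: "continuous_on {\<alpha>..\<beta>} X1" "X1 \<beta> = 0" "\<And>y. \<alpha> < y \<Longrightarrow> y < \<beta> \<Longrightarrow> 0 < X1 y \<and> X1 y < \<delta>"
      "\<And>y. \<alpha> < y \<Longrightarrow> y < \<beta> \<Longrightarrow> DERIV X1 y :> (poly \<phi> y - poly F (X1 y)) / (- poly g (X1 y))"
    and X2: "continuous_on {\<alpha>..\<beta>} X2" "X2 \<beta> = 0" "\<And>y. \<alpha> < y \<Longrightarrow> y < \<beta> \<Longrightarrow> poly g (X2 y) \<noteq> 0"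
      "\<And>y. \<alpha> < y \<Longrightarrow> y < \<beta> \<Longrightarrow> DERIV X2 y :> (poly \<phi> y - poly F (X2 y)) / (- poly g (X2 y))"
    and pair: "\<And>y. \<alpha> < y \<Longrightarrow> y < \<beta> \<Longrightarrow> \<exists>x. 0 < x \<and> x < \<delta> \<and> \<Gamma> x = \<Gamma> (X2 y) \<and> poly F (X2 y) \<le> poly F x"
    and y0: "\<alpha> < y0" "y0 < \<beta>"
  shows "\<Gamma> (X2 y0) \<le> \<Gamma> (X1 y0)"
proof (rule ccontr)
  assume "\<not> \<Gamma> (X2 y0) \<le> \<Gamma> (X1 y0)"
  define D where "D y = \<Gamma> (X1 y) - \<Gamma> (X2 y)" for y
  have D0: "D y0 < 0" using \<open>\<not> \<Gamma> (X2 y0) \<le> \<Gamma> (X1 y0)\<close> by (simp add: D_def)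
  have D\<beta>: "D \<beta> = 0" by (simp add: D_def X1(2) X2(2))
  have cont\<Gamma>: "continuous_on S \<Gamma>" for S
    by (intro continuous_at_imp_continuous_on ballI DERIV_isCont[OF \<Gamma>])
  have contD: "continuous_on {\<alpha>..\<beta>} D"
    unfolding D_def[abs_def]
    by (intro continuous_intros continuous_on_compose2[OF cont\<Gamma>[of UNIV] X1(1)]
        continuous_on_compose2[OF cont\<Gamma>[of UNIV] X2(1)]) auto
  have gneg: "- poly g x > 0" if "0 < x" "x < \<delta>" for x
  proof -
    have "0 < \<kappa> * x ^ r" using \<kappa> that by simp
    also have "\<dots> \<le> - poly g x" using gb[OF that] by simp
    finally show ?thesis .
  qed
  \<comment> \<open>Measured in levels, the term \<open>\<phi>\<close> cancels and only the
    difference of \<open>F\<close> at the two points remains.\<close>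
  have dD: "DERIV D y :> poly F (X2 y) - poly F (X1 y)" if y: "\<alpha> < y" "y < \<beta>" for y
  proof -
    have "poly g (X1 y) \<noteq> 0" using gneg X1(3)[OF y] by fastforce
    then have "DERIV (\<lambda>y. \<Gamma> (X1 y)) y :> poly \<phi> y - poly F (X1 y)"
      using DERIV_chain2[OF \<Gamma> X1(4)[OF y]] by simp
    moreover have "DERIV (\<lambda>y. \<Gamma> (X2 y)) y :> poly \<phi> y - poly F (X2 y)"
      using DERIV_chain2[OF \<Gamma> X2(4)[OF y]] X2(3)[OF y] by simp
    ultimately have "DERIV D y :> (poly \<phi> y - poly F (X1 y)) - (poly \<phi> y - poly F (X2 y))"
      unfolding D_def[abs_def] by (rule DERIV_diff)
    then show ?thesis by simp
  qed
  obtain L where L: "L \<ge> 0" "\<forall>x\<in>{-\<delta>..\<delta>}. \<forall>y\<in>{-\<delta>..\<delta>}. \<bar>poly F x - poly F y\<bar> \<le> L * \<bar>x - y\<bar>"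
    using poly_lipschitz_interval by blast
  \<comment> \<open>\<open>X2 y\<close> is replaced by its level partner \<open>x\<close> on the
    side of \<open>X1\<close>. Where \<open>D < 0\<close>, \<open>x\<close> lies beyond
    \<open>X1 y\<close>; the lower bound on \<open>- g\<close> controls \<open>x - X1 y\<close> by
    \<open>- D\<close>, and the Lipschitz constant of \<open>F\<close> does the rest.\<close>
  have key: "poly F (X2 y) - poly F (X1 y) \<le> L / (\<kappa> * X1 y ^ r) * (- D y)" if y: "\<alpha> < y" "y < \<beta>" and neg: "D y < 0" for y
  proof -
    obtain x where x: "0 < x" "x < \<delta>" "\<Gamma> x = \<Gamma> (X2 y)" "poly F (X2 y) \<le> poly F x" using pair[OF y] by blast
    note x1 = X1(3)[OF y]
    have less: "X1 y < x"
    proof (rule ccontr)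
      assume "\<not> X1 y < x"
      then have "\<Gamma> x \<le> \<Gamma> (X1 y)"
      proof (cases "x = X1 y")
        case False
        with \<open>\<not> X1 y < x\<close> have "\<Gamma> x < \<Gamma> (X1 y)"
          by (intro level_data_increasing[OF \<Gamma> gneg]) (use x x1 in auto)
        then show ?thesis by simp
      qed simp
      with neg x(3) show False by (simp add: D_def)
    qed
    obtain z where z: "X1 y < z" "z < x" "\<Gamma> x - \<Gamma> (X1 y) = (x - X1 y) * (- poly g z)"
      using MVT2[OF less, of \<Gamma> "\<lambda>x. - poly g x"] \<Gamma> by blast
    have "\<kappa> * X1 y ^ r \<le> \<kappa> * z ^ r" using z x1 \<kappa> by (intro mult_left_mono power_mono) auto
    also have "\<dots> \<le> - poly g z" using gb[of z] z x1 x by simp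
    finally have "(x - X1 y) * (\<kappa> * X1 y ^ r) \<le> \<Gamma> x - \<Gamma> (X1 y)"
      unfolding z(3) using less by (intro mult_left_mono) auto
    moreover have pos: "\<kappa> * X1 y ^ r > 0" using \<kappa> x1 by simp
    ultimately have le: "x - X1 y \<le> (- D y) / (\<kappa> * X1 y ^ r)"
      by (simp add: D_def x(3) pos_le_divide_eq)
    have "x \<in> {-\<delta>..\<delta>}" "X1 y \<in> {-\<delta>..\<delta>}" using x x1 by auto
    then have "\<bar>poly F x - poly F (X1 y)\<bar> \<le> L * \<bar>x - X1 y\<bar>" using L(2) by blast
    then have "poly F (X2 y) - poly F (X1 y) \<le> L * (x - X1 y)" using x(4) less by linarith
    also have "\<dots> \<le> L * ((- D y) / (\<kappa> * X1 y ^ r))" using le L(1) by (rule mult_left_mono)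
    finally show ?thesis by simp
  qed
  obtain e where e: "y0 < e" "e \<le> \<beta>" "D e = 0" "\<And>y. y0 \<le> y \<Longrightarrow> y < e \<Longrightarrow> D y < 0"
    by (rule first_hit[of y0 \<beta> D 0])
      (use y0 D0 D\<beta> contD in \<open>auto intro: continuous_on_subset\<close>)
  have cont_sub: "continuous_on {s..u} D" "continuous_on {s..u} X1" if "\<alpha> \<le> s" "u \<le> \<beta>" for s u
    using that contD X1(1) by (auto intro: continuous_on_subset)
  show False
  proof (cases "e < \<beta>")
    \<comment> \<open>If the first zero \<open>e\<close> of \<open>D\<close> lies below
      \<open>\<beta>\<close>, then \<open>X1\<close> has a positive minimum up to \<open>e\<close>,
      so the coefficient is bounded and a linear exponent suffices.\<close>
    case True
    have "\<exists>u\<in>{y0..e}. \<forall>y\<in>{y0..e}. X1 u \<le> X1 y"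
      using e y0 by (intro continuous_attains_inf cont_sub) auto
    then obtain u where u: "u \<in> {y0..e}" "\<And>y. y \<in> {y0..e} \<Longrightarrow> X1 u \<le> X1 y" by blast
    have u0: "X1 u > 0" using X1(3)[of u] u(1) y0 e True by auto
    have "D e < 0"
    proof (rule exp_comparison[OF e(1) cont_sub(1), of "\<lambda>y. L / (\<kappa> * X1 u ^ r) * y"])
      show "continuous_on {y0..e} (\<lambda>y. L / (\<kappa> * X1 u ^ r) * y)" by (intro continuous_intros)
      fix y assume y: "y0 < y" "y < e"
      then have y': "\<alpha> < y" "y < \<beta>" using y0 e True by auto
      show "DERIV D y :> poly F (X2 y) - poly F (X1 y)" by (rule dD[OF y'])
      show "DERIV (\<lambda>y. L / (\<kappa> * X1 u ^ r) * y) y :> L / (\<kappa> * X1 u ^ r)"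
        using DERIV_cmult[OF DERIV_ident, of "L / (\<kappa> * X1 u ^ r)" y] by simp
      have Dy: "D y < 0" using e(4) y by simp
      have "L / (\<kappa> * X1 y ^ r) \<le> L / (\<kappa> * X1 u ^ r)"
        using u0 u(2)[of y] y \<kappa> L(1) by (intro divide_left_mono mult_left_mono power_mono) auto
      then have "L / (\<kappa> * X1 y ^ r) * (- D y) \<le> L / (\<kappa> * X1 u ^ r) * (- D y)"
        using Dy by (intro mult_right_mono) auto
      with key[OF y' Dy] show "poly F (X2 y) - poly F (X1 y) \<le> L / (\<kappa> * X1 u ^ r) * (- D y)" by linarith
    qed (use y0 e D0 in auto)
    with e(3) show False by simp
  next
    \<comment> \<open>Here \<open>X1\<close> tends to \<open>0\<close> and the coefficient is
      unbounded. But near \<open>\<beta>\<close> the function \<open>X1\<close> decreases at least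
      at the rate \<open>K / (C * X1 ^ r)\<close>, so a multiple of \<open>- X1\<close>, itself
      bounded, has a derivative dominating the coefficient.\<close>
    case False
    then have e\<beta>: "e = \<beta>" using e(2) by simp
    define \<psi> where "\<psi> y = poly \<phi> y - poly F (X1 y)" for y
    define K where "K = - poly \<phi> \<beta> / 2"
    have K: "K > 0" using \<beta> by (simp add: K_def)
    have "continuous_on {\<alpha>..\<beta>} \<psi>" unfolding \<psi>_def[abs_def] by (intro continuous_intros X1(1))
    then have "(\<psi> \<longlongrightarrow> \<psi> \<beta>) (at \<beta> within {\<alpha>..\<beta>})"
      using y0 by (simp add: continuous_on_def)
    moreover have "\<psi> \<beta> < - K" using K lowest_term_zero[OF F] \<beta> by (simp add: \<psi>_def X1(2) K_def)
    ultimately have "\<forall>\<^sub>F y in at \<beta> within {\<alpha>..\<beta>}. \<psi> y < - K" by (rule order_tendstoD(2))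
    then obtain d where d: "d > 0" "\<And>y. y \<in> {\<alpha>..\<beta>} \<Longrightarrow> y \<noteq> \<beta> \<Longrightarrow> dist y \<beta> < d \<Longrightarrow> \<psi> y < - K"
      unfolding eventually_at by blast
    define s where "s = max y0 (\<beta> - d / 2)"
    have s: "y0 \<le> s" "s < \<beta>" "\<beta> - d < s" using y0 d(1) by (auto simp: s_def)
    define C' where "C' = L * C / (\<kappa> * K)"
    have "D \<beta> < 0"
    proof (rule exp_comparison[OF s(2) cont_sub(1), of "\<lambda>y. - C' * X1 y"])
      show "continuous_on {s..\<beta>} (\<lambda>y. - C' * X1 y)" using s y0 by (intro continuous_intros cont_sub) auto
      show "D s < 0" using e(4) s e\<beta> by simp
      fix y assume y: "s < y" "y < \<beta>"
      then have y': "\<alpha> < y" "y < \<beta>" using y0 s by auto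
      show "DERIV D y :> poly F (X2 y) - poly F (X1 y)" by (rule dD[OF y'])
      show "DERIV (\<lambda>y. - C' * X1 y) y :> - C' * (\<psi> y / (- poly g (X1 y)))"
        unfolding \<psi>_def by (rule DERIV_cmult[OF X1(4)[OF y']])
      have Dy: "D y < 0" using e(4) y s e\<beta> by simp
      note x1 = X1(3)[OF y']
      have "\<psi> y < - K" using d(2)[of y] y y' s by (auto simp: dist_real_def)
      then have "K \<le> - \<psi> y" by simp
      moreover have g1: "0 < - poly g (X1 y)" "- poly g (X1 y) \<le> C * X1 y ^ r" using gneg gb x1 by auto
      ultimately have "K / (C * X1 y ^ r) \<le> - \<psi> y / (- poly g (X1 y))"
        using K by (intro frac_le) auto
      then have "C' * (K / (C * X1 y ^ r)) \<le> C' * (- \<psi> y / (- poly g (X1 y)))"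
        using L(1) C \<kappa> K by (intro mult_left_mono) (auto simp: C'_def)
      moreover have "C' * (K / (C * X1 y ^ r)) = L / (\<kappa> * X1 y ^ r)"
        using C K \<kappa> x1 by (simp add: C'_def field_simps)
      ultimately have "L / (\<kappa> * X1 y ^ r) \<le> - C' * (\<psi> y / (- poly g (X1 y)))" by simp
      then have "L / (\<kappa> * X1 y ^ r) * (- D y) \<le> - C' * (\<psi> y / (- poly g (X1 y))) * (- D y)"
        using Dy by (intro mult_right_mono) auto
      with key[OF y' Dy] show "poly F (X2 y) - poly F (X1 y) \<le> - C' * (\<psi> y / (- poly g (X1 y))) * (- D y)"
        by linarith
    qed (use s y0 in auto)
    with D\<beta> show False by simp
  qed
qed

text \<open>Termwise integration of the cofactor of \<open>g\<close>. Splitting off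
  \<open>x^(r + 1)\<close> exhibits the order of the extremum; for \<open>c < 0\<close> the value at
  \<open>0\<close> is positive, as the level pairs require.\<close>

lemma antiderivative:
  obtains Q where "\<And>x. DERIV (\<lambda>x. x ^ (r + 1) * poly Q x) x :> - poly g x" "poly Q 0 = - c / (real r + 1)"
proof -
  obtain \<phi>1 F1 g1 where f: "\<And>x. poly \<phi> x = x ^ p * poly \<phi>1 x" "poly \<phi>1 0 = a"
    "\<And>x. poly F x = x ^ q * poly F1 x" "poly F1 0 = b"
    "\<And>x. poly g x = x ^ r * poly g1 x" "poly g1 0 = c" by (rule factors) blast
  define w where "w j = real r + 1 + real j" for j :: nat
  have w: "w j > 0" for j by (simp add: w_def add_nonneg_pos add_pos_nonneg)
  define Q where "Q = (\<Sum>j\<le>degree g1. monom (- coeff g1 j / w j) j)"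
  have Q: "poly Q x = (\<Sum>j\<le>degree g1. - coeff g1 j / w j * x ^ j)" for x
    by (simp add: Q_def poly_sum poly_monom)
  show thesis
  proof (rule that)
    fix x :: real
    have "DERIV (\<lambda>x. - coeff g1 j / w j * x ^ (r + 1 + j)) x :> - coeff g1 j * x ^ (r + j)" for j
    proof -
      have "DERIV (\<lambda>x. - coeff g1 j / w j * x ^ (r + 1 + j)) x :> - coeff g1 j / w j * (real (r + 1 + j) * x ^ (r + j))"
        by (rule DERIV_cmult) (use DERIV_pow[of "r + 1 + j" x UNIV] in simp)
      moreover have "real (r + 1 + j) = w j" by (simp add: w_def)
      ultimately show ?thesis using w[of j] by simp
    qed
    then have "DERIV (\<lambda>x. \<Sum>j\<le>degree g1. - coeff g1 j / w j * x ^ (r + 1 + j)) x :> (\<Sum>j\<le>degree g1. - coeff g1 j * x ^ (r + j))"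
      by (rule DERIV_sum)
    moreover have "(\<lambda>x. x ^ (r + 1) * poly Q x) = (\<lambda>x. \<Sum>j\<le>degree g1. - coeff g1 j / w j * x ^ (r + 1 + j))"
      by (simp add: Q sum_distrib_left power_add mult_ac fun_eq_iff)
    moreover have "- poly g x = (\<Sum>j\<le>degree g1. - coeff g1 j * x ^ (r + j))"
      by (simp add: f(5) poly_altdef[of g1] sum_distrib_left power_add mult_ac sum_negf)
    ultimately show "DERIV (\<lambda>x. x ^ (r + 1) * poly Q x) x :> - poly g x" by simp
  next
    have "poly Q 0 = (\<Sum>j\<in>{0}. - coeff g1 j / w j * 0 ^ j)"
      unfolding Q by (rule sum.mono_neutral_right) auto
    then show "poly Q 0 = - c / (real r + 1)" using f(6) by (simp add: w_def poly_0_coeff_0)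
  qed
qed

section \<open>Size and monotonicity of the levels\<close>

lemma level_data_ex:
  assumes c: "c < 0" and r: "odd r" and \<Gamma>: "\<And>x. DERIV \<Gamma> x :> - poly g x"
  obtains \<delta>0 where "\<delta>0 > 0" "\<And>\<delta>. 0 < \<delta> \<Longrightarrow> \<delta> \<le> \<delta>0 \<Longrightarrow> level_data \<Gamma> \<delta>"
proof -
  \<comment> \<open>A tolerance of half the leading coefficient gives the two constants
    \<open>- c / 2\<close> and \<open>- (3 * c / 2)\<close>.\<close>
  have "- c / 2 > 0" using c by simp
  then obtain \<rho> where \<rho>: "\<rho> > 0" "\<And>x. \<bar>x\<bar> \<le> \<rho> \<Longrightarrow> \<bar>poly g x - c * x ^ r\<bar> \<le> - c / 2 * \<bar>x\<bar> ^ r"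
    using lowest_term_approx[OF g] by blast
  have est: "- c / 2 * \<bar>x\<bar> ^ (r + 1) \<le> - (x * poly g x)" "- (x * poly g x) \<le> - (3 * c / 2) * \<bar>x\<bar> ^ (r + 1)"
    if "\<bar>x\<bar> \<le> \<rho>" for x
  proof -
    have "even (r + 1)" using r by simp
    then have "\<bar>x\<bar> ^ (r + 1) = x ^ (r + 1)" by (rule power_even_abs)
    then have e: "x * (c * x ^ r) = c * \<bar>x\<bar> ^ (r + 1)" by simp
    have "\<bar>x * poly g x - x * (c * x ^ r)\<bar> = \<bar>x\<bar> * \<bar>poly g x - c * x ^ r\<bar>"
      by (simp add: abs_mult flip: right_diff_distrib)
    also have "\<dots> \<le> \<bar>x\<bar> * (- c / 2 * \<bar>x\<bar> ^ r)" using \<rho>(2)[OF that] by (rule mult_left_mono) simp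
    also have "\<dots> = - c / 2 * \<bar>x\<bar> ^ (r + 1)" by simp
    finally have "\<bar>x * poly g x - c * \<bar>x\<bar> ^ (r + 1)\<bar> \<le> - c / 2 * \<bar>x\<bar> ^ (r + 1)" unfolding e .
    then show "- c / 2 * \<bar>x\<bar> ^ (r + 1) \<le> - (x * poly g x)" "- (x * poly g x) \<le> - (3 * c / 2) * \<bar>x\<bar> ^ (r + 1)"
      by (simp_all add: abs_le_iff field_simps)
  qed
  show thesis
  proof (rule that[OF \<rho>(1)])
    fix \<delta> :: real assume \<delta>: "0 < \<delta>" "\<delta> \<le> \<rho>"
    have "- c / 2 * \<bar>x\<bar> ^ (r + 1) \<le> - (x * poly g x) \<and> - (x * poly g x) \<le> - (3 * c / 2) * \<bar>x\<bar> ^ (r + 1)"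
      if "\<bar>x\<bar> < \<delta>" for x using est[of x] that \<delta> by simp
    then show "level_data \<Gamma> \<delta>"
      unfolding level_data_def using \<delta>(1) c \<Gamma>
      by (intro conjI allI exI[of _ "- c / 2"] exI[of _ "- (3 * c / 2)"] impI) auto
  qed
qed

lemma level_data_right:
  assumes "level_data \<Gamma> \<delta>"
  obtains \<kappa> C where "\<kappa> > 0" "C > 0" "\<And>x. 0 < x \<Longrightarrow> x < \<delta> \<Longrightarrow> \<kappa> * x ^ r \<le> - poly g x \<and> - poly g x \<le> C * x ^ r"
proof -
  obtain \<kappa> C where k: "\<kappa> > 0" "C > 0" "\<And>x. x \<noteq> 0 \<Longrightarrow> \<bar>x\<bar> < \<delta> \<Longrightarrow>
      \<kappa> * \<bar>x\<bar> ^ (r + 1) \<le> - (x * poly g x) \<and> - (x * poly g x) \<le> C * \<bar>x\<bar> ^ (r + 1)"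
    using assms unfolding level_data_def by blast
  have "\<kappa> * x ^ r \<le> - poly g x \<and> - poly g x \<le> C * x ^ r" if x: "0 < x" "x < \<delta>" for x
  proof -
    have "x * (\<kappa> * x ^ r) \<le> x * (- poly g x) \<and> x * (- poly g x) \<le> x * (C * x ^ r)"
      using k(3)[of x] x by (simp add: mult_ac)
    then show ?thesis using x(1) by (simp only: mult_le_cancel_left_pos)
  qed
  with k(1,2) show thesis by (rule that)
qed

lemma level_data_g:
  assumes "level_data \<Gamma> \<delta>" "x \<noteq> 0" "\<bar>x\<bar> < \<delta>"
  shows "x * poly g x < 0"
proof -
  obtain \<kappa> C where k: "\<kappa> > 0" "\<kappa> * \<bar>x\<bar> ^ (r + 1) \<le> - (x * poly g x)"
    using assms unfolding level_data_def by blast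
  have "0 < \<kappa> * \<bar>x\<bar> ^ (r + 1)" using k(1) assms(2) by simp
  with k(2) show ?thesis by linarith
qed

lemma level_data_pos:
  assumes lev: "level_data \<Gamma> \<delta>" and x: "x \<noteq> 0" "\<bar>x\<bar> < \<delta>"
  shows "\<Gamma> x > \<Gamma> 0"
proof (cases "x > 0")
  case True
  have "- poly g u > 0" if "0 < u" "u < \<delta>" for u
    using level_data_g[OF lev, of u] that by (auto simp: mult_less_0_iff)
  moreover have "DERIV \<Gamma> u :> - poly g u" for u using lev by (simp add: level_data_def)
  ultimately show ?thesis by (intro level_data_increasing[of \<Gamma> \<delta>]) (use True x in auto)
next
  case False
  then have x0: "x < 0" using x by simp
  have "\<Gamma> 0 < \<Gamma> x"
  proof (rule DERIV_neg_imp_decreasing_open[OF x0])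
    show "continuous_on {x..0} \<Gamma>" using lev unfolding level_data_def
      by (intro DERIV_atLeastAtMost_imp_continuous_on) blast
    fix u assume "x < u" "u < 0"
    then have "- poly g u < 0" using level_data_g[OF lev, of u] x by (auto simp: mult_less_0_iff)
    then show "\<exists>y. DERIV \<Gamma> u :> y \<and> y < 0" using lev unfolding level_data_def by blast
  qed
  then show ?thesis .
qed

lemma level_data_reflect:
  assumes "level_data \<Gamma> \<delta>"
  shows "lienard.level_data (- reflect_poly_arg g) r (\<lambda>x. \<Gamma> (- x)) \<delta>"
proof -
  interpret pr: lienard "- reflect_poly_arg \<phi>" "- reflect_poly_arg F" "- reflect_poly_arg g" p q r
    "- ((-1) ^ p * a)" "- ((-1) ^ q * b)" "- ((-1) ^ r * c)"
    by (rule point_reflection_lienard)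
  obtain \<kappa> C where k: "\<kappa> > 0" "C > 0" "\<And>x. x \<noteq> 0 \<Longrightarrow> \<bar>x\<bar> < \<delta> \<Longrightarrow>
      \<kappa> * \<bar>x\<bar> ^ (r + 1) \<le> - (x * poly g x) \<and> - (x * poly g x) \<le> C * \<bar>x\<bar> ^ (r + 1)"
    using assms unfolding level_data_def by blast
  have \<Gamma>: "DERIV \<Gamma> x :> - poly g x" for x using assms by (simp add: level_data_def)
  have "DERIV (\<lambda>x. \<Gamma> (- x)) x :> - poly g (- x) * - 1" for x
    by (rule DERIV_chain2[OF \<Gamma>]) (auto intro!: derivative_eq_intros)
  moreover have "\<kappa> * \<bar>x\<bar> ^ (r + 1) \<le> x * poly g (- x) \<and> x * poly g (- x) \<le> C * \<bar>x\<bar> ^ (r + 1)"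
    if "x \<noteq> 0" "\<bar>x\<bar> < \<delta>" for x using k(3)[of "- x"] that by simp
  ultimately show ?thesis
    unfolding pr.level_data_def using assms k(1,2)
    by (intro conjI allI exI[of _ \<kappa>] exI[of _ C] impI) (auto simp: level_data_def poly_pcompose)
qed

section \<open>Branches on the two sides and their ends\<close>

lemma branchD:
  assumes "branch \<rho> s \<alpha> \<beta> x" "\<alpha> < y" "y < \<beta>"
  shows "0 < s * x y" "\<bar>x y\<bar> \<le> \<rho>" "DERIV x y :> (poly \<phi> y - poly F (x y)) / (- poly g (x y))"
  using assms unfolding branch_def by blast+

lemma right_path_branch:
  assumes "c < 0" "good_radius \<rho>" "right_path \<rho> (0, \<alpha>) (0, \<beta>) \<gamma> T"
  obtains x where "branch \<rho> 1 \<alpha> \<beta> x"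
proof -
  obtain x where x: "\<alpha> < \<beta>" "continuous_on {\<alpha>..\<beta>} x" "x \<alpha> = 0" "x \<beta> = 0"
    "\<And>y. \<alpha> < y \<Longrightarrow> y < \<beta> \<Longrightarrow> 0 < x y \<and> x y \<le> \<rho>"
    "\<And>y. \<alpha> < y \<Longrightarrow> y < \<beta> \<Longrightarrow> DERIV x y :> (poly \<phi> y - poly F (x y)) / (- poly g (x y))"
    by (rule right_path_graph[OF assms]) (rule that)
  have "\<bar>x y\<bar> \<le> \<rho>" if "\<alpha> < y" "y < \<beta>" for y using x(5)[OF that] by (simp add: abs_of_pos)
  then have "branch \<rho> 1 \<alpha> \<beta> x" unfolding branch_def using x by simp
  then show thesis by (rule that)
qed

lemma branch_point_reflection:
  assumes "branch \<rho> s \<alpha> \<beta> x"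
  shows "lienard.branch (- reflect_poly_arg \<phi>) (- reflect_poly_arg F) (- reflect_poly_arg g) \<rho> (- s) (- \<beta>) (- \<alpha>) (\<lambda>y. - x (- y))"
proof -
  interpret pr: lienard "- reflect_poly_arg \<phi>" "- reflect_poly_arg F" "- reflect_poly_arg g" p q r
    "- ((-1) ^ p * a)" "- ((-1) ^ q * b)" "- ((-1) ^ r * c)"
    by (rule point_reflection_lienard)
  have "continuous_on {- \<beta>..- \<alpha>} (\<lambda>y. - x (- y))"
  proof (rule continuous_on_minus, rule continuous_on_compose2[of "{\<alpha>..\<beta>}" x])
    show "continuous_on {\<alpha>..\<beta>} x" using assms by (simp add: branch_def)
    show "continuous_on {- \<beta>..- \<alpha>} uminus" by (intro continuous_intros)
  qed auto
  moreover have "DERIV (\<lambda>y. - x (- y)) y :> (- poly \<phi> (- y) + poly F (x (- y))) / poly g (x (- y))"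
    if y: "- \<beta> < y" "y < - \<alpha>" for y
  proof -
    have "DERIV x (- y) :> (poly \<phi> (- y) - poly F (x (- y))) / (- poly g (x (- y)))"
      using assms y unfolding branch_def by simp
    then have "DERIV (\<lambda>y. - x (- y)) y :> - ((poly \<phi> (- y) - poly F (x (- y))) / (- poly g (x (- y))) * - 1)"
      by (intro DERIV_minus DERIV_chain2[of x]) (auto intro!: derivative_eq_intros)
    then show ?thesis by (rule DERIV_cong) (simp add: diff_divide_distrib add_divide_distrib)
  qed
  ultimately show ?thesis using assms unfolding branch_def pr.branch_def by (auto simp: poly_pcompose)
qed

lemma branch_point_reflection_converse:
  assumes "lienard.branch (- reflect_poly_arg \<phi>) (- reflect_poly_arg F) (- reflect_poly_arg g) \<rho> s \<alpha> \<beta> x"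
  shows "branch \<rho> (- s) (- \<beta>) (- \<alpha>) (\<lambda>y. - x (- y))"
proof -
  interpret pr: lienard "- reflect_poly_arg \<phi>" "- reflect_poly_arg F" "- reflect_poly_arg g" p q r
    "- ((-1) ^ p * a)" "- ((-1) ^ q * b)" "- ((-1) ^ r * c)"
    by (rule point_reflection_lienard)
  show ?thesis using pr.branch_point_reflection[OF assms]
    by (simp add: pcompose_reflect_minus pcompose_reflect_twice)
qed

lemma left_path_branch:
  assumes M: "monodromy_condition" and good: "lienard.good_radius (- reflect_poly_arg \<phi>) (- reflect_poly_arg g) (- ((-1) ^ r * c)) \<rho>"
    and path: "left_path \<rho> (0, \<beta>) (0, \<alpha>) \<gamma> T"
  obtains x where "branch \<rho> (-1) \<alpha> \<beta> x"
proof -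
  interpret pr: lienard "- reflect_poly_arg \<phi>" "- reflect_poly_arg F" "- reflect_poly_arg g" p q r
    "- ((-1) ^ p * a)" "- ((-1) ^ q * b)" "- ((-1) ^ r * c)"
    by (rule point_reflection_lienard)
  have c: "- ((-1) ^ r * c) < 0" using M by (simp add: monodromy_condition_def)
  have path': "pr.right_path \<rho> (0, - \<beta>) (0, - \<alpha>) (\<lambda>t. axis_reflection (-1) (-1) (\<gamma> t)) T"
    using left_path_reflected[OF path] by (simp add: axis_reflection_def)
  obtain x where "pr.branch \<rho> 1 (- \<beta>) (- \<alpha>) x"
    by (rule pr.right_path_branch[OF c good path'])
  from branch_point_reflection_converse[OF this] have "branch \<rho> (-1) \<alpha> \<beta> (\<lambda>y. - x (- y))" by simp
  then show thesis by (rule that)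
qed

text \<open>The branches are required to share the upper end \<open>\<beta>\<close> only, so the
  levels are compared on a common part above some \<open>\<alpha>\<close>.\<close>

lemma branch_comparison:
  assumes lev: "level_data \<Gamma> \<delta>" and \<rho>: "\<rho> < \<delta>" and \<beta>: "poly \<phi> \<beta> < 0"
    and partner: "\<And>z. z \<noteq> 0 \<Longrightarrow> \<bar>z\<bar> \<le> \<rho> \<Longrightarrow> \<exists>x. x * z < 0 \<and> \<bar>x\<bar> < \<delta> \<and> \<Gamma> x = \<Gamma> z"
    and FF: "\<And>x z. 0 < x \<Longrightarrow> x < \<delta> \<Longrightarrow> - \<delta> < z \<Longrightarrow> z < 0 \<Longrightarrow> \<Gamma> x = \<Gamma> z \<Longrightarrow> poly F z \<le> poly F x"
    and b1: "branch \<rho> 1 \<alpha>1 \<beta> x1" and b2: "branch \<rho> (-1) \<alpha>2 \<beta> x2"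
    and \<alpha>: "\<alpha>1 \<le> \<alpha>" "\<alpha>2 \<le> \<alpha>" and y: "\<alpha> < y" "y < \<beta>"
  shows "\<Gamma> (x2 y) \<le> \<Gamma> (x1 y)"
proof -
  obtain \<kappa> C where k: "\<kappa> > 0" "C > 0" "\<And>x. 0 < x \<Longrightarrow> x < \<delta> \<Longrightarrow> \<kappa> * x ^ r \<le> - poly g x \<and> - poly g x \<le> C * x ^ r"
    by (rule level_data_right[OF lev]) (rule that)
  have \<Gamma>: "DERIV \<Gamma> x :> - poly g x" for x using lev by (simp add: level_data_def)
  have B1: "0 < x1 u" "x1 u \<le> \<rho>" "DERIV x1 u :> (poly \<phi> u - poly F (x1 u)) / (- poly g (x1 u))"
    if "\<alpha> < u" "u < \<beta>" for u
    using branchD[OF b1, of u] \<alpha> that by (simp_all add: abs_le_iff)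
  have B2: "x2 u < 0" "- \<rho> \<le> x2 u" "DERIV x2 u :> (poly \<phi> u - poly F (x2 u)) / (- poly g (x2 u))"
    if "\<alpha> < u" "u < \<beta>" for u
    using branchD[OF b2, of u] \<alpha> that by (simp_all add: abs_le_iff)
  show ?thesis
  proof (rule graph_comparison[OF \<Gamma> k \<beta>, where \<alpha> = \<alpha> and ?X1.0 = x1 and ?X2.0 = x2])
    show "continuous_on {\<alpha>..\<beta>} x1" "continuous_on {\<alpha>..\<beta>} x2" "x1 \<beta> = 0" "x2 \<beta> = 0"
      using b1 b2 \<alpha> unfolding branch_def by (auto intro: continuous_on_subset)
    fix u assume u: "\<alpha> < u" "u < \<beta>"
    show "0 < x1 u \<and> x1 u < \<delta>" using B1[OF u] \<rho> by simp
    show "poly g (x2 u) \<noteq> 0" using level_data_g[OF lev, of "x2 u"] B2[OF u] \<rho> by auto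
    obtain x where x: "x * x2 u < 0" "\<bar>x\<bar> < \<delta>" "\<Gamma> x = \<Gamma> (x2 u)"
      using partner[of "x2 u"] B2[OF u] by (auto simp: abs_le_iff)
    then have "0 < x" "x < \<delta>" using B2(1)[OF u] by (auto simp: mult_less_0_iff)
    moreover have "poly F (x2 u) \<le> poly F x" by (rule FF) (use x B2[OF u] \<rho> calculation in auto)
    ultimately show "\<exists>x. 0 < x \<and> x < \<delta> \<and> \<Gamma> x = \<Gamma> (x2 u) \<and> poly F (x2 u) \<le> poly F x" using x by blast
  qed (use B1 B2 y in auto)
qed

text \<open>If the left branch reached further down, then at \<open>\<alpha>1\<close> the right
  branch would be on the axis, at the minimal level, while the left one is still off the axis at a
  higher level. This contradicts the comparison, extended to \<open>\<alpha>1\<close> by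
  continuity.\<close>

lemma branch_ends:
  assumes lev: "level_data \<Gamma> \<delta>" and \<rho>: "\<rho> < \<delta>" and \<beta>: "poly \<phi> \<beta> < 0"
    and partner: "\<And>z. z \<noteq> 0 \<Longrightarrow> \<bar>z\<bar> \<le> \<rho> \<Longrightarrow> \<exists>x. x * z < 0 \<and> \<bar>x\<bar> < \<delta> \<and> \<Gamma> x = \<Gamma> z"
    and FF: "\<And>x z. 0 < x \<Longrightarrow> x < \<delta> \<Longrightarrow> - \<delta> < z \<Longrightarrow> z < 0 \<Longrightarrow> \<Gamma> x = \<Gamma> z \<Longrightarrow> poly F z \<le> poly F x"
    and b1: "branch \<rho> 1 \<alpha>1 \<beta> x1" and b2: "branch \<rho> (-1) \<alpha>2 \<beta> x2"
  shows "\<alpha>1 \<le> \<alpha>2"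
proof (rule ccontr)
  assume "\<not> \<alpha>1 \<le> \<alpha>2"
  then have less: "\<alpha>2 < \<alpha>1" by simp
  have \<alpha>\<beta>: "\<alpha>1 < \<beta>" using b1 by (simp add: branch_def)
  have cont\<Gamma>: "continuous_on UNIV \<Gamma>" using lev unfolding level_data_def
    by (intro continuous_at_imp_continuous_on ballI) (blast intro: DERIV_isCont)
  have c1: "continuous_on {\<alpha>1..\<beta>} x1" and c2: "continuous_on {\<alpha>1..\<beta>} x2"
    using b1 b2 less unfolding branch_def by (auto intro: continuous_on_subset)
  have cl: "closure {\<alpha>1<..<\<beta>} = {\<alpha>1..\<beta>}" using \<alpha>\<beta> by simp
  have "\<Gamma> (x2 \<alpha>1) - \<Gamma> (x1 \<alpha>1) \<le> 0"
  proof (rule continuous_le_on_closure[of "{\<alpha>1<..<\<beta>}" "\<lambda>y. \<Gamma> (x2 y) - \<Gamma> (x1 y)"])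
    show "continuous_on (closure {\<alpha>1<..<\<beta>}) (\<lambda>y. \<Gamma> (x2 y) - \<Gamma> (x1 y))"
      unfolding cl by (intro continuous_intros continuous_on_compose2[OF cont\<Gamma> c1] continuous_on_compose2[OF cont\<Gamma> c2]) auto
    show "\<alpha>1 \<in> closure {\<alpha>1<..<\<beta>}" unfolding cl using \<alpha>\<beta> by simp
    fix y assume "y \<in> {\<alpha>1<..<\<beta>}"
    then have y: "\<alpha>1 < y" "y < \<beta>" by auto
    have "\<Gamma> (x2 y) \<le> \<Gamma> (x1 y)"
      by (rule branch_comparison[OF lev \<rho> \<beta> partner FF b1 b2 order_refl _ y]) (use less in auto)
    then show "\<Gamma> (x2 y) - \<Gamma> (x1 y) \<le> 0" by simp
  qed
  moreover have "\<Gamma> (x2 \<alpha>1) > \<Gamma> 0"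
    using b2 less \<alpha>\<beta> \<rho> unfolding branch_def by (intro level_data_pos[OF lev]) fastforce+
  moreover have "x1 \<alpha>1 = 0" using b1 by (simp add: branch_def)
  ultimately show False by simp
qed

text \<open>A graph over the \<open>y\<close>-axis does not record the direction of time, so
  \<open>x -> - x\<close> can be used with \<open>\<phi>\<close> and both ends unchanged. This
  exchanges the roles of the two sides.\<close>

lemma branch_x_reflection:
  assumes "branch \<rho> s \<alpha> \<beta> x"
  shows "lienard.branch \<phi> (reflect_poly_arg F) (- reflect_poly_arg g) \<rho> (- s) \<alpha> \<beta> (\<lambda>y. - x y)"
proof -
  interpret xr: lienard \<phi> "reflect_poly_arg F" "- reflect_poly_arg g" p q r a "(-1) ^ q * b" "- ((-1) ^ r * c)"
    using \<phi> F g by unfold_locales (assumption | intro lowest_term_minus lowest_term_reflect; assumption)+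
  have "DERIV (\<lambda>y. - x y) y :> (poly \<phi> y - poly F (x y)) / poly g (x y)" if y: "\<alpha> < y" "y < \<beta>" for y
  proof -
    have "DERIV x y :> (poly \<phi> y - poly F (x y)) / (- poly g (x y))"
      using assms y unfolding branch_def by simp
    from DERIV_minus[OF this] show ?thesis by (rule DERIV_cong) simp
  qed
  then show ?thesis using assms unfolding branch_def xr.branch_def
    by (auto simp: poly_pcompose intro: continuous_on_minus)
qed

lemma branch_ends_equal:
  assumes lev: "level_data \<Gamma> \<delta>" and \<rho>: "\<rho> < \<delta>" and \<beta>: "poly \<phi> \<beta> < 0"
    and partner: "\<And>z. z \<noteq> 0 \<Longrightarrow> \<bar>z\<bar> \<le> \<rho> \<Longrightarrow> \<exists>x. x * z < 0 \<and> \<bar>x\<bar> < \<delta> \<and> \<Gamma> x = \<Gamma> z"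
    and FF: "\<And>x z. 0 < x \<Longrightarrow> x < \<delta> \<Longrightarrow> - \<delta> < z \<Longrightarrow> z < 0 \<Longrightarrow> \<Gamma> x = \<Gamma> z \<Longrightarrow> poly F x = poly F z"
    and b1: "branch \<rho> 1 \<alpha>1 \<beta> x1" and b2: "branch \<rho> (-1) \<alpha>2 \<beta> x2"
  shows "\<alpha>1 = \<alpha>2"
proof (rule antisym)
  show "\<alpha>1 \<le> \<alpha>2"
  proof (rule branch_ends[OF lev \<rho> \<beta> partner _ b1 b2])
    show "poly F z \<le> poly F x" if "0 < x" "x < \<delta>" "- \<delta> < z" "z < 0" "\<Gamma> x = \<Gamma> z" for x z using FF[OF that] by simp
  qed
  interpret xr: lienard \<phi> "reflect_poly_arg F" "- reflect_poly_arg g" p q r a "(-1) ^ q * b" "- ((-1) ^ r * c)"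
    using \<phi> F g by unfold_locales (assumption | intro lowest_term_minus lowest_term_reflect; assumption)+
  have lev': "xr.level_data (\<lambda>x. \<Gamma> (- x)) \<delta>" by (rule level_data_reflect[OF lev])
  have b1': "xr.branch \<rho> (-1) \<alpha>1 \<beta> (\<lambda>y. - x1 y)" using branch_x_reflection[OF b1] by simp
  have b2': "xr.branch \<rho> 1 \<alpha>2 \<beta> (\<lambda>y. - x2 y)" using branch_x_reflection[OF b2] by simp
  show "\<alpha>2 \<le> \<alpha>1"
  proof (rule xr.branch_ends[OF lev' \<rho> \<beta> _ _ b2' b1'])
    fix z :: real assume "z \<noteq> 0" "\<bar>z\<bar> \<le> \<rho>"
    then obtain x where "x * (- z) < 0" "\<bar>x\<bar> < \<delta>" "\<Gamma> x = \<Gamma> (- z)" using partner[of "- z"] by auto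
    then show "\<exists>x. x * z < 0 \<and> \<bar>x\<bar> < \<delta> \<and> \<Gamma> (- x) = \<Gamma> (- z)" by (intro exI[of _ "- x"]) auto
  next
    fix x z :: real assume "0 < x" "x < \<delta>" "- \<delta> < z" "z < 0" "\<Gamma> (- x) = \<Gamma> (- z)"
    then show "poly (reflect_poly_arg F) z \<le> poly (reflect_poly_arg F) x"
      using FF[of "- z" "- x"] by (simp add: poly_pcompose)
  qed
qed

text \<open>With both ends in common, the comparison from the upper end and, after a half-turn, from
  the lower end give opposite inequalities between the levels. So the levels agree all along, and
  then so do the values of \<open>F\<close>, against the strict inequality.\<close>

lemma branch_ends_distinct:
  assumes lev: "level_data \<Gamma> \<delta>" and \<rho>: "\<rho> < \<delta>" and \<beta>: "poly \<phi> \<beta> < 0" and \<alpha>: "poly \<phi> \<alpha> > 0"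
    and partner: "\<And>z. z \<noteq> 0 \<Longrightarrow> \<bar>z\<bar> \<le> \<rho> \<Longrightarrow> \<exists>x. x * z < 0 \<and> \<bar>x\<bar> < \<delta> \<and> \<Gamma> x = \<Gamma> z"
    and FF: "\<And>x z. 0 < x \<Longrightarrow> x < \<delta> \<Longrightarrow> - \<delta> < z \<Longrightarrow> z < 0 \<Longrightarrow> \<Gamma> x = \<Gamma> z \<Longrightarrow> poly F z < poly F x"
    and b1: "branch \<rho> 1 \<alpha> \<beta> x1" and b2: "branch \<rho> (-1) \<alpha> \<beta> x2"
  shows False
proof -
  interpret pr: lienard "- reflect_poly_arg \<phi>" "- reflect_poly_arg F" "- reflect_poly_arg g" p q r
    "- ((-1) ^ p * a)" "- ((-1) ^ q * b)" "- ((-1) ^ r * c)"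
    by (rule point_reflection_lienard)
  have \<alpha>\<beta>: "\<alpha> < \<beta>" using b1 by (simp add: branch_def)
  have B1: "0 < x1 u" "x1 u \<le> \<rho>" "DERIV x1 u :> (poly \<phi> u - poly F (x1 u)) / (- poly g (x1 u))"
    if "\<alpha> < u" "u < \<beta>" for u
    using branchD[OF b1, of u] that by (simp_all add: abs_le_iff)
  have B2: "x2 u < 0" "- \<rho> \<le> x2 u" "DERIV x2 u :> (poly \<phi> u - poly F (x2 u)) / (- poly g (x2 u))"
    if "\<alpha> < u" "u < \<beta>" for u
    using branchD[OF b2, of u] that by (simp_all add: abs_le_iff)
  have le: "\<Gamma> (x2 y) \<le> \<Gamma> (x1 y)" if y: "\<alpha> < y" "y < \<beta>" for y
    by (rule branch_comparison[OF lev \<rho> \<beta> partner _ b1 b2 order_refl order_refl y]) (auto intro: less_imp_le FF)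
  have lev': "pr.level_data (\<lambda>x. \<Gamma> (- x)) \<delta>" by (rule level_data_reflect[OF lev])
  have b1': "pr.branch \<rho> (-1) (- \<beta>) (- \<alpha>) (\<lambda>y. - x1 (- y))" using branch_point_reflection[OF b1] by simp
  have b2': "pr.branch \<rho> 1 (- \<beta>) (- \<alpha>) (\<lambda>y. - x2 (- y))" using branch_point_reflection[OF b2] by simp
  have ge: "\<Gamma> (x1 y) \<le> \<Gamma> (x2 y)" if y: "\<alpha> < y" "y < \<beta>" for y
  proof -
    have "\<Gamma> (- (- x1 (- (- y)))) \<le> \<Gamma> (- (- x2 (- (- y))))"
    proof (rule pr.branch_comparison[OF lev' \<rho> _ _ _ b2' b1' order_refl order_refl])
      show "poly (- reflect_poly_arg \<phi>) (- \<alpha>) < 0" using \<alpha> by (simp add: poly_pcompose)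
      fix z :: real assume "z \<noteq> 0" "\<bar>z\<bar> \<le> \<rho>"
      then obtain x where "x * (- z) < 0" "\<bar>x\<bar> < \<delta>" "\<Gamma> x = \<Gamma> (- z)" using partner[of "- z"] by auto
      then show "\<exists>x. x * z < 0 \<and> \<bar>x\<bar> < \<delta> \<and> \<Gamma> (- x) = \<Gamma> (- z)" by (intro exI[of _ "- x"]) auto
    next
      fix x z :: real assume "0 < x" "x < \<delta>" "- \<delta> < z" "z < 0" "\<Gamma> (- x) = \<Gamma> (- z)"
      then show "poly (- reflect_poly_arg F) z \<le> poly (- reflect_poly_arg F) x"
        using FF[of "- z" "- x"] by (simp add: poly_pcompose)
    qed (use y in auto)
    then show ?thesis by simp
  qed
  have eq: "\<Gamma> (x1 y) = \<Gamma> (x2 y)" if "\<alpha> < y" "y < \<beta>" for y using le[OF that] ge[OF that] by simp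
  \<comment> \<open>Any interior point would do: levels that agree nearby have equal derivatives,
    and the derivatives differ by the values of \<open>F\<close>.\<close>
  define y where "y = (\<alpha> + \<beta>) / 2"
  have y: "\<alpha> < y" "y < \<beta>" using \<alpha>\<beta> by (auto simp: y_def)
  have \<Gamma>: "DERIV \<Gamma> x :> - poly g x" for x using lev by (simp add: level_data_def)
  have gnz: "poly g (x1 y) \<noteq> 0" "poly g (x2 y) \<noteq> 0"
    using level_data_g[OF lev, of "x1 y"] level_data_g[OF lev, of "x2 y"] B1[OF y] B2[OF y] \<rho> by auto
  have "DERIV (\<lambda>y. \<Gamma> (x1 y)) y :> poly \<phi> y - poly F (x1 y)"
    using DERIV_chain2[OF \<Gamma> B1(3)[OF y]] gnz by simp
  moreover have "DERIV (\<lambda>y. \<Gamma> (x2 y)) y :> poly \<phi> y - poly F (x2 y)"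
    using DERIV_chain2[OF \<Gamma> B2(3)[OF y]] gnz by simp
  ultimately have "DERIV (\<lambda>y. \<Gamma> (x1 y) - \<Gamma> (x2 y)) y :> (poly \<phi> y - poly F (x1 y)) - (poly \<phi> y - poly F (x2 y))"
    by (rule DERIV_diff)
  moreover have "0 < min (y - \<alpha>) (\<beta> - y)" using y by simp
  moreover have "\<forall>u. \<bar>y - u\<bar> < min (y - \<alpha>) (\<beta> - y) \<longrightarrow> \<Gamma> (x1 y) - \<Gamma> (x2 y) = \<Gamma> (x1 u) - \<Gamma> (x2 u)"
    using eq[OF y] eq by (auto simp: abs_less_iff)
  ultimately have "(poly \<phi> y - poly F (x1 y)) - (poly \<phi> y - poly F (x2 y)) = 0" by (rule DERIV_local_const)
  moreover have "poly F (x2 y) < poly F (x1 y)"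
    by (rule FF) (use B1[OF y] B2[OF y] \<rho> eq[OF y] in auto)
  ultimately show False by simp
qed

end

section \<open>Centers\<close>

definition periodic_through :: "(real \<times> real \<Rightarrow> real \<times> real) \<Rightarrow> real \<times> real \<Rightarrow> bool" where
  "periodic_through X v \<longleftrightarrow> (\<exists>\<gamma> T. integral_curve X UNIV \<gamma> \<and> \<gamma> 0 = v \<and>
    T > 0 \<and> (\<forall>t. \<gamma> (t + T) = \<gamma> t) \<and> (\<exists>t. \<gamma> t \<noteq> v))"

lemma center_iff_periodic:
  "center X P \<longleftrightarrow> X P = 0 \<and> (\<exists>\<epsilon>>0. \<forall>v\<in>ball P \<epsilon> - {P}. periodic_through X v)"
  by (simp add: center_def periodic_through_def)

lemma periodic_through_reverse:
  assumes "periodic_through X v"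
  shows "periodic_through (\<lambda>v. - X v) v"
proof -
  obtain \<gamma> T where \<gamma>: "integral_curve X UNIV \<gamma>" "\<gamma> 0 = v" "T > 0" "\<And>t. \<gamma> (t + T) = \<gamma> t" "\<exists>t. \<gamma> t \<noteq> v"
    using assms by (auto simp: periodic_through_def)
  have "integral_curve (\<lambda>v. - X v) UNIV (\<lambda>t. \<gamma> (- t))"
    using integral_curve_reflect[OF \<gamma>(1)] by simp
  moreover have "\<gamma> (- (t + T)) = \<gamma> (- t)" for t using \<gamma>(4)[of "- (t + T)"] by simp
  moreover have "\<exists>t. \<gamma> (- t) \<noteq> v" using \<gamma>(5) by (metis minus_minus)
  ultimately show ?thesis
    unfolding periodic_through_def using \<gamma>(2,3) by (intro exI[of _ "\<lambda>t. \<gamma> (- t)"] exI[of _ T]) auto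
qed

lemma periodic_through_axis_reflection:
  assumes "periodic_through X v" and s: "s1 * s1 = 1" "s2 * s2 = 1"
  shows "periodic_through (\<lambda>v. axis_reflection s1 s2 (X (axis_reflection s1 s2 v))) (axis_reflection s1 s2 v)"
proof -
  let ?R = "axis_reflection s1 s2"
  have RR: "?R (?R w) = w" for w
    by (cases w) (simp add: axis_reflection_def s flip: mult.assoc)
  obtain \<gamma> T where \<gamma>: "integral_curve X UNIV \<gamma>" "\<gamma> 0 = v" "T > 0" "\<And>t. \<gamma> (t + T) = \<gamma> t" "\<exists>t. \<gamma> t \<noteq> v"
    using assms by (auto simp: periodic_through_def)
  have "\<exists>t. ?R (\<gamma> t) \<noteq> ?R v" using \<gamma>(5) RR by metis
  then show ?thesis
    unfolding periodic_through_def using \<gamma> integral_curve_axis_reflection[OF \<gamma>(1) s]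
    by (intro exI[of _ "\<lambda>t. ?R (\<gamma> t)"] exI[of _ T]) auto
qed

lemma periodic_reduce:
  fixes \<gamma> :: "real \<Rightarrow> 'a"
  assumes per: "\<And>t. \<gamma> (t + T) = \<gamma> t" and T: "T > 0"
  shows "\<exists>s\<in>{u..u+T}. \<gamma> t = \<gamma> s"
proof -
  have nat: "\<gamma> (t + real n * T) = \<gamma> t" for t n
  proof (induction n)
    case (Suc n)
    have "\<gamma> (t + real (Suc n) * T) = \<gamma> (t + real n * T + T)" by (simp add: algebra_simps)
    then show ?case using Suc per by simp
  qed simp
  have int: "\<gamma> (t + of_int k * T) = \<gamma> t" for t k
  proof (cases "k \<ge> 0")
    case True
    then show ?thesis using nat[of t "nat k"] by simp
  next
    case False
    then show ?thesis using nat[of "t + of_int k * T" "nat (- k)"] by simp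
  qed
  define k where "k = \<lfloor>(t - u) / T\<rfloor>"
  define s where "s = t - of_int k * T"
  have "of_int k \<le> (t - u) / T" "(t - u) / T < of_int k + 1" unfolding k_def by linarith+
  then have "of_int k * T \<le> t - u" "t - u < (of_int k + 1) * T"
    using T by (simp_all add: pos_le_divide_eq pos_divide_less_eq)
  then have "s \<in> {u..u+T}" by (simp add: s_def algebra_simps)
  moreover have "\<gamma> t = \<gamma> s" using int[of s k] by (simp add: s_def)
  ultimately show ?thesis by blast
qed

context lienard
begin

text \<open>A right and a left half-turn with the same ends close up under the truncated flow by
  uniqueness. The closed orbit consists of pieces inside the box, so it is an orbit of the original
  field; it contains \<open>v\<close>, from which \<open>(0, \<beta>)\<close> is reached.\<close>

lemma closing_orbit:
  assumes R: "right_path \<rho> (0, \<alpha>) (0, \<beta>) \<gamma>R TR" and L: "left_path \<rho> (0, \<beta>) (0, \<alpha>) \<gamma>L TL"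
    and \<alpha>\<beta>: "\<alpha> \<noteq> \<beta>" and E: "right_path \<rho> v (0, \<beta>) \<eta> T1"
  shows "periodic_through X v"
proof -
  obtain f Lf B where f: "Lf \<ge> 0" "\<And>u v. norm (f u - f v) \<le> Lf * norm (u - v)" "\<And>v. norm (f v) \<le> B"
    "\<And>v. v \<in> square_box \<rho> \<Longrightarrow> f v = X v"
    by (rule lienard_field_extension[of \<rho> \<phi> F g]) (rule that)
  obtain \<gamma> where \<gamma>: "\<gamma> 0 = (0, \<beta>)" "integral_curve f UNIV \<gamma>"
    using integral_curve_global[OF f(2,3), of "(0, \<beta>)"] by blast
  have fcurve: "integral_curve f {0..S} \<theta>" if "integral_curve X {0..S} \<theta>" "\<And>t. t \<in> {0..S} \<Longrightarrow> \<theta> t \<in> square_box \<rho>" for S \<theta>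
    by (rule integral_curve_cong_field[OF that(1)]) (simp add: that(2) f(4))
  have shift: "integral_curve f S (\<lambda>t. \<gamma> (t + u))" for S u
    by (rule integral_curve_shift[OF \<gamma>(2)]) simp
  have R': "TR > 0" "integral_curve f {0..TR} \<gamma>R" "\<gamma>R 0 = (0, \<alpha>)" "\<gamma>R TR = (0, \<beta>)" "\<And>t. t \<in> {0..TR} \<Longrightarrow> \<gamma>R t \<in> square_box \<rho>"
    using R fcurve[of TR \<gamma>R] unfolding right_path_def by auto
  have L': "TL > 0" "integral_curve f {0..TL} \<gamma>L" "\<gamma>L 0 = (0, \<beta>)" "\<gamma>L TL = (0, \<alpha>)" "\<And>t. t \<in> {0..TL} \<Longrightarrow> \<gamma>L t \<in> square_box \<rho>"
    using L fcurve[of TL \<gamma>L] unfolding left_path_def by auto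
  have E': "T1 > 0" "integral_curve f {0..T1} \<eta>" "\<eta> 0 = v" "\<eta> T1 = (0, \<beta>)"
    using E fcurve[of T1 \<eta>] unfolding right_path_def by auto
  have onL: "\<gamma> t = \<gamma>L t" if "t \<in> {0..TL}" for t
    by (rule lipschitz_curve_unique[OF f(2) integral_curve_subset[OF \<gamma>(2)] L'(2), of 0]) (use that L' \<gamma>(1) in auto)
  have onR: "\<gamma> (t + - TR) = \<gamma>R t" if "t \<in> {0..TR}" for t
    by (rule lipschitz_curve_unique[OF f(2) shift R'(2), of TR]) (use that R' \<gamma>(1) in auto)
  have onE: "\<gamma> (t + - T1) = \<eta> t" if "t \<in> {0..T1}" for t
    by (rule lipschitz_curve_unique[OF f(2) shift E'(2), of T1]) (use that E' \<gamma>(1) in auto)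
  define T where "T = TL + TR"
  have T: "T > 0" using L' R' by (simp add: T_def)
  have \<gamma>TL: "\<gamma> TL = (0, \<alpha>)" using onL[of TL] L' by simp
  have \<gamma>TR: "\<gamma> (- TR) = (0, \<alpha>)" using onR[of 0] R' by simp
  have per: "\<gamma> (t + T) = \<gamma> t" for t
    by (rule lipschitz_curve_unique[OF f(2) shift integral_curve_subset[OF \<gamma>(2)],
          where s = "- TR" and a = "min t (- TR)" and b = "max t (- TR)"])
      (auto simp: T_def \<gamma>TL \<gamma>TR)
  have box: "\<gamma> t \<in> square_box \<rho>" for t
  proof -
    obtain s where s: "s \<in> {- TR..- TR + T}" "\<gamma> t = \<gamma> s" using periodic_reduce[of \<gamma> T "- TR" t] per T by blast
    show ?thesis
    proof (cases "s \<ge> 0")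
      case True
      then show ?thesis using s onL[of s] L'(5)[of s] by (simp add: T_def)
    next
      case False
      then show ?thesis using s onR[of "s + TR"] R'(5)[of "s + TR"] by simp
    qed
  qed
  have curve: "integral_curve X UNIV \<gamma>"
    by (rule integral_curve_cong_field[OF \<gamma>(2)]) (simp add: box f(4))
  show ?thesis
    unfolding periodic_through_def
  proof (intro exI conjI allI)
    show "integral_curve X UNIV (\<lambda>t. \<gamma> (t + - T1))" by (rule integral_curve_shift[OF curve]) simp
    show "\<gamma> (0 + - T1) = v" using onE[of 0] E' by simp
    show "T > 0" by (rule T)
    show "\<gamma> (t + T + - T1) = \<gamma> (t + - T1)" for t using per[of "t + - T1"] by (simp add: algebra_simps)
    \<comment> \<open>At time \<open>T1\<close> the orbit is at \<open>(0, \<beta>)\<close>; if that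
      is \<open>v\<close> itself, the other end \<open>(0, \<alpha>)\<close> serves.\<close>
    show "\<gamma> ((if v = (0, \<beta>) then T1 + TL else T1) + - T1) \<noteq> v"
      using \<gamma>TL \<gamma>(1) \<alpha>\<beta> by auto
  qed
qed

lemma right_path_mono: "right_path \<rho> v w \<gamma> T \<Longrightarrow> \<rho> \<le> \<rho>' \<Longrightarrow> right_path \<rho>' v w \<gamma> T"
  unfolding right_path_def using square_box_mono by blast

text \<open>Two scales are needed: orbits confined to a smaller box meet the axis at a height
  \<open>\<beta>\<close> below \<open>\<epsilon>1\<close>, and only for such heights are half-turns
  inside the larger box guaranteed.\<close>

lemma nested_paths:
  assumes M: "monodromy_condition" and \<rho>1: "\<rho>1 > 0"
  obtains \<rho> \<epsilon> where "0 < \<rho>" "\<rho> \<le> \<rho>1" "\<epsilon> > 0" "section_radius \<rho>"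
    "lienard.good_radius (- reflect_poly_arg \<phi>) (- reflect_poly_arg g) (- ((-1) ^ r * c)) \<rho>"
    "\<And>v. norm v < \<epsilon> \<Longrightarrow> fst v > 0 \<or> (fst v = 0 \<and> snd v < 0) \<Longrightarrow>
      \<exists>\<beta> \<alpha>1 \<alpha>2 \<eta> T1 \<gamma>R TR \<gamma>L TL. \<beta> > 0 \<and> \<beta> \<le> \<rho> \<and> \<alpha>1 < 0 \<and> \<alpha>2 < 0 \<and> right_path \<rho> v (0, \<beta>) \<eta> T1 \<and>
        right_path \<rho> (0, \<alpha>1) (0, \<beta>) \<gamma>R TR \<and> left_path \<rho> (0, \<beta>) (0, \<alpha>2) \<gamma>L TL"
proof -
  interpret pr: lienard "- reflect_poly_arg \<phi>" "- reflect_poly_arg F" "- reflect_poly_arg g" p q r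
    "- ((-1) ^ p * a)" "- ((-1) ^ q * b)" "- ((-1) ^ r * c)"
    by (rule point_reflection_lienard)
  obtain \<rho>p where \<rho>p: "\<And>\<rho>. 0 < \<rho> \<Longrightarrow> \<rho> \<le> \<rho>p \<Longrightarrow> pr.good_radius \<rho>" "\<rho>p > 0"
    by (rule pr.good_radius_ex) (rule that)
  obtain \<rho>0 where \<rho>0: "\<rho>0 > 0" "\<And>\<rho>. 0 < \<rho> \<Longrightarrow> \<rho> \<le> \<rho>0 \<Longrightarrow> section_radius \<rho> \<and> (\<exists>\<epsilon>>0.
     (\<forall>v. norm v < \<epsilon> \<longrightarrow> fst v > 0 \<or> (fst v = 0 \<and> snd v < 0) \<longrightarrow> (\<exists>\<gamma> T y. y > 0 \<and> right_path \<rho> v (0, y) \<gamma> T)) \<and>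
     (\<forall>y. 0 < y \<and> y < \<epsilon> \<longrightarrow> (\<exists>\<gamma> T y'. y' < 0 \<and> right_path \<rho> (0, y') (0, y) \<gamma> T)) \<and>
     (\<forall>y. 0 < y \<and> y < \<epsilon> \<longrightarrow> (\<exists>\<gamma> T y'. y' < 0 \<and> left_path \<rho> (0, y) (0, y') \<gamma> T)))"
    by (rule paths_ex[OF M]) (rule that)
  define \<rho> where "\<rho> = min \<rho>1 (min \<rho>p \<rho>0)"
  have \<rho>: "0 < \<rho>" "\<rho> \<le> \<rho>1" "\<rho> \<le> \<rho>p" "\<rho> \<le> \<rho>0" using \<rho>1 \<rho>p \<rho>0 by (auto simp: \<rho>_def)
  obtain \<epsilon>1 where e1: "\<epsilon>1 > 0"
    "\<And>y. 0 < y \<Longrightarrow> y < \<epsilon>1 \<Longrightarrow> \<exists>\<gamma> T y'. y' < 0 \<and> right_path \<rho> (0, y') (0, y) \<gamma> T"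
    "\<And>y. 0 < y \<Longrightarrow> y < \<epsilon>1 \<Longrightarrow> \<exists>\<gamma> T y'. y' < 0 \<and> left_path \<rho> (0, y) (0, y') \<gamma> T"
    using \<rho>0(2)[OF \<rho>(1,4)] by blast
  define \<rho>' where "\<rho>' = min \<rho> (\<epsilon>1 / 2)"
  have \<rho>': "0 < \<rho>'" "\<rho>' \<le> \<rho>" "\<rho>' < \<epsilon>1" using \<rho> e1(1) by (auto simp: \<rho>'_def)
  then have "\<rho>' \<le> \<rho>0" using \<rho> by simp
  from \<rho>0(2)[OF \<rho>'(1) this] obtain \<epsilon> where e: "\<epsilon> > 0"
    "\<And>v. norm v < \<epsilon> \<Longrightarrow> fst v > 0 \<or> (fst v = 0 \<and> snd v < 0) \<Longrightarrow> \<exists>\<gamma> T y. y > 0 \<and> right_path \<rho>' v (0, y) \<gamma> T"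
    by blast
  show thesis
  proof (rule that[OF \<rho>(1,2) e(1)])
    show "section_radius \<rho>" using \<rho>0(2)[OF \<rho>(1,4)] by blast
    show "pr.good_radius \<rho>" by (rule \<rho>p(1)[OF \<rho>(1,3)])
    fix v :: "real \<times> real" assume v: "norm v < \<epsilon>" "fst v > 0 \<or> (fst v = 0 \<and> snd v < 0)"
    obtain \<eta> T1 \<beta> where E: "\<beta> > 0" "right_path \<rho>' v (0, \<beta>) \<eta> T1" using e(2)[OF v] by blast
    have "T1 > 0" "\<forall>t\<in>{0..T1}. \<eta> t \<in> square_box \<rho>'" "\<eta> T1 = (0, \<beta>)" using E(2) by (simp_all add: right_path_def)
    then have "(0, \<beta>) \<in> square_box \<rho>'" by (metis atLeastAtMost_iff less_imp_le order_refl)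
    then have \<beta>: "\<beta> \<le> \<rho>'" by (simp add: square_box_def abs_le_iff)
    then have "\<beta> < \<epsilon>1" using \<rho>' by simp
    obtain \<gamma>R TR \<alpha>1 where R: "\<alpha>1 < 0" "right_path \<rho> (0, \<alpha>1) (0, \<beta>) \<gamma>R TR" using e1(2)[OF E(1) \<open>\<beta> < \<epsilon>1\<close>] by blast
    obtain \<gamma>L TL \<alpha>2 where L: "\<alpha>2 < 0" "left_path \<rho> (0, \<beta>) (0, \<alpha>2) \<gamma>L TL" using e1(3)[OF E(1) \<open>\<beta> < \<epsilon>1\<close>] by blast
    have "right_path \<rho> v (0, \<beta>) \<eta> T1" by (rule right_path_mono[OF E(2) \<rho>'(2)])
    with E(1) \<beta> \<rho>'(2) R L show "\<exists>\<beta> \<alpha>1 \<alpha>2 \<eta> T1 \<gamma>R TR \<gamma>L TL. \<beta> > 0 \<and> \<beta> \<le> \<rho> \<and> \<alpha>1 < 0 \<and> \<alpha>2 < 0 \<and> right_path \<rho> v (0, \<beta>) \<eta> T1 \<and>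
        right_path \<rho> (0, \<alpha>1) (0, \<beta>) \<gamma>R TR \<and> left_path \<rho> (0, \<beta>) (0, \<alpha>2) \<gamma>L TL"
      by (meson order_trans)
  qed
qed

lemma section_signs:
  assumes "section_radius \<rho>"
  shows "0 < y \<Longrightarrow> y \<le> \<rho> \<Longrightarrow> poly \<phi> y < 0" "y < 0 \<Longrightarrow> - \<rho> \<le> y \<Longrightarrow> poly \<phi> y > 0"
proof -
  have *: "y * poly \<phi> y < 0" if "y \<noteq> 0" "\<bar>y\<bar> \<le> \<rho>" using assms that by (simp add: section_radius_def)
  show "0 < y \<Longrightarrow> y \<le> \<rho> \<Longrightarrow> poly \<phi> y < 0" "y < 0 \<Longrightarrow> - \<rho> \<le> y \<Longrightarrow> poly \<phi> y > 0"
    using * by (auto simp: mult_less_0_iff)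
qed

lemma periodic_right:
  assumes M: "monodromy_condition" and lev: "level_data \<Gamma> \<delta>" and \<rho>1: "0 < \<rho>1" "\<rho>1 < \<delta>"
    and partner: "\<And>z. z \<noteq> 0 \<Longrightarrow> \<bar>z\<bar> \<le> \<rho>1 \<Longrightarrow> \<exists>x. x * z < 0 \<and> \<bar>x\<bar> < \<delta> \<and> \<Gamma> x = \<Gamma> z"
    and FF: "\<And>x z. 0 < x \<Longrightarrow> x < \<delta> \<Longrightarrow> - \<delta> < z \<Longrightarrow> z < 0 \<Longrightarrow> \<Gamma> x = \<Gamma> z \<Longrightarrow> poly F x = poly F z"
  obtains \<epsilon> where "\<epsilon> > 0" "\<And>v. norm v < \<epsilon> \<Longrightarrow> fst v > 0 \<or> (fst v = 0 \<and> snd v < 0) \<Longrightarrow> periodic_through X v"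
proof -
  have c: "c < 0" using M by (simp add: monodromy_condition_def)
  obtain \<rho> \<epsilon> where \<rho>: "0 < \<rho>" "\<rho> \<le> \<rho>1" "\<epsilon> > 0" "section_radius \<rho>"
    "lienard.good_radius (- reflect_poly_arg \<phi>) (- reflect_poly_arg g) (- ((-1) ^ r * c)) \<rho>"
    "\<And>v. norm v < \<epsilon> \<Longrightarrow> fst v > 0 \<or> (fst v = 0 \<and> snd v < 0) \<Longrightarrow>
      \<exists>\<beta> \<alpha>1 \<alpha>2 \<eta> T1 \<gamma>R TR \<gamma>L TL. \<beta> > 0 \<and> \<beta> \<le> \<rho> \<and> \<alpha>1 < 0 \<and> \<alpha>2 < 0 \<and> right_path \<rho> v (0, \<beta>) \<eta> T1 \<and>
        right_path \<rho> (0, \<alpha>1) (0, \<beta>) \<gamma>R TR \<and> left_path \<rho> (0, \<beta>) (0, \<alpha>2) \<gamma>L TL"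
    by (rule nested_paths[OF M \<rho>1(1)]) (rule that)
  have good: "good_radius \<rho>" using \<rho>(4) by (simp add: section_radius_def)
  show thesis
  proof (rule that[OF \<rho>(3)])
    fix v :: "real \<times> real" assume v: "norm v < \<epsilon>" "fst v > 0 \<or> (fst v = 0 \<and> snd v < 0)"
    from \<rho>(6)[OF v] obtain \<beta> \<alpha>1 \<alpha>2 \<eta> T1 \<gamma>R TR \<gamma>L TL where
      P: "\<beta> > 0" "\<beta> \<le> \<rho>" "\<alpha>1 < 0" "\<alpha>2 < 0" "right_path \<rho> v (0, \<beta>) \<eta> T1"
        "right_path \<rho> (0, \<alpha>1) (0, \<beta>) \<gamma>R TR" "left_path \<rho> (0, \<beta>) (0, \<alpha>2) \<gamma>L TL" by blast
    obtain x1 where b1: "branch \<rho> 1 \<alpha>1 \<beta> x1" by (rule right_path_branch[OF c good P(6)])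
    obtain x2 where b2: "branch \<rho> (-1) \<alpha>2 \<beta> x2" by (rule left_path_branch[OF M \<rho>(5) P(7)])
    have "\<alpha>1 = \<alpha>2"
    proof (rule branch_ends_equal[OF lev _ _ _ _ b1 b2])
      show "\<rho> < \<delta>" using \<rho> \<rho>1 by simp
      show "poly \<phi> \<beta> < 0" by (rule section_signs(1)[OF \<rho>(4) P(1,2)])
      show "\<exists>x. x * z < 0 \<and> \<bar>x\<bar> < \<delta> \<and> \<Gamma> x = \<Gamma> z" if "z \<noteq> 0" "\<bar>z\<bar> \<le> \<rho>" for z
        by (rule partner) (use that \<rho> in auto)
      show "poly F x = poly F z" if "0 < x" "x < \<delta>" "- \<delta> < z" "z < 0" "\<Gamma> x = \<Gamma> z" for x z by (rule FF[OF that])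
    qed
    then show "periodic_through X v" using closing_orbit[OF P(6) _ _ P(5)] P by auto
  qed
qed

text \<open>A periodic orbit meets a segment of the negative \<open>y\<close>-axis in a compact set;
  let \<open>m\<close> be its highest point there. Following the orbit through one turn from
  \<open>m\<close> gives another point \<open>\<alpha>2\<close> of it, strictly between
  \<open>m\<close> and \<open>0\<close> because \<open>F\<close> is larger on the right. This
  contradicts the choice of \<open>m\<close>.\<close>

lemma not_center:
  assumes M: "monodromy_condition" and lev: "level_data \<Gamma> \<delta>" and \<rho>1: "0 < \<rho>1" "\<rho>1 < \<delta>"
    and partner: "\<And>z. z \<noteq> 0 \<Longrightarrow> \<bar>z\<bar> \<le> \<rho>1 \<Longrightarrow> \<exists>x. x * z < 0 \<and> \<bar>x\<bar> < \<delta> \<and> \<Gamma> x = \<Gamma> z"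
    and FF: "\<And>x z. 0 < x \<Longrightarrow> x < \<delta> \<Longrightarrow> - \<delta> < z \<Longrightarrow> z < 0 \<Longrightarrow> \<Gamma> x = \<Gamma> z \<Longrightarrow> poly F z < poly F x"
  shows "\<not> center X (0, 0)"
proof
  assume "center X (0, 0)"
  then obtain \<epsilon>c where ec: "\<epsilon>c > 0" "\<And>v. v \<in> ball (0, 0) \<epsilon>c - {(0, 0)} \<Longrightarrow> periodic_through X v"
    by (auto simp: center_iff_periodic)
  have c: "c < 0" using M by (simp add: monodromy_condition_def)
  obtain \<rho> \<epsilon> where \<rho>: "0 < \<rho>" "\<rho> \<le> \<rho>1" "\<epsilon> > 0" "section_radius \<rho>"
    "lienard.good_radius (- reflect_poly_arg \<phi>) (- reflect_poly_arg g) (- ((-1) ^ r * c)) \<rho>"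
    "\<And>v. norm v < \<epsilon> \<Longrightarrow> fst v > 0 \<or> (fst v = 0 \<and> snd v < 0) \<Longrightarrow>
      \<exists>\<beta> \<alpha>1 \<alpha>2 \<eta> T1 \<gamma>R TR \<gamma>L TL. \<beta> > 0 \<and> \<beta> \<le> \<rho> \<and> \<alpha>1 < 0 \<and> \<alpha>2 < 0 \<and> right_path \<rho> v (0, \<beta>) \<eta> T1 \<and>
        right_path \<rho> (0, \<alpha>1) (0, \<beta>) \<gamma>R TR \<and> left_path \<rho> (0, \<beta>) (0, \<alpha>2) \<gamma>L TL"
    by (rule nested_paths[OF M \<rho>1(1)]) (rule that)
  have good: "good_radius \<rho>" using \<rho>(4) by (simp add: section_radius_def)
  define y0 where "y0 = min \<epsilon> \<epsilon>c / 2"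
  have y0: "0 < y0" "y0 < \<epsilon>" "y0 < \<epsilon>c" using \<rho>(3) ec(1) by (auto simp: y0_def)
  have "(0, - y0) \<in> ball (0, 0) \<epsilon>c - {(0, 0)}" using y0 by (simp add: dist_Pair_Pair)
  from ec(2)[OF this] obtain \<gamma> T where \<gamma>: "integral_curve X UNIV \<gamma>" "\<gamma> 0 = (0, - y0)" "T > 0" "\<And>t. \<gamma> (t + T) = \<gamma> t"
    by (auto simp: periodic_through_def)
  have nz: "\<gamma> t \<noteq> (0, 0)" for t
    by (rule curve_nonzero[OF \<gamma>(1), of 0]) (use \<gamma>(2) y0 in auto)
  have cont: "continuous_on S \<gamma>" for S
    using integral_curve_continuous[OF \<gamma>(1)] continuous_on_subset by blast
  have "compact (\<gamma> ` {0..T})" by (intro compact_continuous_image cont compact_Icc)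
  moreover have "range \<gamma> = \<gamma> ` {0..T}"
  proof
    show "range \<gamma> \<subseteq> \<gamma> ` {0..T}"
    proof
      fix v assume "v \<in> range \<gamma>"
      then obtain t where "v = \<gamma> t" by blast
      then show "v \<in> \<gamma> ` {0..T}" using periodic_reduce[of \<gamma> T 0 t] \<gamma>(3,4) by auto
    qed
  qed auto
  ultimately have closed: "closed (range \<gamma>)" by (simp add: compact_imp_closed)
  define S where "S = {- y0..0} \<inter> (\<lambda>y. (0, y)) -` range \<gamma>"
  have "closed ((\<lambda>y::real. (0::real, y)) -` range \<gamma>)"
    by (rule closed_vimage[OF closed]) (intro continuous_intros)
  then have "compact S" unfolding S_def by (intro compact_Int_closed compact_Icc)
  moreover have "- y0 \<in> S" using \<gamma>(2) y0 by (auto simp: S_def intro: range_eqI[of _ _ 0])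
  ultimately obtain m where m: "m \<in> S" "\<And>y. y \<in> S \<Longrightarrow> y \<le> m"
    using compact_attains_sup[of S] by (metis empty_iff)
  obtain t0 where t0: "\<gamma> t0 = (0, m)" using m(1) by (auto simp: S_def)
  have m0: "- y0 \<le> m" "m < 0" using m(1) nz[of t0] t0 by (auto simp: S_def le_less)
  have "norm (0::real, m) < \<epsilon>" using m0 y0 by (simp add: norm_prod_def)
  from \<rho>(6)[OF this] m0 obtain \<beta> \<alpha>2 \<eta> T1 \<gamma>L TL where
    P: "\<beta> > 0" "\<beta> \<le> \<rho>" "\<alpha>2 < 0" "right_path \<rho> (0, m) (0, \<beta>) \<eta> T1" "left_path \<rho> (0, \<beta>) (0, \<alpha>2) \<gamma>L TL"
    by auto
  have shift: "integral_curve X U (\<lambda>t. \<gamma> (t + u))" for U u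
    by (rule integral_curve_shift[OF \<gamma>(1)]) simp
  have T1: "T1 > 0" "integral_curve X {0..T1} \<eta>" "\<eta> 0 = (0, m)" "\<eta> T1 = (0, \<beta>)"
    and TL: "TL > 0" "integral_curve X {0..TL} \<gamma>L" "\<gamma>L 0 = (0, \<beta>)" "\<gamma>L TL = (0, \<alpha>2)"
    using P by (auto simp: right_path_def left_path_def)
  have box: "\<eta> 0 \<in> square_box \<rho>"
    using P(4) unfolding right_path_def by (metis atLeastAtMost_iff less_imp_le order_refl)
  have "\<eta> 0 = \<gamma> (0 + t0)" using T1(3) t0 by simp
  from lienard_unique[OF T1(2) shift _ this, of T1] T1(1) have "\<eta> T1 = \<gamma> (T1 + t0)" by simp
  then have "\<gamma>L 0 = \<gamma> (0 + (T1 + t0))" using T1(4) TL(3) by simp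
  from lienard_unique[OF TL(2) shift _ this, of TL] TL(1) have "\<gamma>L TL = \<gamma> (TL + (T1 + t0))" by simp
  then have hit: "\<gamma> (TL + (T1 + t0)) = (0, \<alpha>2)" using TL by simp
  obtain x1 where b1: "branch \<rho> 1 m \<beta> x1" by (rule right_path_branch[OF c good P(4)])
  obtain x2 where b2: "branch \<rho> (-1) \<alpha>2 \<beta> x2" by (rule left_path_branch[OF M \<rho>(5) P(5)])
  have \<rho>\<delta>: "\<rho> < \<delta>" using \<rho> \<rho>1 by simp
  have \<phi>\<beta>: "poly \<phi> \<beta> < 0" by (rule section_signs(1)[OF \<rho>(4) P(1,2)])
  have partner': "\<exists>x. x * z < 0 \<and> \<bar>x\<bar> < \<delta> \<and> \<Gamma> x = \<Gamma> z" if "z \<noteq> 0" "\<bar>z\<bar> \<le> \<rho>" for z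
    by (rule partner) (use that \<rho> in auto)
  have "m \<le> \<alpha>2"
    by (rule branch_ends[OF lev \<rho>\<delta> \<phi>\<beta> partner' _ b1 b2]) (auto intro: less_imp_le FF)
  moreover have "m \<noteq> \<alpha>2"
  proof
    assume "m = \<alpha>2"
    then have b2': "branch \<rho> (-1) m \<beta> x2" using b2 by simp
    have "poly \<phi> m > 0" by (rule section_signs(2)[OF \<rho>(4)]) (use m0 box T1(3) in \<open>auto simp: square_box_def\<close>)
    then show False by (rule branch_ends_distinct[OF lev \<rho>\<delta> \<phi>\<beta> _ partner' FF b1 b2'])
  qed
  moreover have "\<alpha>2 \<in> S"
    using hit P(3) m0 \<open>m \<le> \<alpha>2\<close> by (auto simp: S_def intro: range_eqI[of _ _ "TL + (T1 + t0)"])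
  ultimately show False using m(2)[of \<alpha>2] by simp
qed

section \<open>Uniqueness of level partners and transport of centers\<close>

lemma level_data_inj:
  assumes lev: "level_data \<Gamma> \<delta>" and x: "\<bar>x\<bar> < \<delta>" "\<bar>y\<bar> < \<delta>" "x * y > 0" and eq: "\<Gamma> x = \<Gamma> y"
  shows "x = y"
proof -
  have ne: False if uv: "u < v" "\<bar>u\<bar> < \<delta>" "\<bar>v\<bar> < \<delta>" "u * v > 0" "\<Gamma> u = \<Gamma> v" for u v
  proof -
    have "\<exists>z. u < z \<and> z < v \<and> \<Gamma> v - \<Gamma> u = (v - u) * (- poly g z)"
      by (rule MVT2[OF uv(1)]) (use lev in \<open>simp add: level_data_def\<close>)
    then obtain z where z: "u < z" "z < v" "poly g z = 0" using uv by auto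
    have "z \<noteq> 0" "\<bar>z\<bar> < \<delta>" using z uv by (auto simp: zero_less_mult_iff)
    then show False using level_data_g[OF lev, of z] z by simp
  qed
  show ?thesis
    using ne[of x y] ne[of y x] x eq by (cases x y rule: linorder_cases) (auto simp: mult.commute)
qed

lemma center_reflections:
  shows "center X (0, 0) \<Longrightarrow> center (lienard_field (- reflect_poly_arg \<phi>) (- F) g) (0, 0)"
    and "periodic_through (lienard_field (- reflect_poly_arg \<phi>) (- reflect_poly_arg F) (- reflect_poly_arg g)) v \<Longrightarrow>
      periodic_through X (axis_reflection (-1) (-1) v)"
proof -
  assume "center X (0, 0)"
  then obtain \<epsilon> where e: "\<epsilon> > 0" "\<And>v. v \<in> ball (0, 0) \<epsilon> - {(0, 0)} \<Longrightarrow> periodic_through X v"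
    by (auto simp: center_iff_periodic)
  interpret tr: lienard "- reflect_poly_arg \<phi>" "- F" g p q r "- ((-1) ^ p * a)" "- b" c
    by (rule time_reflection_lienard)
  have "periodic_through tr.X v" if v: "v \<in> ball (0, 0) \<epsilon> - {(0, 0)}" for v
  proof -
    obtain x y where xy: "v = (x, y)" by (cases v)
    have "(x, - y) \<in> ball (0, 0) \<epsilon> - {(0, 0)}" using v by (auto simp: xy dist_Pair_Pair dist_real_def)
    then have "periodic_through X (x, - y)" by (rule e(2))
    from periodic_through_axis_reflection[OF periodic_through_reverse[OF this], of 1 "-1"]
    show ?thesis by (simp add: lienard_field_time_reflection xy) (simp add: axis_reflection_def)
  qed
  moreover have "tr.X (0, 0) = 0" using tr.X_zero by (simp add: zero_prod_def)
  ultimately show "center tr.X (0, 0)" unfolding center_iff_periodic using e(1) by blast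
next
  assume "periodic_through (lienard_field (- reflect_poly_arg \<phi>) (- reflect_poly_arg F) (- reflect_poly_arg g)) v"
  from periodic_through_axis_reflection[OF this, of "-1" "-1"]
  show "periodic_through X (axis_reflection (-1) (-1) v)"
    by (simp add: lienard_field_point_reflection pcompose_reflect_minus pcompose_reflect_twice)
qed

lemma center_if_equal:
  assumes M: "monodromy_condition" and lev: "level_data \<Gamma> \<delta>" and \<rho>1: "0 < \<rho>1" "\<rho>1 < \<delta>"
    and partner: "\<And>z. z \<noteq> 0 \<Longrightarrow> \<bar>z\<bar> \<le> \<rho>1 \<Longrightarrow> \<exists>x. x * z < 0 \<and> \<bar>x\<bar> < \<delta> \<and> \<Gamma> x = \<Gamma> z"
    and FF: "\<And>x z. 0 < x \<Longrightarrow> x < \<delta> \<Longrightarrow> - \<delta> < z \<Longrightarrow> z < 0 \<Longrightarrow> \<Gamma> x = \<Gamma> z \<Longrightarrow> poly F x = poly F z"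
  shows "center X (0, 0)"
proof -
  interpret pr: lienard "- reflect_poly_arg \<phi>" "- reflect_poly_arg F" "- reflect_poly_arg g" p q r
    "- ((-1) ^ p * a)" "- ((-1) ^ q * b)" "- ((-1) ^ r * c)"
    by (rule point_reflection_lienard)
  obtain \<epsilon>1 where e1: "\<epsilon>1 > 0" "\<And>v. norm v < \<epsilon>1 \<Longrightarrow> fst v > 0 \<or> (fst v = 0 \<and> snd v < 0) \<Longrightarrow> periodic_through X v"
    by (rule periodic_right[OF M lev \<rho>1 partner FF]) (assumption | rule that; assumption)+
  have partner': "\<exists>x. x * z < 0 \<and> \<bar>x\<bar> < \<delta> \<and> \<Gamma> (- x) = \<Gamma> (- z)" if "z \<noteq> 0" "\<bar>z\<bar> \<le> \<rho>1" for z
  proof -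
    obtain x where "x * (- z) < 0" "\<bar>x\<bar> < \<delta>" "\<Gamma> x = \<Gamma> (- z)" using partner[of "- z"] \<open>z \<noteq> 0\<close> \<open>\<bar>z\<bar> \<le> \<rho>1\<close> by auto
    then show ?thesis by (intro exI[of _ "- x"]) auto
  qed
  have FF': "poly (- reflect_poly_arg F) x = poly (- reflect_poly_arg F) z"
    if "0 < x" "x < \<delta>" "- \<delta> < z" "z < 0" "\<Gamma> (- x) = \<Gamma> (- z)" for x z
    using FF[of "- z" "- x"] that by (simp add: poly_pcompose)
  obtain \<epsilon>2 where e2: "\<epsilon>2 > 0" "\<And>v. norm v < \<epsilon>2 \<Longrightarrow> fst v > 0 \<or> (fst v = 0 \<and> snd v < 0) \<Longrightarrow> periodic_through pr.X v"
    by (rule pr.periodic_right[OF monodromy_point_reflection[OF M] level_data_reflect[OF lev] \<rho>1 partner' FF'])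
      (assumption | rule that; assumption)+
  have "periodic_through X v" if v: "v \<in> ball (0, 0) (min \<epsilon>1 \<epsilon>2) - {(0, 0)}" for v
  proof -
    have n: "norm v < \<epsilon>1" "norm v < \<epsilon>2" "v \<noteq> (0, 0)" using v by (auto simp: dist_norm norm_minus_commute simp flip: zero_prod_def)
    show ?thesis
    proof (cases "fst v > 0 \<or> (fst v = 0 \<and> snd v < 0)")
      case True
      then show ?thesis using e1(2) n by blast
    next
      case False
      let ?w = "axis_reflection (-1) (-1) v"
      have "norm ?w = norm v" by (simp add: axis_reflection_def norm_prod_def)
      moreover have "fst ?w > 0 \<or> (fst ?w = 0 \<and> snd ?w < 0)"
        using False n(3) by (cases v) (auto simp: axis_reflection_def)
      ultimately have "periodic_through pr.X ?w" using e2(2) n by simp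
      from center_reflections(2)[OF this] show ?thesis by (simp add: axis_reflection_def)
    qed
  qed
  moreover have "X (0, 0) = 0" using X_zero by (simp add: zero_prod_def)
  moreover have "min \<epsilon>1 \<epsilon>2 > 0" using e1(1) e2(1) by simp
  ultimately show ?thesis unfolding center_iff_periodic by blast
qed

text \<open>Differentiability is known at \<open>0\<close> only, but a negative derivative there
  already puts \<open>z x\<close> on the side opposite to \<open>x\<close>, and continuity at
  \<open>0\<close> keeps it small.\<close>

lemma decreasing_solution_sides:
  assumes z: "decreasing_solution f G z" and \<delta>: "\<delta> > 0"
  shows "\<exists>e>0. \<forall>x. x \<noteq> 0 \<and> \<bar>x\<bar> < e \<longrightarrow> x * z x < 0 \<and> \<bar>z x\<bar> < \<delta> \<and> f x = f (z x) \<and> G x = G (z x)"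
proof -
  obtain d where d: "d < 0" "(z has_real_derivative d) (at 0)" and z0: "z 0 = 0"
    and ev: "\<forall>\<^sub>F x in nhds 0. f x = f (z x) \<and> G x = G (z x)"
    using z by (auto simp: decreasing_solution_def)
  obtain e1 where e1: "e1 > 0" "\<And>x. dist x 0 < e1 \<Longrightarrow> f x = f (z x) \<and> G x = G (z x)"
    using ev unfolding eventually_nhds_metric by blast
  obtain e2 where e2: "e2 > 0" "\<And>h. 0 < h \<Longrightarrow> h < e2 \<Longrightarrow> z (0 + h) < z 0"
    using DERIV_neg_dec_right[OF d(2,1)] by blast
  obtain e3 where e3: "e3 > 0" "\<And>h. 0 < h \<Longrightarrow> h < e3 \<Longrightarrow> z 0 < z (0 - h)"
    using DERIV_neg_dec_left[OF d(2,1)] by blast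
  obtain e4 where e4: "e4 > 0" "\<And>x. \<bar>x\<bar> < e4 \<Longrightarrow> \<bar>z x\<bar> < \<delta>"
    using DERIV_isCont[OF d(2)] \<delta> z0 unfolding continuous_at_eps_delta by (force simp: dist_real_def)
  define e where "e = min (min e1 e2) (min e3 e4)"
  have e: "e > 0" "e \<le> e1" "e \<le> e2" "e \<le> e3" "e \<le> e4" using e1 e2 e3 e4 by (auto simp: e_def)
  have "x * z x < 0 \<and> \<bar>z x\<bar> < \<delta> \<and> f x = f (z x) \<and> G x = G (z x)" if x: "x \<noteq> 0" "\<bar>x\<bar> < e" for x
  proof (intro conjI)
    show "x * z x < 0"
    proof (cases "x > 0")
      case True
      then have "z x < 0" using e2(2)[of x] x e z0 by simp
      with True show ?thesis by (simp add: mult_pos_neg)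
    next
      case False
      then have "z x > 0" using e3(2)[of "- x"] x e z0 by simp
      with False x(1) show ?thesis by (simp add: mult_neg_pos)
    qed
    show "\<bar>z x\<bar> < \<delta>" using e4(2) x e by simp
    show "f x = f (z x)" "G x = G (z x)" using e1(2)[of x] x e by (auto simp: dist_real_def)
  qed
  with e(1) show ?thesis by blast
qed

text \<open>Everything hangs on the three alternatives for \<open>F\<close> on level pairs: equality
  gives a center and makes the level involution \<open>\<sigma>\<close> a solution, while either
  strict inequality excludes both a center and a solution.\<close>

lemma center_iff_unique_solution:
  assumes M: "monodromy_condition" and G: "\<And>x. DERIV G x :> poly g x" "G 0 = 0"
  shows "center X (0, 0) \<longleftrightarrow> unique_decreasing_solution (poly F) G"
proof -
  have c: "c < 0" and r: "odd r" using M by (auto simp: monodromy_condition_def)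
  obtain Q where Q: "\<And>x. DERIV (\<lambda>x. x ^ (r + 1) * poly Q x) x :> - poly g x" "poly Q 0 = - c / (real r + 1)"
    by (rule antiderivative) (rule that)
  define \<Gamma> where "\<Gamma> x = x ^ (r + 1) * poly Q x" for x
  have G\<Gamma>: "G x = - \<Gamma> x" for x
  proof -
    have "DERIV (\<lambda>x. G x + \<Gamma> x) x :> poly g x + - poly g x" for x
      unfolding \<Gamma>_def by (intro DERIV_add G(1) Q(1))
    then have "G x + \<Gamma> x = G 0 + \<Gamma> 0" by (intro DERIV_isconst_all) simp
    then show ?thesis using G(2) by (simp add: \<Gamma>_def)
  qed
  have Gamma: "DERIV \<Gamma> x :> - poly g x" for x using Q(1) by (simp add: \<Gamma>_def[abs_def])
  obtain \<delta>0 where \<delta>0: "\<delta>0 > 0" "\<And>\<delta>. 0 < \<delta> \<Longrightarrow> \<delta> \<le> \<delta>0 \<Longrightarrow> level_data \<Gamma> \<delta>"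
    by (rule level_data_ex[OF c r Gamma]) (rule that)
  have "even (r + 1)" "r + 1 \<ge> 1" using r by auto
  moreover have "poly Q 0 > 0" unfolding Q(2) using c by (intro divide_pos_pos) auto
  ultimately obtain \<sigma> \<delta>1 where \<sigma>: "\<delta>1 > 0" "\<sigma> 0 = 0" "(\<sigma> has_real_derivative -1) (at 0)"
    "\<And>x. x \<noteq> 0 \<Longrightarrow> \<bar>x\<bar> < \<delta>1 \<Longrightarrow> x * \<sigma> x < 0 \<and> \<Gamma> (\<sigma> x) = \<Gamma> x"
    and tri: "(\<forall>x z. 0 < x \<and> x < \<delta>1 \<and> - \<delta>1 < z \<and> z < 0 \<and> \<Gamma> x = \<Gamma> z \<longrightarrow> poly F x = poly F z) \<or>
     (\<forall>x z. 0 < x \<and> x < \<delta>1 \<and> - \<delta>1 < z \<and> z < 0 \<and> \<Gamma> x = \<Gamma> z \<longrightarrow> poly F x > poly F z) \<or>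
     (\<forall>x z. 0 < x \<and> x < \<delta>1 \<and> - \<delta>1 < z \<and> z < 0 \<and> \<Gamma> x = \<Gamma> z \<longrightarrow> poly F x < poly F z)"
    by (rule even_order_level_pairs[of "r + 1" Q F, folded \<Gamma>_def]) (rule that)
  define \<delta> where "\<delta> = min \<delta>0 \<delta>1"
  have \<delta>: "\<delta> > 0" "\<delta> \<le> \<delta>0" "\<delta> \<le> \<delta>1" using \<delta>0(1) \<sigma>(1) by (auto simp: \<delta>_def)
  have lev: "level_data \<Gamma> \<delta>" by (rule \<delta>0(2)[OF \<delta>(1,2)])
  obtain e where e: "e > 0" "\<And>x. \<bar>x\<bar> < e \<Longrightarrow> \<bar>\<sigma> x\<bar> < \<delta>"
    using DERIV_isCont[OF \<sigma>(3)] \<delta>(1) \<sigma>(2) unfolding continuous_at_eps_delta by (force simp: dist_real_def)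
  define \<rho>1 where "\<rho>1 = min e \<delta> / 2"
  have \<rho>1: "0 < \<rho>1" "\<rho>1 < \<delta>" "\<rho>1 < e" using e \<delta> by (auto simp: \<rho>1_def)
  have partner: "\<exists>x. x * z < 0 \<and> \<bar>x\<bar> < \<delta> \<and> \<Gamma> x = \<Gamma> z" if z: "z \<noteq> 0" "\<bar>z\<bar> \<le> \<rho>1" for z
    using \<sigma>(4)[of z] e(2)[of z] z \<rho>1 \<delta> by (intro exI[of _ "\<sigma> z"]) (auto simp: mult.commute)
  have center_equal: "poly F x = poly F z"
    if "center X (0, 0)" "0 < x" "x < \<delta>" "- \<delta> < z" "z < 0" "\<Gamma> x = \<Gamma> z" for x z
    using tri
  proof (elim disjE)
    assume "\<forall>x z. 0 < x \<and> x < \<delta>1 \<and> - \<delta>1 < z \<and> z < 0 \<and> \<Gamma> x = \<Gamma> z \<longrightarrow> poly F x = poly F z"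
    then show ?thesis using that \<delta>(3) by simp
  next
    assume gt: "\<forall>x z. 0 < x \<and> x < \<delta>1 \<and> - \<delta>1 < z \<and> z < 0 \<and> \<Gamma> x = \<Gamma> z \<longrightarrow> poly F x > poly F z"
    have "\<not> center X (0, 0)"
      by (rule not_center[OF M lev \<rho>1(1,2) partner]) (use gt \<delta>(3) in auto)
    with that(1) show ?thesis by simp
  next
    \<comment> \<open>Reflecting \<open>y\<close> and reversing time replaces \<open>F\<close> by
      \<open>- F\<close>, which turns this case into the previous one.\<close>
    assume lt: "\<forall>x z. 0 < x \<and> x < \<delta>1 \<and> - \<delta>1 < z \<and> z < 0 \<and> \<Gamma> x = \<Gamma> z \<longrightarrow> poly F x < poly F z"
    interpret tr: lienard "- reflect_poly_arg \<phi>" "- F" g p q r "- ((-1) ^ p * a)" "- b" c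
      by (rule time_reflection_lienard)
    have "tr.level_data \<Gamma> \<delta>" using lev by (simp add: level_data_def tr.level_data_def)
    then have "\<not> center tr.X (0, 0)"
      by (rule tr.not_center[OF monodromy_time_reflection[OF M] _ \<rho>1(1,2) partner]) (use lt \<delta>(3) in auto)
    with center_reflections(1)[OF that(1)] show ?thesis by simp
  qed
  show ?thesis
  proof
    assume cen: "center X (0, 0)"
    have \<sigma>F: "poly F x = poly F (\<sigma> x)" if x: "x \<noteq> 0" "\<bar>x\<bar> < \<rho>1" for x
    proof -
      have s: "x * \<sigma> x < 0" "\<Gamma> (\<sigma> x) = \<Gamma> x" "\<bar>\<sigma> x\<bar> < \<delta>" "\<bar>x\<bar> < \<delta>"
        using \<sigma>(4)[of x] e(2)[of x] x \<rho>1 \<delta> by auto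
      show ?thesis
      proof (cases "x > 0")
        case True
        then have "\<sigma> x < 0" using s(1) by (simp add: mult_less_0_iff)
        then show ?thesis using True s by (intro center_equal[OF cen]) auto
      next
        case False
        then have "\<sigma> x > 0" "x < 0" using s(1) by (auto simp: mult_less_0_iff)
        then show ?thesis using s by (intro center_equal[OF cen, symmetric]) auto
      qed
    qed
    have dec: "decreasing_solution (poly F) G \<sigma>"
      unfolding decreasing_solution_def
    proof (intro conjI)
      have "poly F x = poly F (\<sigma> x) \<and> G x = G (\<sigma> x)" if "dist x 0 < \<rho>1" for x
      proof (cases "x = 0")
        case False
        then show ?thesis using \<sigma>F[of x] \<sigma>(4)[of x] that \<rho>1 \<delta> by (simp add: G\<Gamma> dist_real_def)
      qed (simp add: \<sigma>(2))
      then show "\<forall>\<^sub>F x in nhds 0. poly F x = poly F (\<sigma> x) \<and> G x = G (\<sigma> x)"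
        unfolding eventually_nhds_metric using \<rho>1(1) by blast
      show "\<exists>d<0. (\<sigma> has_real_derivative d) (at 0)" using \<sigma>(3) by (intro exI[of _ "-1"]) simp
    qed (rule \<sigma>(2))
    \<comment> \<open>Uniqueness needs only \<open>G\<close>: \<open>w x\<close> and
      \<open>\<sigma> x\<close> are on the same level and on the same side of \<open>0\<close>,
      where the level function is injective.\<close>
    have "\<forall>\<^sub>F x in nhds 0. w x = \<sigma> x" if w: "decreasing_solution (poly F) G w" for w
    proof -
      obtain e' where e': "e' > 0" "\<And>x. x \<noteq> 0 \<Longrightarrow> \<bar>x\<bar> < e' \<Longrightarrow> x * w x < 0 \<and> \<bar>w x\<bar> < \<delta> \<and> G x = G (w x)"
        using decreasing_solution_sides[OF w \<delta>(1)] by blast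
      have "w x = \<sigma> x" if x: "dist x 0 < min e' \<rho>1" for x
      proof (cases "x = 0")
        case True
        then show ?thesis using w \<sigma>(2) by (simp add: decreasing_solution_def)
      next
        case False
        have w': "x * w x < 0" "\<bar>w x\<bar> < \<delta>" "\<Gamma> x = \<Gamma> (w x)"
          using e'(2)[OF False] x by (auto simp: G\<Gamma> dist_real_def)
        have s: "x * \<sigma> x < 0" "\<Gamma> (\<sigma> x) = \<Gamma> x" "\<bar>\<sigma> x\<bar> < \<delta>"
          using \<sigma>(4)[OF False] e(2)[of x] x \<rho>1 \<delta> by (auto simp: dist_real_def)
        have "w x * \<sigma> x > 0" using w'(1) s(1) by (auto simp: mult_less_0_iff zero_less_mult_iff)
        then show ?thesis using level_data_inj[OF lev w'(2) s(3)] w'(3) s(2) by simp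
      qed
      then show ?thesis unfolding eventually_nhds_metric using e'(1) \<rho>1(1) by (intro exI[of _ "min e' \<rho>1"]) auto
    qed
    with dec show "unique_decreasing_solution (poly F) G" unfolding unique_decreasing_solution_def by blast
  next
    assume "unique_decreasing_solution (poly F) G"
    then obtain z where z: "decreasing_solution (poly F) G z" by (auto simp: unique_decreasing_solution_def)
    obtain e' where e': "e' > 0" "\<And>x. x \<noteq> 0 \<Longrightarrow> \<bar>x\<bar> < e' \<Longrightarrow> x * z x < 0 \<and> \<bar>z x\<bar> < \<delta>1 \<and> poly F x = poly F (z x) \<and> G x = G (z x)"
      using decreasing_solution_sides[OF z \<sigma>(1)] by blast
    \<comment> \<open>A single pair of points with equal \<open>F\<close> on a common level rules
      out both strict alternatives.\<close>
    define x where "x = min e' \<delta>1 / 2"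
    have x: "0 < x" "x < e'" "x < \<delta>1" using e'(1) \<sigma>(1) by (auto simp: x_def)
    have zx: "z x < 0" "- \<delta>1 < z x" "poly F x = poly F (z x)" "\<Gamma> x = \<Gamma> (z x)"
      using e'(2)[of x] x by (auto simp: G\<Gamma> mult_less_0_iff)
    have "\<forall>x z. 0 < x \<and> x < \<delta>1 \<and> - \<delta>1 < z \<and> z < 0 \<and> \<Gamma> x = \<Gamma> z \<longrightarrow> poly F x = poly F z"
      using tri
    proof (elim disjE)
      assume "\<forall>x z. 0 < x \<and> x < \<delta>1 \<and> - \<delta>1 < z \<and> z < 0 \<and> \<Gamma> x = \<Gamma> z \<longrightarrow> poly F x > poly F z"
      then have "poly F x > poly F (z x)" using x zx by blast
      with zx(3) show ?thesis by simp
    next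
      assume "\<forall>x z. 0 < x \<and> x < \<delta>1 \<and> - \<delta>1 < z \<and> z < 0 \<and> \<Gamma> x = \<Gamma> z \<longrightarrow> poly F x < poly F z"
      then have "poly F x < poly F (z x)" using x zx by blast
      with zx(3) show ?thesis by simp
    qed
    then show "center X (0, 0)"
      by (intro center_if_equal[OF M lev \<rho>1(1,2) partner]) (use \<delta>(3) in auto)
  qed
qed

end

section \<open>From the coefficient form to the theorem\<close>

lemma lowest_term_sum_monom:
  assumes "k \<le> n" "1 \<le> k" "u k \<noteq> 0"
  shows "lowest_term (\<Sum>i=k..n. monom (u i) i) k (u k)"
proof -
  define Q where "Q = (\<Sum>i=k..n. monom (u i) (i - k))"
  have "poly (\<Sum>i=k..n. monom (u i) i) x = x ^ k * poly Q x" for x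
    by (simp add: Q_def poly_sum poly_monom sum_distrib_left mult.left_commute flip: power_add)
  moreover have "poly Q 0 = u k"
  proof -
    have "poly Q 0 = (\<Sum>i=k..n. if i = k then u i else 0)"
      unfolding Q_def poly_sum poly_monom by (intro sum.cong) (auto simp: power_0_left)
    then show ?thesis using assms by simp
  qed
  ultimately show ?thesis unfolding lowest_term_def using assms by blast
qed

lemma interval_integral_poly_antiderivative:
  assumes "\<And>x. DERIV H x :> poly g x"
  shows "(LBINT s=0..ereal x. poly g s) = H x - H 0"
proof -
  have "(LBINT s=ereal 0..ereal x. poly g s) = H x - H 0"
    by (rule interval_integral_FTC_finite)
      (auto intro!: continuous_intros has_field_derivative_at_within[OF assms]
        simp: has_real_derivative_iff_has_vector_derivative[symmetric])
  then show ?thesis by (simp add: zero_ereal_def)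
qed

theorem theorem2p2:
  fixes a b c :: "nat \<Rightarrow> real"
    and p l q m r n :: nat
    and \<phi> F g :: "real poly"
    and G :: "real \<Rightarrow> real"
    and c_hat :: real
  assumes \<phi>: "\<phi> = (\<Sum>i=p..l. monom (a i) i)"
    and F: "F = (\<Sum>i=q..m. monom (b i) i)"
    and g: "g = (\<Sum>i=r..n. monom (c i) i)"
    and nonzero: "a p * b q * c r * a l * b m * c n \<noteq> 0"
    and p: "1 \<le> p" "p \<le> l"
    and q: "1 \<le> q" "q \<le> m"
    and r: "1 \<le> r" "r \<le> n"
    and a_p: "a p = -1"
    and c_hat: "c_hat = real q * \<bar>b q / (real p + 1)\<bar> powr ((real p + 1) / real p)"
    and G: "\<And>x. G x = (LBINT s=0..ereal x. poly g s)"
  shows "(monodromic (lienard_field \<phi> F g) (0, 0) \<longleftrightarrow>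
            (p * (r + 1) < q * (p + 1) \<and> odd p \<and> odd r \<and> c r < 0) \<or>
            (p * (r + 1) = q * (p + 1) \<and> odd p \<and> odd r \<and> c r < - c_hat)) \<and>
         (monodromic (lienard_field \<phi> F g) (0, 0) \<longrightarrow>
            (center (lienard_field \<phi> F g) (0, 0) \<longleftrightarrow>
               unique_decreasing_solution (poly F) G))"
proof -
  interpret lienard \<phi> F g p q r "a p" "b q" "c r"
    unfolding \<phi> F g by unfold_locales (use nonzero p q r in \<open>auto intro!: lowest_term_sum_monom\<close>)
  have mono_iff: "monodromic X (0, 0) \<longleftrightarrow> monodromy_condition"
    using characteristic_orbit_iff[OF a_p] X_zero
    by (simp add: monodromic_def has_characteristic_orbit_def zero_prod_def)
  \<comment> \<open>In (M2) the sign of \<open>c r\<close> is implied, since \<open>c_hat\<close> is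
    nonnegative.\<close>
  have "c r < 0" if "c r < - c_hat"
    by (rule less_le_trans[OF that]) (simp add: c_hat)
  then have "monodromy_condition \<longleftrightarrow>
            (p * (r + 1) < q * (p + 1) \<and> odd p \<and> odd r \<and> c r < 0) \<or>
            (p * (r + 1) = q * (p + 1) \<and> odd p \<and> odd r \<and> c r < - c_hat)"
    unfolding monodromy_condition_def c_hat[symmetric] using a_p by blast
  moreover have "center X (0, 0) \<longleftrightarrow> unique_decreasing_solution (poly F) G" if M: "monodromy_condition"
  proof (rule center_iff_unique_solution[OF M])
    obtain Q where Q: "\<And>x. DERIV (\<lambda>x. x ^ (r + 1) * poly Q x) x :> - poly g x"
      by (rule antiderivative) (rule that)
    have H: "DERIV (\<lambda>x. - (x ^ (r + 1) * poly Q x)) x :> poly g x" for x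
      using DERIV_minus[OF Q] by simp
    have G': "G x = - (x ^ (r + 1) * poly Q x)" for x
      unfolding G interval_integral_poly_antiderivative[OF H] by simp
    then have "G = (\<lambda>x. - (x ^ (r + 1) * poly Q x))" by (rule ext)
    then show "DERIV G x :> poly g x" "G 0 = 0" for x using H by simp_all
  qed
  ultimately show ?thesis unfolding mono_iff by blast
qed

end
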